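(* Let matrices $\Pi\in\mathcal{H}_{n+m}$, $N\in\mathbb{C}^{2n\times(n+m)}$ and $\Delta,\Sigma\in\mathcal{H}_2$ be given, and let $\mathbf{\Theta}=\mathbf{\Theta}(\Delta,\Sigma)$ and $\overline{\mathbf{\Theta}}=\overline{\mathbf{\Theta}}(\Delta,\Sigma)$ be the sets defined in the context. Suppose $\mathbf{\Theta}$ represents curves on the right half complex plane and $\overline{\mathbf{\Theta}}$ represents $\mathbf{\Theta}\cup\{\infty\}$. Define $S_\theta\triangleq(\Xi_\theta N)_\perp$. Then the following statements are equivalent: i) $S_\theta^*\Pi S_\theta<0$ for all $\theta\in\overline{\mathbf{\Theta}}(\Delta,\Sigma)$. ii) There exist $U,V\in\mathcal{H}_n$ such that $V>0$ and $$N^*(\Delta\otimes U+\Sigma\otimes V)N+\Pi<0.$$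
   Context: $\mathcal{H}_n$ is the set of $n\times n$ Hermitian matrices; for Hermitian $X$, $X>0$, $X\ge 0$, $X<0$, $X\le 0$ denote positive/negative (semi)definiteness. $X^*$ is the conjugate transpose and $\otimes$ is the Kronecker product. For a matrix $X$, $X_\perp$ denotes its null space, i.e. a matrix whose columns form a basis of the null space of $X$ (so $XX_\perp=0$). For $\theta\in\mathbb{C}$ and $M\in\mathcal{H}_2$, $\rho(\theta,M)\triangleq\begin{bmatrix}\theta\\1\end{bmatrix}^*M\begin{bmatrix}\theta\\1\end{bmatrix}$. Define $\mathbf{\Theta}(\Delta,\Sigma)\triangleq\{\theta\in\mathbb{C}:\rho(\theta,\Delta)=0,\ \rho(\theta,\Sigma)\ge0\}$, and $\overline{\mathbf{\Theta}}\triangleq\mathbf{\Theta}$ if $\mathbf{\Theta}$ is bounded, $\overline{\mathbf{\Theta}}\triangleq\mathbf{\Theta}\cup\{\infty\}$ otherwise. A curve on the complex plane is a collection of infinitely many points $\theta(t)\in\mathbb{C}$ continuously parametrized by $t$ for $t_0\le t\le t_f$, where $t_0,t_f\in\mathbb{R}\cup\{\pm\infty\}$ and $t_0<t_f$. A set of complex numbers represents a curve (or curves) if it is a union of a finite number of curves. $\Xi_\theta\triangleq[\,I_n\ \ -\theta I_n\,]$ for $\theta\in\mathbb{C}$, and $\Xi_\infty\triangleq[\,0\ \ -I_n\,]$.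
   Formalization: A curve is required to be parametrized injectively on the open parameter interval (end points may coincide); otherwise space-filling images count as curves, and the claim fails for Δ = 0, Σ = [0 1; 1 0], where Θ is the closed right half plane. *)

theory Defs
  imports
    "HOL-Library.Extended_Real"
    "HOL-Analysis.Elementary_Metric_Spaces"
    "Jordan_Normal_Form.Matrix_Kernel"
    "Jordan_Normal_Form.Schur_Decomposition"
begin

definition hermitian_mats :: "nat \<Rightarrow> complex mat set" where
  "hermitian_mats n = {X \<in> carrier_mat n n. mat_adjoint X = X}"

(* (X v) \<bullet>c v is v^* X v; the order on complex is the one of HOL-Library.Complex_Order. *)

definition pos_def :: "complex mat \<Rightarrow> bool" where
  "pos_def X \<longleftrightarrow> X \<in> hermitian_mats (dim_row X) \<and>
     (\<forall>v \<in> carrier_vec (dim_row X). v \<noteq> 0\<^sub>v (dim_row X) \<longrightarrow> (X *\<^sub>v v) \<bullet>c v > 0)"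

definition neg_def :: "complex mat \<Rightarrow> bool" where
  "neg_def X \<longleftrightarrow> X \<in> hermitian_mats (dim_row X) \<and>
     (\<forall>v \<in> carrier_vec (dim_row X). v \<noteq> 0\<^sub>v (dim_row X) \<longrightarrow> (X *\<^sub>v v) \<bullet>c v < 0)"

definition kronecker :: "'a :: times mat \<Rightarrow> 'a mat \<Rightarrow> 'a mat"  (infixl \<open>\<otimes>\<^sub>K\<close> 71) where
  "A \<otimes>\<^sub>K B = mat (dim_row A * dim_row B) (dim_col A * dim_col B)
     (\<lambda>(i, j). A $$ (i div dim_row B, j div dim_col B) * B $$ (i mod dim_row B, j mod dim_col B))"

(* The columns of S, listed without repetition, form a basis of the null space of A.
   S has no columns when the null space is trivial. *)
definition is_null_basis :: "complex mat \<Rightarrow> complex mat \<Rightarrow> bool" where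
  "is_null_basis A S \<longleftrightarrow> dim_row S = dim_col A \<and> distinct (cols S) \<and>
     vectorspace.basis class_ring
       ((module_vec TYPE(complex) (dim_col A))\<lparr>carrier := mat_kernel A\<rparr>) (set (cols S))"

definition rho :: "complex \<Rightarrow> complex mat \<Rightarrow> complex" where
  "rho \<theta> M = (M *\<^sub>v vec_of_list [\<theta>, 1]) \<bullet>c vec_of_list [\<theta>, 1]"

definition Theta :: "complex mat \<Rightarrow> complex mat \<Rightarrow> complex set" where
  "Theta D Sg = {\<theta>. rho \<theta> D = 0 \<and> rho \<theta> Sg \<ge> 0}"

datatype ext_complex = Fin complex | Infty

definition Theta_bar :: "complex mat \<Rightarrow> complex mat \<Rightarrow> ext_complex set" where
  "Theta_bar D Sg =
     (if bounded (Theta D Sg) then Fin ` Theta D Sg else insert Infty (Fin ` Theta D Sg))"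

(* The parameter interval is closed, infinite end points being approached but not attained.
   A parametrization is not allowed to retrace itself (the end points of a closed curve may
   coincide). Without injectivity, space-filling images such as a disc or a half plane
   would count as curves. *)
definition is_curve :: "complex set \<Rightarrow> bool" where
  "is_curve C \<longleftrightarrow> (\<exists>(\<gamma> :: real \<Rightarrow> complex) (t0 :: ereal) (tf :: ereal).
     t0 < tf \<and>
     continuous_on {t. t0 \<le> ereal t \<and> ereal t \<le> tf} \<gamma> \<and>
     inj_on \<gamma> {t. t0 < ereal t \<and> ereal t < tf} \<and>
     C = \<gamma> ` {t. t0 \<le> ereal t \<and> ereal t \<le> tf} \<and> infinite C)"

definition represents_curves :: "complex set \<Rightarrow> bool" where
  "represents_curves A \<longleftrightarrow>
     (\<exists>\<C>. finite \<C> \<and> \<C> \<noteq> {} \<and> (\<forall>C \<in> \<C>. is_curve C) \<and> A = \<Union>\<C>)"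

(* Block rows [I, -\<theta> I] and [0, -I]: the lower blocks have no rows. *)
fun Xi :: "nat \<Rightarrow> ext_complex \<Rightarrow> complex mat" where
  "Xi n (Fin \<theta>) = four_block_mat (1\<^sub>m n) (- (\<theta> \<cdot>\<^sub>m 1\<^sub>m n)) (0\<^sub>m 0 n) (0\<^sub>m 0 n)"
| "Xi n Infty = four_block_mat (0\<^sub>m n n) (- (1\<^sub>m n)) (0\<^sub>m 0 n) (0\<^sub>m 0 n)"

end

theory Submission
  imports "HOL-Analysis.Urysohn" "HOL-Analysis.Further_Topology"
    "Jordan_Normal_Form.Spectral_Radius" Defs
begin

text \<open>
  If \<open>\<Theta>\<close> is unbounded and represents curves, it is cut out of a line by a quadratic inequality:
  \<open>\<Delta> = 0\<close> would give \<open>\<Theta>\<close> interior points, which is impossible for a finite union of injective curves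
  (Baire category and invariance of dimension). Split \<open>N\<close> into block rows \<open>F\<close>, \<open>G\<close>. Statement (i) says that
  \<open>w\<^sup>* \<Pi> w < 0\<close> for all nonzero \<open>w\<close> with \<open>G w = 0\<close> or \<open>F w = \<theta> G w\<close>, \<open>\<theta> \<in> \<Theta>\<close>, and evaluating (ii)
  at such \<open>w\<close> gives (i).

  For the converse, minimise the distance to the origin over a compact convex set of values
  \<open>(\<Phi>(H), \<Psi>(H) - Y, tr(\<Pi> H) - t)\<close> with \<open>H, Y, t \<ge> 0\<close> of total trace one, where \<open>\<Phi>\<close> and \<open>\<Psi>\<close> are the adjoints
  of \<open>U \<mapsto> N\<^sup>* (\<Delta> \<otimes> U) N\<close> and \<open>V \<mapsto> N\<^sup>* (\<Sigma> \<otimes> V) N\<close>. A minimiser different from the origin is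
  a multiplier \<open>(U, V)\<close> up to scaling. The origin is not attained because a positive semidefinite \<open>H\<close> with
  \<open>\<Phi>(H) = 0\<close> and \<open>\<Psi>(H) \<ge> 0\<close> is a sum of \<open>w w\<^sup>*\<close> with \<open>w\<close> as in (i): a real linear change of the
  pair \<open>(F, G)\<close> turns the constraints into \<open>F H G\<^sup>*\<close> being Hermitian, or Hermitian and positive semidefinite,
  and vectors \<open>w\<close> are split off \<open>H\<close> one at a time as eigenvectors.
\<close>

text \<open>A positive semidefinite \<open>H\<close> is always carried as
  \<open>Z * mat_adjoint Z\<close>. Positivity is then built in, and splitting off a vector means
  removing one column of \<open>Z\<close>. The price is that values depend on \<open>Z\<close>
  quadratically, so separation is done for convex images instead of convex domains.

  Plain separation would give a nonzero multiplier with weak inequalities only. The slacks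
  \<open>Y\<close> and \<open>t\<close> belong to the normalised set so that points with a single
  nonzero component can be tested: \<open>t\<close> fixes a strict sign for the coefficient of
  \<Pi>, \<open>Y\<close> makes \<open>V\<close> strictly definite, and rank-one \<open>H\<close>
  give the strict matrix inequality. Taking the point nearest to the origin as functional also makes
  \<open>U\<close> and \<open>V\<close> Hermitian, being values of maps that produce Hermitian
  matrices.

  Vectors with \<open>G w = 0\<close> have ratio infinity. Both the splitting step and the Moebius
  change can produce them, and this is where statement (i) at infinity enters.\<close>

no_notation Finite_Cartesian_Product.vec_nth (infixl \<open>$\<close> 90)
hide_type (open) Finite_Cartesian_Product.vec
hide_const (open) Finite_Cartesian_Product.mat Finite_Cartesian_Product.vec
  Finite_Cartesian_Product.row
no_notation Inner_Product.real_inner_class.inner (infix \<open>\<bullet>\<close> 70)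

section \<open>Curves have empty interior\<close>

text \<open>A continuous injection on a compact set is a homeomorphism onto its image, so an open
  set inside the image would embed into the line, against invariance of dimension.\<close>

lemma interior_injective_compact_image_empty:
  fixes \<gamma> :: "real \<Rightarrow> complex"
  assumes "compact T" "continuous_on T \<gamma>" "inj_on \<gamma> T"
  shows "interior (\<gamma> ` T) = {}"
proof (rule ccontr)
  assume ne: "interior (\<gamma> ` T) \<noteq> {}"
  obtain g where g: "homeomorphism T (\<gamma> ` T) \<gamma> g"
    using homeomorphism_compact[OF assms(1,2) refl assms(3)] by blast
  have "continuous_on (interior (\<gamma> ` T)) g" "inj_on g (interior (\<gamma> ` T))"
    using g interior_subset[of "\<gamma> ` T"]
    by (auto simp: homeomorphism_def intro: continuous_on_subset inj_on_inverseI)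
  then have "DIM(complex) \<le> DIM(real)"
    using invariance_of_dimension open_interior ne by blast
  then show False by simp
qed

text \<open>The image of a curve need not be closed, and injectivity is known only away from the end
  points. Baire's theorem is prepared by cutting the curve into compact pieces: injective images of
  compact intervals, and single points.\<close>

lemma is_curve_sigma_compact:
  assumes "is_curve C"
  shows "\<exists>\<G>. countable \<G> \<and> C = \<Union>\<G> \<and> (\<forall>K\<in>\<G>. compact K \<and> interior K = {})"
proof -
  from assms obtain \<gamma> :: "real \<Rightarrow> complex" and t0 tf :: ereal where
    c: "continuous_on {t. t0 \<le> ereal t \<and> ereal t \<le> tf} \<gamma>"
    and i: "inj_on \<gamma> {t. t0 < ereal t \<and> ereal t < tf}"
    and C: "C = \<gamma> ` {t. t0 \<le> ereal t \<and> ereal t \<le> tf}"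
    unfolding is_curve_def by blast
  define I where "I = {t. t0 < ereal t \<and> ereal t < tf}"
  \<comment> \<open>Only attained end points are collected; an infinite end contributes
    none.\<close>
  define E where "E = {t. t0 = ereal t \<or> tf = ereal t} \<inter> {t. t0 \<le> ereal t \<and> ereal t \<le> tf}"
  have "E \<subseteq> {real_of_ereal t0, real_of_ereal tf}" unfolding E_def by auto
  then have finE: "finite E" using finite_subset by blast
  have "open I"
  proof -
    have "I = ereal -` {t0<..<tf}" unfolding I_def by auto
    then show ?thesis by (simp add: open_ereal_vimage)
  qed
  obtain \<D> where D: "countable \<D>" "\<D> \<subseteq> Pow I" "\<And>X. X \<in> \<D> \<Longrightarrow> \<exists>a b. X = cbox a b" "\<Union>\<D> = I"
    using open_countable_Union_open_cbox[OF \<open>open I\<close>] by metis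
  define \<G> where "\<G> = (\<lambda>X. \<gamma> ` X) ` \<D> \<union> (\<lambda>t. {\<gamma> t}) ` E"
  have "{t. t0 \<le> ereal t \<and> ereal t \<le> tf} = I \<union> E"
    unfolding I_def E_def by auto
  then have "C = \<Union>\<G>" unfolding C \<G>_def D(4)[symmetric] by auto
  moreover have "countable \<G>" unfolding \<G>_def using D(1) finE by (simp add: countable_finite)
  moreover have "compact K \<and> interior K = {}" if K: "K \<in> \<G>" for K
  proof -
    consider X where "X \<in> \<D>" "K = \<gamma> ` X" | t where "K = {\<gamma> t}"
      using K unfolding \<G>_def by auto
    then show ?thesis
    proof cases
      case 1
      have X: "compact X" "X \<subseteq> I" using D(2) D(3)[OF 1(1)] 1(1) by auto
      have "continuous_on X \<gamma>"
        using X(2) by (intro continuous_on_subset[OF c]) (auto simp: I_def)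
      moreover have "inj_on \<gamma> X" using X(2) i unfolding I_def by (rule inj_on_subset[rotated])
      ultimately show ?thesis unfolding 1(2)
        using X(1) interior_injective_compact_image_empty compact_continuous_image by blast
    next
      case 2
      then show ?thesis by simp
    qed
  qed
  ultimately show ?thesis by blast
qed

lemma represents_curves_interior_empty:
  assumes "represents_curves A"
  shows "interior A = {}"
proof -
  obtain \<C> where C: "finite \<C>" "\<forall>C \<in> \<C>. is_curve C" "A = \<Union>\<C>"
    using assms unfolding represents_curves_def by blast
  then obtain \<G> where G: "\<forall>C\<in>\<C>. countable (\<G> C) \<and> C = \<Union>(\<G> C) \<and> (\<forall>K\<in>\<G> C. compact K \<and> interior K = {})"
    using is_curve_sigma_compact by metis
  have "euclidean interior_of \<Union>(\<Union>(\<G> ` \<C>)) = {}"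
  proof (rule Baire_category_alt)
    show "completely_metrizable_space (euclidean :: complex topology) \<or>
      locally_compact_space (euclidean :: complex topology) \<and> regular_space (euclidean :: complex topology)"
      by (simp add: completely_metrizable_space_euclidean)
    show "countable (\<Union>(\<G> ` \<C>))" using G C(1) by (simp add: countable_finite)
    show "closedin euclidean T \<and> euclidean interior_of T = {}" if "T \<in> \<Union>(\<G> ` \<C>)" for T
      using that G by (auto simp: compact_imp_closed)
  qed
  moreover have "\<Union>(\<Union>(\<G> ` \<C>)) = (\<Union>C\<in>\<C>. \<Union>(\<G> C))" by blast
  moreover have "\<dots> = (\<Union>C\<in>\<C>. C)" using G by (intro SUP_cong) simp_all
  ultimately show ?thesis using C(3) by simp
qed

section \<open>Gram matrices\<close>

lemma mat_adjoint_carrier [simp]: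
  "A \<in> carrier_mat nr nc \<Longrightarrow> mat_adjoint (A :: complex mat) \<in> carrier_mat nc nr"
  by (auto simp: mat_adjoint_def)

lemma mat_adjoint_dim [simp]:
  "dim_row (mat_adjoint (A :: complex mat)) = dim_col A"
  "dim_col (mat_adjoint (A :: complex mat)) = dim_row A"
  by (auto simp: mat_adjoint_def)

lemma mat_adjoint_index [simp]:
  "i < dim_col A \<Longrightarrow> j < dim_row A \<Longrightarrow> mat_adjoint (A :: complex mat) $$ (i, j) = cnj (A $$ (j, i))"
  by (simp add: mat_adjoint_def mat_of_rows_index)

lemma mat_adjoint_adjoint [simp]: "mat_adjoint (mat_adjoint A) = (A :: complex mat)"
  by (rule eq_matI) auto

lemma mat_adjoint_mult:
  assumes "A \<in> carrier_mat a b" "B \<in> carrier_mat b c"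
  shows "mat_adjoint (A * B) = mat_adjoint B * mat_adjoint (A :: complex mat)"
  using assms by (intro eq_matI) (auto simp: scalar_prod_def mult.commute)

lemma scalar_prod_adjoint:
  assumes "A \<in> carrier_mat nr nc" "x \<in> carrier_vec nc" "y \<in> carrier_vec nr"
  shows "(A *\<^sub>v x) \<bullet>c y = x \<bullet>c (mat_adjoint A *\<^sub>v (y :: complex vec))"
proof -
  have "(A *\<^sub>v x) \<bullet>c y = (\<Sum>i<nr. \<Sum>j<nc. A $$ (i, j) * x $ j * cnj (y $ i))"
    using assms by (auto simp: scalar_prod_def sum_distrib_right lessThan_atLeast0 intro!: sum.cong)
  also have "\<dots> = (\<Sum>j<nc. \<Sum>i<nr. A $$ (i, j) * x $ j * cnj (y $ i))"
    by (rule sum.swap)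
  also have "\<dots> = x \<bullet>c (mat_adjoint A *\<^sub>v y)"
    using assms by (auto simp: scalar_prod_def sum_distrib_left lessThan_atLeast0 mult_ac intro!: sum.cong)
  finally show ?thesis .
qed

lemma cscalar_prod_commute:
  "x \<in> carrier_vec n \<Longrightarrow> y \<in> carrier_vec n \<Longrightarrow> y \<bullet>c x = cnj (x \<bullet>c (y :: complex vec))"
  by (auto simp: scalar_prod_def mult.commute)

lemma cscalar_prod_self:
  "(x :: complex vec) \<bullet>c x = complex_of_real (\<Sum>i<dim_vec x. (cmod (x $ i))\<^sup>2)"
  unfolding scalar_prod_def of_real_sum
  by (intro sum.cong) (auto simp: complex_norm_square simp del: of_real_power)

definition outer :: "complex vec \<Rightarrow> complex vec \<Rightarrow> complex mat" where
  "outer u v = mat (dim_vec u) (dim_vec v) (\<lambda>(i, j). u $ i * cnj (v $ j))"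

lemma outer_carrier [simp]:
  "u \<in> carrier_vec a \<Longrightarrow> v \<in> carrier_vec b \<Longrightarrow> outer u v \<in> carrier_mat a b"
  by (auto simp: outer_def)

lemma outer_dim [simp]: "dim_row (outer u v) = dim_vec u" "dim_col (outer u v) = dim_vec v"
  by (auto simp: outer_def)

lemma outer_index [simp]:
  "i < dim_vec u \<Longrightarrow> j < dim_vec v \<Longrightarrow> outer u v $$ (i, j) = u $ i * cnj (v $ j)"
  by (auto simp: outer_def)

lemma mult_outer:
  assumes "A \<in> carrier_mat a b" "u \<in> carrier_vec b"
  shows "A * outer u v = outer (A *\<^sub>v u) v"
  using assms by (intro eq_matI) (auto simp: scalar_prod_def sum_distrib_right mult.assoc)

lemma outer_mult_adjoint:
  assumes "A \<in> carrier_mat a b" "v \<in> carrier_vec b"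
  shows "outer u v * mat_adjoint A = outer u (A *\<^sub>v v)"
  using assms by (intro eq_matI) (auto simp: scalar_prod_def sum_distrib_left mult_ac)

lemma outer_mult_vec:
  assumes "y \<in> carrier_vec (dim_vec v)"
  shows "outer u v *\<^sub>v y = (y \<bullet>c v) \<cdot>\<^sub>v u"
  using assms by (intro eq_vecI) (auto simp: scalar_prod_def sum_distrib_left sum_distrib_right mult_ac)

lemma outer_zero [simp]:
  "outer u (0\<^sub>v n) = 0\<^sub>m (dim_vec u) n" "outer (0\<^sub>v n) u = 0\<^sub>m n (dim_vec u)"
  by (auto intro!: eq_matI)

lemma outer_smult:
  "outer (a \<cdot>\<^sub>v u) (b \<cdot>\<^sub>v v) = (a * cnj b) \<cdot>\<^sub>m outer u v"
  by (auto intro!: eq_matI)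

text \<open>\<open>Q\<close> is the Householder reflection \<open>I - c u u^*\<close> with
  \<open>u = q - e_r\<close> and \<open>c = 2 / (u^* u) = 1 / (1 - \<rho>)\<close>, deprived of its
  last column, which is \<open>q\<close>. The other columns complete \<open>q\<close> to an
  orthonormal basis. The reflection sends \<open>e_r\<close> to \<open>q\<close> because the last
  entry of \<open>q\<close> is real, and \<rho> \<le> 0 keeps the denominator away from
  zero.\<close>

lemma householder_columns_aux:
  assumes q: "q \<in> carrier_vec (Suc r)" and qq: "q \<bullet>c q = 1"
    and \<rho>: "q $ r = complex_of_real \<rho>" "\<rho> \<le> 0"
  shows "\<exists>Q \<in> carrier_mat (Suc r) r. Q * mat_adjoint Q = 1\<^sub>m (Suc r) - outer q q"
proof -
  define c where "c = complex_of_real (1 / (1 - \<rho>))"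
  define u where "u i = q $ i - (if i = r then 1 else 0)" for i
  \<comment> \<open>Only columns \<open>j < r\<close> are kept, where
    \<open>u j = q $ j\<close>.\<close>
  define Q where "Q = mat (Suc r) r (\<lambda>(i, j). (if i = j then 1 else 0) - c * u i * cnj (q $ j))"
  have c1: "c * (1 - complex_of_real \<rho>) = 1"
  proof -
    have "c * (1 - complex_of_real \<rho>) = complex_of_real (1 / (1 - \<rho>) * (1 - \<rho>))"
      by (simp only: c_def of_real_mult of_real_diff of_real_1)
    then show ?thesis using \<rho>(2) by simp
  qed
  have cc: "cnj c = c" by (simp add: c_def)
  have "(\<Sum>j<Suc r. q $ j * cnj (q $ j)) = 1"
    using qq q by (simp add: scalar_prod_def lessThan_atLeast0)
  then have nq: "(\<Sum>j<r. q $ j * cnj (q $ j)) = 1 - complex_of_real \<rho> * complex_of_real \<rho>"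
    by (simp add: \<rho>(1) algebra_simps)
  have "Q * mat_adjoint Q = 1\<^sub>m (Suc r) - outer q q"
  proof (rule eq_matI)
    fix i l assume "i < dim_row (1\<^sub>m (Suc r) - outer q q)" "l < dim_col (1\<^sub>m (Suc r) - outer q q)"
    then have i: "i < Suc r" and l: "l < Suc r" using q by auto
    have "(Q * mat_adjoint Q) $$ (i, l)
        = (\<Sum>j<r. ((if i = j then 1 else 0) - c * u i * cnj (q $ j)) *
                   ((if l = j then 1 else 0) - c * cnj (u l) * q $ j))"
      using i l by (auto simp: Q_def scalar_prod_def lessThan_atLeast0 cc intro!: sum.cong)
    also have "\<dots> = (\<Sum>j<r. (if i = j then (if l = j then 1 else 0) else 0)
         - c * cnj (u l) * (if i = j then q $ j else 0) - c * u i * (if l = j then cnj (q $ j) else 0)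
         + c * c * u i * cnj (u l) * (q $ j * cnj (q $ j)))"
      by (intro sum.cong) (auto simp: algebra_simps)
    also have "\<dots> = (if i < r \<and> i = l then 1 else 0) - c * cnj (u l) * (if i < r then q $ i else 0)
         - c * u i * (if l < r then cnj (q $ l) else 0)
         + c * c * u i * cnj (u l) * (1 - complex_of_real \<rho> * complex_of_real \<rho>)"
      unfolding nq[symmetric]
      by (simp add: sum.distrib sum_subtractf sum_distrib_left[symmetric] sum.delta')
    also have "\<dots> = (if i = l then 1 else 0) - q $ i * cnj (q $ l)"
    proof -
      let ?p = "complex_of_real \<rho>"
      have e1: "c * c * (1 - ?p * ?p) = c * (1 + ?p)"
      proof -
        have "c * c * (1 - ?p * ?p) = (c * (1 - ?p)) * (c * (1 + ?p))" by (simp add: algebra_simps)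
        then show ?thesis by (simp add: c1)
      qed
      have ir: "i < r \<or> i = r" and lr: "l < r \<or> l = r" using i l by auto
      then consider "i < r" "l < r" | "i < r" "l = r" | "i = r" "l < r" | "i = r" "l = r" by blast
      then show ?thesis
      proof cases
        case 1
        have "- c * cnj (q $ l) * q $ i - c * q $ i * cnj (q $ l)
           + c * c * q $ i * cnj (q $ l) * (1 - ?p * ?p)
           = q $ i * cnj (q $ l) * (c * c * (1 - ?p * ?p) - 2 * c)" by (simp add: algebra_simps)
        also have "\<dots> = - q $ i * cnj (q $ l) * (c * (1 - ?p))" unfolding e1 by (simp add: algebra_simps)
        finally show ?thesis using 1 unfolding c1 by (simp add: u_def)
      next
        case 2
        have "- c * (?p - 1) * q $ i + c * c * q $ i * (?p - 1) * (1 - ?p * ?p)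
           = q $ i * (?p - 1) * (c * c * (1 - ?p * ?p) - c)" by (simp add: algebra_simps)
        also have "\<dots> = - q $ i * ?p * (c * (1 - ?p))" unfolding e1 by (simp add: algebra_simps)
        finally show ?thesis using 2 unfolding c1 by (simp add: u_def \<rho>(1))
      next
        case 3
        have "- c * (?p - 1) * cnj (q $ l) + c * c * (?p - 1) * cnj (q $ l) * (1 - ?p * ?p)
           = cnj (q $ l) * (?p - 1) * (c * c * (1 - ?p * ?p) - c)" by (simp add: algebra_simps)
        also have "\<dots> = - ?p * cnj (q $ l) * (c * (1 - ?p))" unfolding e1 by (simp add: algebra_simps)
        finally show ?thesis using 3 unfolding c1 by (simp add: u_def \<rho>(1))
      next
        case 4
        have "c * c * (?p - 1) * (?p - 1) * (1 - ?p * ?p) = (c * (1 - ?p)) * (c * (1 - ?p)) * (1 - ?p * ?p)"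
          by (simp add: algebra_simps)
        then show ?thesis using 4 unfolding c1 by (simp add: u_def \<rho>(1))
      qed
    qed
    also have "\<dots> = (1\<^sub>m (Suc r) - outer q q) $$ (i, l)"
      using i l q by auto
    finally show "(Q * mat_adjoint Q) $$ (i, l) = (1\<^sub>m (Suc r) - outer q q) $$ (i, l)" .
  qed (use q in \<open>auto simp: Q_def\<close>)
  then show ?thesis by (intro bexI[of _ Q]) (auto simp: Q_def)
qed

text \<open>A phase factor changes \<open>q\<close> but not \<open>outer q q\<close>; it is chosen
  to make the last entry \<open>- cmod (q $ r)\<close>.\<close>

lemma unit_vec_complement:
  assumes q: "q \<in> carrier_vec (Suc r)" and qq: "q \<bullet>c q = 1"
  shows "\<exists>Q \<in> carrier_mat (Suc r) r. Q * mat_adjoint Q = 1\<^sub>m (Suc r) - outer q q"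
proof -
  define e where "e = (if q $ r = 0 then 1 else - cnj (sgn (q $ r)))"
  have "cmod e = 1" by (simp add: e_def norm_sgn)
  then have e: "e * cnj e = 1" by (simp add: complex_norm_square[symmetric])
  have er: "e * q $ r = complex_of_real (- cmod (q $ r))"
    by (simp add: e_def sgn_div_norm scaleR_conv_of_real complex_norm_square[symmetric] power2_eq_square
        mult.commute[of "cnj _"] field_simps)
  have "(e \<cdot>\<^sub>v q) \<bullet>c (e \<cdot>\<^sub>v q) = (e * cnj e) * (q \<bullet>c q)"
    using q by (simp add: conjugate_smult_vec mult_ac)
  then have "\<exists>Q \<in> carrier_mat (Suc r) r. Q * mat_adjoint Q = 1\<^sub>m (Suc r) - outer (e \<cdot>\<^sub>v q) (e \<cdot>\<^sub>v q)"
    using q er e qq by (intro householder_columns_aux[where \<rho> = "- cmod (q $ r)"]) auto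
  moreover have "outer (e \<cdot>\<^sub>v q) (e \<cdot>\<^sub>v q) = outer q q"
    unfolding outer_smult e by (rule eq_matI) auto
  ultimately show ?thesis by simp
qed

lemma unit_vec_of_nonzero:
  assumes "q \<in> carrier_vec r" "q \<noteq> 0\<^sub>v r"
  obtains a :: real where "a > 0" "(complex_of_real a \<cdot>\<^sub>v q) \<bullet>c (complex_of_real a \<cdot>\<^sub>v q) = 1"
proof -
  define N where "N = (\<Sum>i<dim_vec q. (cmod (q $ i))\<^sup>2)"
  have N: "q \<bullet>c q = complex_of_real N" unfolding N_def by (rule cscalar_prod_self)
  have "N \<noteq> 0" using conjugate_square_eq_0_vec[OF assms(1)] assms(2) N by auto
  moreover have "N \<ge> 0" unfolding N_def by (intro sum_nonneg) auto
  ultimately have "N > 0" by simp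
  define a where "a = 1 / sqrt N"
  have "a * a * N = 1" using \<open>N > 0\<close> by (simp add: a_def)
  moreover have "(complex_of_real a \<cdot>\<^sub>v q) \<bullet>c (complex_of_real a \<cdot>\<^sub>v q) = complex_of_real (a * a * N)"
    using assms(1) by (simp add: conjugate_smult_vec N)
  ultimately show thesis using that[of a] \<open>N > 0\<close> by (simp add: a_def)
qed

text \<open>Sandwiching \<open>Q * mat_adjoint Q = 1 - outer q q\<close> between \<open>Z\<close>
  and its adjoint shows that \<open>Z * Q\<close> works. A rank-one term is traded for a column,
  which drives the inductions below.\<close>

lemma peel_column:
  assumes Z: "Z \<in> carrier_mat k (Suc r)" and q: "q \<in> carrier_vec (Suc r)" "q \<bullet>c q = 1"
  shows "\<exists>Z' \<in> carrier_mat k r. Z' * mat_adjoint Z' = Z * mat_adjoint Z - outer (Z *\<^sub>v q) (Z *\<^sub>v q)"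
proof -
  obtain Q where Q: "Q \<in> carrier_mat (Suc r) r" "Q * mat_adjoint Q = 1\<^sub>m (Suc r) - outer q q"
    using unit_vec_complement[OF q] by blast
  have aQ: "mat_adjoint Q \<in> carrier_mat r (Suc r)" and aZ: "mat_adjoint Z \<in> carrier_mat (Suc r) k"
    using Q Z by auto
  have "(Z * Q) * mat_adjoint (Z * Q) = Z * Q * (mat_adjoint Q * mat_adjoint Z)"
    using mat_adjoint_mult[OF Z Q(1)] by simp
  also have "\<dots> = Z * Q * mat_adjoint Q * mat_adjoint Z"
    using Z Q(1) aQ aZ by (intro assoc_mult_mat[symmetric]) auto
  also have "Z * Q * mat_adjoint Q = Z * (Q * mat_adjoint Q)"
    using Z Q(1) aQ by (intro assoc_mult_mat) auto
  also have "\<dots> = Z - outer (Z *\<^sub>v q) q"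
    unfolding Q(2) using Z q(1) by (subst mult_minus_distrib_mat[of _ k "Suc r"]) (auto simp: mult_outer)
  also have "\<dots> * mat_adjoint Z = Z * mat_adjoint Z - outer (Z *\<^sub>v q) q * mat_adjoint Z"
    using Z q(1) aZ by (intro minus_mult_distrib_mat) auto
  also have "outer (Z *\<^sub>v q) q * mat_adjoint Z = outer (Z *\<^sub>v q) (Z *\<^sub>v q)"
    using Z q(1) by (rule outer_mult_adjoint)
  finally show ?thesis using Z Q(1) by (intro bexI[of _ "Z * Q"]) auto
qed

lemma wide_mat_kernel:
  assumes Z: "(Z :: complex mat) \<in> carrier_mat k r" and kr: "k < r"
  obtains q where "q \<in> carrier_vec r" "q \<noteq> 0\<^sub>v r" "Z *\<^sub>v q = 0\<^sub>v k"
proof -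
  \<comment> \<open>Zero rows are put below \<open>Z\<close>. Row \<open>k\<close> of
    \<open>S\<close> vanishes, so the transpose kills \<open>unit_vec r k\<close> and
    \<open>S\<close> is singular.\<close>
  define S where "S = mat r r (\<lambda>(i, j). if i < k then Z $$ (i, j) else 0)"
  have S: "S \<in> carrier_mat r r" by (simp add: S_def)
  have "transpose_mat S *\<^sub>v unit_vec r k = 0\<^sub>v r"
    using kr by (intro eq_vecI) (auto simp: S_def)
  then have "det (transpose_mat S) = 0"
    using det_0_iff_vec_prod_zero[of "transpose_mat S" r] S kr unit_vec_nonzero[of k r]
    by (metis transpose_carrier_mat unit_vec_carrier)
  then have "det S = 0" using det_transpose[OF S] by simp
  then obtain q where q: "q \<in> carrier_vec r" "q \<noteq> 0\<^sub>v r" "S *\<^sub>v q = 0\<^sub>v r"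
    using det_0_iff_vec_prod_zero[OF S] by blast
  have "Z *\<^sub>v q = 0\<^sub>v k"
  proof (rule eq_vecI)
    fix i assume "i < dim_vec (0\<^sub>v k :: complex vec)"
    then have i: "i < k" by simp
    have "(S *\<^sub>v q) $ i = 0" using q(3) i kr by simp
    moreover have "row S i = row Z i" using i kr Z by (intro eq_vecI) (auto simp: S_def)
    ultimately show "(Z *\<^sub>v q) $ i = 0\<^sub>v k $ i" using i kr Z S by simp
  qed (use Z in auto)
  then show thesis using that q by blast
qed

text \<open>Lets Gram matrices of any width be parametrized by square factors. Surplus columns are
  peeled off along kernel vectors of \<open>Z\<close>, which leaves the Gram matrix unchanged;
  missing columns are filled with zeros.\<close>

lemma gram_square_factor:
  assumes "Z \<in> carrier_mat k r"
  shows "\<exists>Z' \<in> carrier_mat k k. Z' * mat_adjoint Z' = Z * mat_adjoint (Z :: complex mat)"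
  using assms
proof (induction r arbitrary: Z)
  case 0
  then show ?case
    by (intro bexI[of _ "0\<^sub>m k k"]) (auto intro!: eq_matI simp: scalar_prod_def)
next
  case (Suc r)
  show ?case
  proof (cases "k < Suc r")
    case True
    obtain q0 where q0: "q0 \<in> carrier_vec (Suc r)" "q0 \<noteq> 0\<^sub>v (Suc r)" "Z *\<^sub>v q0 = 0\<^sub>v k"
      using wide_mat_kernel[OF Suc.prems True] by blast
    obtain a :: real where a: "(complex_of_real a \<cdot>\<^sub>v q0) \<bullet>c (complex_of_real a \<cdot>\<^sub>v q0) = 1"
      using unit_vec_of_nonzero[OF q0(1,2)] by blast
    have "Z *\<^sub>v (complex_of_real a \<cdot>\<^sub>v q0) = 0\<^sub>v k"
      using Suc.prems q0 by (simp add: mult_mat_vec[OF Suc.prems]) (auto intro!: eq_vecI)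
    then obtain Z' where Z': "Z' \<in> carrier_mat k r" "Z' * mat_adjoint Z' = Z * mat_adjoint Z - 0\<^sub>m k k"
      using peel_column[OF Suc.prems _ a] q0(1) by auto
    have "Z * mat_adjoint Z - 0\<^sub>m k k = Z * mat_adjoint Z"
      using Suc.prems by (intro eq_matI) auto
    then show ?thesis using Suc.IH[OF Z'(1)] Z'(2) by simp
  next
    case False
    define Z' where "Z' = mat k k (\<lambda>(i, j). if j < Suc r then Z $$ (i, j) else 0)"
    have "Z' * mat_adjoint Z' = Z * mat_adjoint Z"
    proof (rule eq_matI)
      fix i j assume "i < dim_row (Z * mat_adjoint Z)" "j < dim_col (Z * mat_adjoint Z)"
      then have ij: "i < k" "j < k" using Suc.prems by auto
      have "(Z' * mat_adjoint Z') $$ (i, j)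
          = (\<Sum>l\<in>{0..<k}. if l < Suc r then Z $$ (i, l) * cnj (Z $$ (j, l)) else 0)"
        using ij by (auto simp: Z'_def scalar_prod_def intro!: sum.cong)
      also have "\<dots> = (\<Sum>l\<in>{0..<Suc r}. Z $$ (i, l) * cnj (Z $$ (j, l)))"
        using False by (intro sum.mono_neutral_cong_right) auto
      also have "\<dots> = (Z * mat_adjoint Z) $$ (i, j)"
        using ij Suc.prems by (auto simp: scalar_prod_def)
      finally show "(Z' * mat_adjoint Z') $$ (i, j) = (Z * mat_adjoint Z) $$ (i, j)" .
    qed (use Suc.prems in \<open>auto simp: Z'_def\<close>)
    then show ?thesis by (intro bexI[of _ Z']) (auto simp: Z'_def)
  qed
qed

text \<open>The wide matrix \<open>[sqrt a Z1, sqrt b Z2]\<close> has the required Gram matrix and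
  is then reduced to a square factor.\<close>

lemma gram_convex:
  assumes Z: "Z1 \<in> carrier_mat k k" "Z2 \<in> carrier_mat k k" and ab: "0 \<le> a" "0 \<le> b"
  shows "\<exists>Z \<in> carrier_mat k k. Z * mat_adjoint Z =
    complex_of_real a \<cdot>\<^sub>m (Z1 * mat_adjoint Z1) + complex_of_real b \<cdot>\<^sub>m (Z2 * mat_adjoint Z2)"
proof -
  define Z where "Z = mat k (k + k) (\<lambda>(i, j). if j < k then complex_of_real (sqrt a) * Z1 $$ (i, j)
    else complex_of_real (sqrt b) * Z2 $$ (i, j - k))"
  have sq: "complex_of_real (sqrt c) * complex_of_real (sqrt c) = complex_of_real c" if "c \<ge> 0" for c
    using that by (simp only: of_real_mult[symmetric] real_sqrt_mult_self abs_of_nonneg)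
  have "Z * mat_adjoint Z = complex_of_real a \<cdot>\<^sub>m (Z1 * mat_adjoint Z1) + complex_of_real b \<cdot>\<^sub>m (Z2 * mat_adjoint Z2)"
    (is "_ = ?R")
  proof (rule eq_matI)
    fix i j assume "i < dim_row ?R" "j < dim_col ?R"
    then have ij: "i < k" "j < k" using Z by auto
    let ?f = "\<lambda>l. Z $$ (i, l) * cnj (Z $$ (j, l))"
    have "(Z * mat_adjoint Z) $$ (i, j) = (\<Sum>l\<in>{0..<k + k}. ?f l)"
      using ij by (auto simp: Z_def scalar_prod_def intro!: sum.cong)
    also have "\<dots> = (\<Sum>l\<in>{0..<k}. ?f l) + (\<Sum>l\<in>{k..<k + k}. ?f l)"
      by (rule sum.atLeastLessThan_concat[symmetric]) auto
    also have "(\<Sum>l\<in>{k..<k + k}. ?f l) = (\<Sum>l\<in>{0..<k}. ?f (l + k))"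
      using sum.shift_bounds_nat_ivl[of ?f 0 k k] by simp
    also have "\<dots> = (\<Sum>l\<in>{0..<k}. complex_of_real b * (Z2 $$ (i, l) * cnj (Z2 $$ (j, l))))"
    proof (intro sum.cong refl)
      fix l assume "l \<in> {0..<k}"
      then have "?f (l + k) = complex_of_real (sqrt b) * complex_of_real (sqrt b) * (Z2 $$ (i, l) * cnj (Z2 $$ (j, l)))"
        using ij by (simp add: Z_def mult_ac)
      then show "?f (l + k) = complex_of_real b * (Z2 $$ (i, l) * cnj (Z2 $$ (j, l)))"
        unfolding sq[OF ab(2)] .
    qed
    also have "(\<Sum>l\<in>{0..<k}. ?f l) = (\<Sum>l\<in>{0..<k}. complex_of_real a * (Z1 $$ (i, l) * cnj (Z1 $$ (j, l))))"
    proof (intro sum.cong refl)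
      fix l assume "l \<in> {0..<k}"
      then have "?f l = complex_of_real (sqrt a) * complex_of_real (sqrt a) * (Z1 $$ (i, l) * cnj (Z1 $$ (j, l)))"
        using ij by (simp add: Z_def mult_ac)
      then show "?f l = complex_of_real a * (Z1 $$ (i, l) * cnj (Z1 $$ (j, l)))"
        unfolding sq[OF ab(1)] .
    qed
    also have "(\<Sum>l\<in>{0..<k}. complex_of_real a * (Z1 $$ (i, l) * cnj (Z1 $$ (j, l)))) +
        (\<Sum>l\<in>{0..<k}. complex_of_real b * (Z2 $$ (i, l) * cnj (Z2 $$ (j, l)))) = ?R $$ (i, j)"
      using ij Z by (auto simp: scalar_prod_def sum_distrib_left)
    finally show "(Z * mat_adjoint Z) $$ (i, j) = ?R $$ (i, j)" .
  qed (use Z in \<open>auto simp: Z_def\<close>)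
  moreover have "Z \<in> carrier_mat k (k + k)" by (simp add: Z_def)
  ultimately show ?thesis using gram_square_factor[of Z k "k + k"] by auto
qed

section \<open>Splitting off vectors of a Gram matrix\<close>

definition tr_prod :: "complex mat \<Rightarrow> complex mat \<Rightarrow> complex" where
  "tr_prod X Y = (\<Sum>i<dim_row X. \<Sum>j<dim_col X. X $$ (i, j) * Y $$ (j, i))"

lemma tr_prod_add:
  assumes "X \<in> carrier_mat n m" "Y \<in> carrier_mat m n" "Y' \<in> carrier_mat m n"
  shows "tr_prod X (Y + Y') = tr_prod X Y + tr_prod X Y'"
  using assms by (simp add: tr_prod_def sum.distrib ring_distribs)

lemma tr_prod_outer:
  assumes "P \<in> carrier_mat n n" "u \<in> carrier_vec n" "v \<in> carrier_vec n"
  shows "tr_prod P (outer u v) = (P *\<^sub>v u) \<bullet>c v"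
  using assms by (auto simp: tr_prod_def scalar_prod_def sum_distrib_right lessThan_atLeast0 mult.assoc intro!: sum.cong)

lemma minus_zero_mat: "A \<in> carrier_mat n m \<Longrightarrow> A - 0\<^sub>m n m = (A :: complex mat)"
  by (intro eq_matI) auto

lemma minus_add_cancel_mat:
  "A \<in> carrier_mat n m \<Longrightarrow> B \<in> carrier_mat n m \<Longrightarrow> A - B + B = (A :: complex mat)"
  by (intro eq_matI) auto

lemma gram_carrier:
  "Z \<in> carrier_mat k r \<Longrightarrow> Z * mat_adjoint (Z :: complex mat) \<in> carrier_mat k k"
  by auto

text \<open>The diagonal of the Gram matrix consists of the squared norms of the rows of
  \<open>Z\<close>.\<close>

lemma gram_eq_zero:
  assumes Z: "(Z :: complex mat) \<in> carrier_mat k r" and 0: "Z * mat_adjoint Z = 0\<^sub>m k k"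
  shows "Z = 0\<^sub>m k r"
proof (rule eq_matI)
  fix i j assume "i < dim_row (0\<^sub>m k r :: complex mat)" "j < dim_col (0\<^sub>m k r :: complex mat)"
  then have ij: "i < k" "j < r" by auto
  have "row Z i \<bullet>c row Z i = (Z * mat_adjoint Z) $$ (i, i)"
    using ij carrier_matD[OF Z] by (auto simp: scalar_prod_def)
  also have "\<dots> = 0" using 0 ij by simp
  finally have "row Z i = 0\<^sub>v r"
    using conjugate_square_eq_0_vec[of "row Z i" r] Z by auto
  then have "row Z i $ j = 0" using ij by simp
  then show "Z $$ (i, j) = 0\<^sub>m k r $$ (i, j)" using Z ij by simp
qed (use Z in auto)

text \<open>The form of \<open>mat_adjoint B * B\<close> at \<open>q\<close> is the squared norm of
  \<open>B q\<close>, so singularity of this product yields a kernel vector of \<open>B\<close>.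
  Otherwise \<open>Y = B * C\<close> with \<open>C\<close> its inverse.\<close>

lemma left_inverse_or_kernel:
  assumes B: "B \<in> carrier_mat n r"
  obtains (kernel) q where "q \<in> carrier_vec r" "q \<noteq> 0\<^sub>v r" "B *\<^sub>v q = 0\<^sub>v n"
  | (inverse) Y where "Y \<in> carrier_mat n r" "mat_adjoint B * Y = (1\<^sub>m r :: complex mat)"
proof (cases "det (mat_adjoint B * B) = 0")
  case True
  have BB: "mat_adjoint B * B \<in> carrier_mat r r" using B by auto
  obtain q where q: "q \<in> carrier_vec r" "q \<noteq> 0\<^sub>v r" "(mat_adjoint B * B) *\<^sub>v q = 0\<^sub>v r"
    using True det_0_iff_vec_prod_zero[OF BB] by blast
  have "(B *\<^sub>v q) \<bullet>c (B *\<^sub>v q) = q \<bullet>c ((mat_adjoint B * B) *\<^sub>v q)"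
    using B q(1) by (simp add: scalar_prod_adjoint[of _ n r] assoc_mult_mat_vec[of _ r n _ r])
  then have "B *\<^sub>v q = 0\<^sub>v n"
    using conjugate_square_eq_0_vec[of "B *\<^sub>v q" n] B q(1,3) by auto
  then show thesis using kernel q by blast
next
  case False
  have BB: "mat_adjoint B * B \<in> carrier_mat r r" using B by auto
  obtain C where C: "mat_adjoint B * B * C = 1\<^sub>m r" "C \<in> carrier_mat r r"
    using det_non_zero_imp_unit[OF BB False, of "()"]
    unfolding Units_def ring_mat_def by auto
  have "mat_adjoint B * (B * C) = 1\<^sub>m r"
    using assoc_mult_mat[of "mat_adjoint B" r n B r C r] C B by simp
  then show thesis by (rule inverse[rotated]) (use B C in simp)
qed

lemma complex_eigenvector_exists:
  assumes "(M :: complex mat) \<in> carrier_mat n n" "0 < n"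
  obtains \<sigma> q where "q \<in> carrier_vec n" "q \<noteq> 0\<^sub>v n" "M *\<^sub>v q = \<sigma> \<cdot>\<^sub>v q"
  using spectrum_non_empty[OF assms] assms(1)
  unfolding spectrum_def eigenvalue_def eigenvector_def by auto

text \<open>If \<open>A B\<^sup>*\<close> is Hermitian and \<open>B\<close> has a left inverse, then \<open>A = B M\<close>, and an eigenvector of
  \<open>M\<close> can be split off. The compression of the form to the complement of the eigenvector is the
  form itself evaluated at shifted vectors, so positivity survives.\<close>

lemma split_off_direction:
  assumes A: "A \<in> carrier_mat n (Suc r)" and B: "B \<in> carrier_mat n (Suc r)"
    and herm: "A * mat_adjoint B = B * mat_adjoint A"
    and psd: "\<And>y. nonneg \<Longrightarrow> y \<in> carrier_vec n \<Longrightarrow> 0 \<le> Re ((A * mat_adjoint B *\<^sub>v y) \<bullet>c y)"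
  obtains q s where "q \<in> carrier_vec (Suc r)" "q \<bullet>c q = 1"
    "B *\<^sub>v q = 0\<^sub>v n \<or> A *\<^sub>v q = complex_of_real s \<cdot>\<^sub>v (B *\<^sub>v q) \<and> (nonneg \<longrightarrow> 0 \<le> s)"
    "outer (A *\<^sub>v q) (B *\<^sub>v q) = outer (B *\<^sub>v q) (A *\<^sub>v q)"
    "\<And>y. nonneg \<Longrightarrow> y \<in> carrier_vec n \<Longrightarrow>
      0 \<le> Re (((A * mat_adjoint B - outer (A *\<^sub>v q) (B *\<^sub>v q)) *\<^sub>v y) \<bullet>c y)"
proof -
  let ?K = "A * mat_adjoint B"
  have aA: "mat_adjoint A \<in> carrier_mat (Suc r) n" and aB: "mat_adjoint B \<in> carrier_mat (Suc r) n"
    and K: "?K \<in> carrier_mat n n"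
    using A B by auto
  from B show thesis
  proof (cases rule: left_inverse_or_kernel)
    \<comment> \<open>With \<open>B q = 0\<close> nothing is subtracted from the form; this is the
      direction of ratio infinity.\<close>
    case (kernel q0)
    obtain a :: real where a: "(complex_of_real a \<cdot>\<^sub>v q0) \<bullet>c (complex_of_real a \<cdot>\<^sub>v q0) = 1"
      using unit_vec_of_nonzero[OF kernel(1,2)] by blast
    have 0: "B *\<^sub>v (complex_of_real a \<cdot>\<^sub>v q0) = 0\<^sub>v n"
      using B kernel by (simp add: mult_mat_vec[OF B]) (auto intro!: eq_vecI)
    have "?K - 0\<^sub>m n n = ?K" using K by (rule minus_zero_mat)
    then show thesis using that[OF _ a] 0 kernel(1) psd A by simp
  next
    case (inverse Y)
    \<comment> \<open>Multiplying \<open>A B^* = B A^*\<close> by \<open>Y\<close> on the right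
      gives \<open>A = B M\<close> with exactly this \<open>M\<close>.\<close>
    define M where "M = mat_adjoint A * Y"
    have M: "M \<in> carrier_mat (Suc r) (Suc r)" using aA inverse by (simp add: M_def)
    have "A = A * (mat_adjoint B * Y)" using inverse A by simp
    also have "\<dots> = ?K * Y" using A aB inverse(1) by (simp add: assoc_mult_mat[of _ n "Suc r"])
    also have "\<dots> = B * M" unfolding herm M_def
      using B aA inverse(1) by (simp add: assoc_mult_mat[of _ n "Suc r"])
    finally have ABM: "A = B * M" .
    obtain \<sigma> q0 where q0: "q0 \<in> carrier_vec (Suc r)" "q0 \<noteq> 0\<^sub>v (Suc r)" "M *\<^sub>v q0 = \<sigma> \<cdot>\<^sub>v q0"
      using complex_eigenvector_exists[OF M] by blast
    obtain a :: real where a: "(complex_of_real a \<cdot>\<^sub>v q0) \<bullet>c (complex_of_real a \<cdot>\<^sub>v q0) = 1"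
      using unit_vec_of_nonzero[OF q0(1,2)] by blast
    define q where "q = complex_of_real a \<cdot>\<^sub>v q0"
    have q: "q \<in> carrier_vec (Suc r)" "q \<bullet>c q = 1" using q0(1) a by (auto simp: q_def)
    have Mq: "M *\<^sub>v q = \<sigma> \<cdot>\<^sub>v q"
      using M q0 by (simp add: q_def mult_mat_vec smult_smult_assoc mult.commute)
    have Aq: "A *\<^sub>v q = \<sigma> \<cdot>\<^sub>v (B *\<^sub>v q)"
      using B M q(1) Mq unfolding ABM by (simp add: assoc_mult_mat_vec[of _ n "Suc r"] mult_mat_vec)
    \<comment> \<open>\<open>mat_adjoint B\<close> maps \<open>y0\<close> to \<open>q\<close>, so
      the form at \<open>y0\<close> evaluates to \<sigma> and, by hermiticity, also to
      \<open>cnj \<sigma>\<close>. The eigenvalue is real, and nonnegative if the form is.\<close>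
    define y0 where "y0 = Y *\<^sub>v q"
    have y0: "y0 \<in> carrier_vec n" using inverse(1) q(1) by (simp add: y0_def)
    have By0: "mat_adjoint B *\<^sub>v y0 = q"
      unfolding y0_def using assoc_mult_mat_vec[OF aB inverse(1) q(1)] inverse(2) q(1) by simp
    have Ay0: "mat_adjoint A *\<^sub>v y0 = \<sigma> \<cdot>\<^sub>v q"
      unfolding y0_def Mq[symmetric] M_def using assoc_mult_mat_vec[OF aA inverse(1) q(1)] by simp
    have form: "(?K *\<^sub>v y) \<bullet>c z = (mat_adjoint B *\<^sub>v y) \<bullet>c (mat_adjoint A *\<^sub>v z)"
      if "y \<in> carrier_vec n" "z \<in> carrier_vec n" for y z
      using A aB that by (simp add: assoc_mult_mat_vec[of _ n "Suc r"] scalar_prod_adjoint[of _ n "Suc r"])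
    have form': "(?K *\<^sub>v y) \<bullet>c z = (mat_adjoint A *\<^sub>v y) \<bullet>c (mat_adjoint B *\<^sub>v z)"
      if "y \<in> carrier_vec n" "z \<in> carrier_vec n" for y z
      unfolding herm
      using B aA that by (simp add: assoc_mult_mat_vec[of _ n "Suc r"] scalar_prod_adjoint[of _ n "Suc r"])
    have s0: "(?K *\<^sub>v y0) \<bullet>c y0 = cnj \<sigma>"
      using form[OF y0 y0] q By0 Ay0 by (simp add: conjugate_smult_vec)
    have s1: "(?K *\<^sub>v y0) \<bullet>c y0 = \<sigma>"
      using form'[OF y0 y0] q By0 Ay0 by simp
    define s where "s = Re \<sigma>"
    have \<sigma>: "\<sigma> = complex_of_real s"
      using s0 s1 unfolding s_def by (metis Reals_cnj_iff of_real_Re)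
    have s_nonneg: "0 \<le> s" if nonneg
      using psd[OF that y0] s1 by (simp add: s_def)
    have Aq': "A *\<^sub>v q = complex_of_real s \<cdot>\<^sub>v (B *\<^sub>v q)" using Aq \<sigma> by simp
    have Bq: "B *\<^sub>v q \<in> carrier_vec n" using B q by simp
    have out: "outer (A *\<^sub>v q) (B *\<^sub>v q) = outer (B *\<^sub>v q) (A *\<^sub>v q)"
      unfolding Aq' using Bq by (intro eq_matI) auto
    have "0 \<le> Re (((?K - outer (A *\<^sub>v q) (B *\<^sub>v q)) *\<^sub>v y) \<bullet>c y)" if nn: nonneg and y: "y \<in> carrier_vec n" for y
    proof -
      define c where "c = y \<bullet>c (B *\<^sub>v q)"
      have cc: "(B *\<^sub>v q) \<bullet>c y = cnj c" unfolding c_def using cscalar_prod_commute[OF y Bq] .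
      have Bcy: "mat_adjoint B *\<^sub>v y \<in> carrier_vec (Suc r)" and Acy: "mat_adjoint A *\<^sub>v y \<in> carrier_vec (Suc r)"
        using aB aA y by auto
      have xq: "(mat_adjoint B *\<^sub>v y) \<bullet>c q = c"
        unfolding c_def using scalar_prod_adjoint[OF aB y q(1)] by simp
      have qa: "q \<bullet>c (mat_adjoint A *\<^sub>v y) = \<sigma> * cnj c"
        using scalar_prod_adjoint[OF A q(1) y] Aq Bq y cc by simp
      \<comment> \<open>The shift makes the images of \<open>y'\<close> under both adjoints
        orthogonal to \<open>q\<close>; the form at \<open>y'\<close> then equals the peeled form at
        \<open>y\<close>.\<close>
      define y' where "y' = y - c \<cdot>\<^sub>v y0"
      have y': "y' \<in> carrier_vec n" using y y0 by (simp add: y'_def)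
      have By': "mat_adjoint B *\<^sub>v y' = mat_adjoint B *\<^sub>v y - c \<cdot>\<^sub>v q"
        unfolding y'_def using aB y y0 By0
        by (simp add: mult_minus_distrib_mat_vec[of _ "Suc r" n] mult_mat_vec)
      have Ay': "mat_adjoint A *\<^sub>v y' = mat_adjoint A *\<^sub>v y - (c * \<sigma>) \<cdot>\<^sub>v q"
        unfolding y'_def using aA y y0 Ay0
        by (simp add: mult_minus_distrib_mat_vec[of _ "Suc r" n] mult_mat_vec smult_smult_assoc)
      have conj_minus: "conjugate (u - d \<cdot>\<^sub>v q) = conjugate u - cnj d \<cdot>\<^sub>v conjugate q"
        if "u \<in> carrier_vec (Suc r)" for u d using that q by (intro eq_vecI) auto
      let ?x = "mat_adjoint B *\<^sub>v y" and ?a = "mat_adjoint A *\<^sub>v y"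
      have "(?K *\<^sub>v y') \<bullet>c y' = (?x - c \<cdot>\<^sub>v q) \<bullet>c (?a - (c * \<sigma>) \<cdot>\<^sub>v q)"
        using form[OF y' y'] By' Ay' by simp
      also have "\<dots> = ?x \<bullet>c ?a - cnj (c * \<sigma>) * (?x \<bullet>c q) - c * (q \<bullet>c ?a) + c * cnj (c * \<sigma>) * (q \<bullet>c q)"
        using Bcy Acy q(1)
        by (simp add: conj_minus minus_scalar_prod_distrib[of _ "Suc r"] scalar_prod_minus_distrib[of _ "Suc r"]
            algebra_simps)
      also have "\<dots> = (?K *\<^sub>v y) \<bullet>c y - \<sigma> * (c * cnj c)"
        unfolding xq qa q(2) form[OF y y] using \<sigma> by (simp add: algebra_simps)
      also have "\<dots> = ((?K - outer (A *\<^sub>v q) (B *\<^sub>v q)) *\<^sub>v y) \<bullet>c y"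
      proof -
        have "(?K - outer (A *\<^sub>v q) (B *\<^sub>v q)) *\<^sub>v y = ?K *\<^sub>v y - c \<cdot>\<^sub>v (A *\<^sub>v q)"
          using K A B y q(1) Bq
          by (subst minus_mult_distrib_mat_vec[of _ n n]) (auto simp: outer_mult_vec c_def)
        also have "\<dots> = ?K *\<^sub>v y - (c * \<sigma>) \<cdot>\<^sub>v (B *\<^sub>v q)" by (simp add: Aq smult_smult_assoc)
        also have "\<dots> \<bullet>c y = (?K *\<^sub>v y) \<bullet>c y - c * \<sigma> * ((B *\<^sub>v q) \<bullet>c y)"
          using K y Bq by (simp add: minus_scalar_prod_distrib[of _ n])
        finally show ?thesis by (simp add: cc algebra_simps)
      qed
      finally show ?thesis using psd[OF nn y'] by simp
    qed
    then show thesis using that[OF q] Aq' s_nonneg out by blast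
  qed
qed

text \<open>Induction on the columns of \<open>Z\<close>. The pair \<open>F * Z\<close>,
  \<open>G * Z\<close> supplies a unit vector \<open>q\<close>, and \<open>w = Z q\<close> is of the
  kind that \<open>neg\<close> controls. Peeling it off preserves both constraints and splits
  \<open>w^* P w\<close> off the trace. The flag \<open>nonneg\<close> lets one induction serve two
  uses: all real ratios for a full line, nonnegative ratios after the Moebius change.\<close>

lemma gram_decomposition:
  assumes P: "P \<in> carrier_mat k k" and F: "F \<in> carrier_mat n k" and G: "G \<in> carrier_mat n k"
    and neg: "\<And>w s. w \<in> carrier_vec k \<Longrightarrow> w \<noteq> 0\<^sub>v k \<Longrightarrow>
      G *\<^sub>v w = 0\<^sub>v n \<or> F *\<^sub>v w = complex_of_real s \<cdot>\<^sub>v (G *\<^sub>v w) \<and> (nonneg \<longrightarrow> 0 \<le> s) \<Longrightarrow>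
      Re ((P *\<^sub>v w) \<bullet>c w) < 0"
    and Z: "Z \<in> carrier_mat k r"
    and herm: "F * (Z * mat_adjoint Z) * mat_adjoint G = G * (Z * mat_adjoint Z) * mat_adjoint F"
    and psd: "\<And>y. nonneg \<Longrightarrow> y \<in> carrier_vec n \<Longrightarrow>
      0 \<le> Re ((F * (Z * mat_adjoint Z) * mat_adjoint G *\<^sub>v y) \<bullet>c y)"
  shows "Z = 0\<^sub>m k r \<or> Re (tr_prod P (Z * mat_adjoint Z)) < 0"
  using Z herm psd
proof (induction r arbitrary: Z)
  case 0
  then show ?case by (auto intro!: eq_matI)
next
  case (Suc r)
  let ?S = "Z * mat_adjoint Z" and ?A = "F * Z" and ?B = "G * Z"
  note Z = Suc.prems(1)
  have aZ: "mat_adjoint Z \<in> carrier_mat (Suc r) k" and aF: "mat_adjoint F \<in> carrier_mat k n"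
    and aG: "mat_adjoint G \<in> carrier_mat k n" and S: "?S \<in> carrier_mat k k"
    using Z F G by auto
  have AB: "X * Z * mat_adjoint (Y * Z) = X * ?S * mat_adjoint Y"
    if "X \<in> carrier_mat n k" "Y \<in> carrier_mat n k" for X Y
  proof -
    have "mat_adjoint (Y * Z) = mat_adjoint Z * mat_adjoint Y"
      using mat_adjoint_mult that Z by blast
    moreover have "mat_adjoint Y \<in> carrier_mat k n" using that by simp
    moreover have "X * Z * (mat_adjoint Z * mat_adjoint Y) = X * Z * mat_adjoint Z * mat_adjoint Y"
      using that Z aZ by (intro assoc_mult_mat[symmetric]) auto
    moreover have "X * Z * mat_adjoint Z = X * ?S"
      using that Z aZ by (intro assoc_mult_mat) auto
    ultimately show ?thesis by simp
  qed
  have K: "?A * mat_adjoint ?B = F * ?S * mat_adjoint G" "?B * mat_adjoint ?A = G * ?S * mat_adjoint F"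
    using AB[OF F G] AB[OF G F] .
  have A: "?A \<in> carrier_mat n (Suc r)" and B: "?B \<in> carrier_mat n (Suc r)" using F G Z by auto
  obtain q s where q: "q \<in> carrier_vec (Suc r)" "q \<bullet>c q = 1"
    "?B *\<^sub>v q = 0\<^sub>v n \<or> ?A *\<^sub>v q = complex_of_real s \<cdot>\<^sub>v (?B *\<^sub>v q) \<and> (nonneg \<longrightarrow> 0 \<le> s)"
    and out: "outer (?A *\<^sub>v q) (?B *\<^sub>v q) = outer (?B *\<^sub>v q) (?A *\<^sub>v q)"
    and psd': "\<And>y. nonneg \<Longrightarrow> y \<in> carrier_vec n \<Longrightarrow>
      0 \<le> Re (((?A * mat_adjoint ?B - outer (?A *\<^sub>v q) (?B *\<^sub>v q)) *\<^sub>v y) \<bullet>c y)"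
    using split_off_direction[OF A B, of nonneg] K Suc.prems(2,3) by metis
  define w where "w = Z *\<^sub>v q"
  have w: "w \<in> carrier_vec k" using Z q by (simp add: w_def)
  have Aw: "?A *\<^sub>v q = F *\<^sub>v w" and Bw: "?B *\<^sub>v q = G *\<^sub>v w"
    using F G Z q(1) by (auto simp: w_def)
  obtain Z' where Z': "Z' \<in> carrier_mat k r" "Z' * mat_adjoint Z' = ?S - outer w w"
    using peel_column[OF Z q(1,2)] unfolding w_def by blast
  have ow: "outer w w \<in> carrier_mat k k" using w by simp
  have peel: "X * (?S - outer w w) * mat_adjoint Y = X * ?S * mat_adjoint Y - outer (X *\<^sub>v w) (Y *\<^sub>v w)"
    if X: "X \<in> carrier_mat n k" and Y: "Y \<in> carrier_mat n k" for X Y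
  proof -
    have aY: "mat_adjoint Y \<in> carrier_mat k n" using Y by simp
    have "X * (?S - outer w w) = X * ?S - outer (X *\<^sub>v w) w"
      using mult_minus_distrib_mat[OF X S ow] mult_outer[OF X w] by simp
    then show ?thesis
      using minus_mult_distrib_mat[OF _ _ aY, of "X * ?S" n "outer (X *\<^sub>v w) w"]
        outer_mult_adjoint[OF Y w] X S w by simp
  qed
  have "Z' = 0\<^sub>m k r \<or> Re (tr_prod P (Z' * mat_adjoint Z')) < 0"
  proof (rule Suc.IH[OF Z'(1)])
    show "F * (Z' * mat_adjoint Z') * mat_adjoint G = G * (Z' * mat_adjoint Z') * mat_adjoint F"
      unfolding Z'(2) peel[OF F G] peel[OF G F] using Suc.prems(2) out Aw Bw by simp
    show "0 \<le> Re ((F * (Z' * mat_adjoint Z') * mat_adjoint G *\<^sub>v y) \<bullet>c y)"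
      if nonneg "y \<in> carrier_vec n" for y
      unfolding Z'(2) peel[OF F G] using psd'[OF that] K(1) Aw Bw by simp
  qed
  moreover have S_eq: "?S = Z' * mat_adjoint Z' + outer w w"
    unfolding Z'(2) using S ow by (rule minus_add_cancel_mat[symmetric])
  have tr: "tr_prod P ?S = tr_prod P (Z' * mat_adjoint Z') + (P *\<^sub>v w) \<bullet>c w"
    unfolding S_eq using P gram_carrier[OF Z'(1)] ow w
    by (simp add: tr_prod_add[of _ k k] tr_prod_outer[of _ k])
  have tr0: "tr_prod P (0\<^sub>m k r * mat_adjoint (0\<^sub>m k r)) = 0"
    using P by (simp add: tr_prod_def scalar_prod_def)
  show ?case
  \<comment> \<open>A zero \<open>w\<close> contributes nothing, so negativity must come from the
    remainder; if that is zero too, the Gram matrix of \<open>Z\<close> vanishes.\<close>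
  proof (cases "w = 0\<^sub>v k")
    case True
    show ?thesis
    proof (cases "Z' = 0\<^sub>m k r")
      case z: True
      have "?S = 0\<^sub>m k k" unfolding S_eq z using True by (intro eq_matI) (auto simp: scalar_prod_def)
      then show ?thesis using gram_eq_zero[OF Z] by simp
    next
      case False
      then show ?thesis using calculation tr True P by simp
    qed
  next
    case False
    have "Re ((P *\<^sub>v w) \<bullet>c w) < 0"
      using neg[OF w False] q(3) Aw Bw by metis
    then show ?thesis using calculation tr tr0 by auto
  qed
qed

section \<open>Block forms and separation\<close>

lemma hermitian_matsD:
  assumes "X \<in> hermitian_mats n"
  shows "X \<in> carrier_mat n n" "mat_adjoint X = X" "dim_row X = n" "dim_col X = n"
  using assms by (auto simp: hermitian_mats_def)

lemma hermitian_mats_cnj: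
  assumes "X \<in> hermitian_mats n" "i < n" "j < n"
  shows "cnj (X $$ (i, j)) = X $$ (j, i)"
  using mat_adjoint_index[of j X i] hermitian_matsD[OF assms(1)] assms(2,3) by simp

lemma hermitian_matsI:
  assumes "X \<in> carrier_mat n n" "\<And>i j. i < n \<Longrightarrow> j < n \<Longrightarrow> cnj (X $$ (j, i)) = X $$ (i, j)"
  shows "X \<in> hermitian_mats n"
  using assms unfolding hermitian_mats_def by (auto intro!: eq_matI)

lemma hermitian_form_real:
  assumes "X \<in> hermitian_mats n" "v \<in> carrier_vec n"
  shows "Im ((X *\<^sub>v v) \<bullet>c v) = 0"
proof -
  note X = hermitian_matsD[OF assms(1)]
  have "(X *\<^sub>v v) \<bullet>c v = v \<bullet>c (X *\<^sub>v v)"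
    using scalar_prod_adjoint[OF X(1) assms(2,2)] X(2) by simp
  also have "\<dots> = cnj ((X *\<^sub>v v) \<bullet>c v)"
    using cscalar_prod_commute[of "X *\<^sub>v v" n v] X(1) assms(2) by simp
  finally show ?thesis by (metis Reals_cnj_iff complex_is_Real_iff)
qed

lemma pos_def_iff:
  assumes "X \<in> hermitian_mats n"
  shows "pos_def X \<longleftrightarrow> (\<forall>v \<in> carrier_vec n. v \<noteq> 0\<^sub>v n \<longrightarrow> Re ((X *\<^sub>v v) \<bullet>c v) > 0)"
  unfolding pos_def_def using hermitian_matsD[OF assms] assms hermitian_form_real[OF assms]
  by (auto simp: less_complex_def)

lemma neg_def_iff:
  assumes "X \<in> hermitian_mats n"
  shows "neg_def X \<longleftrightarrow> (\<forall>v \<in> carrier_vec n. v \<noteq> 0\<^sub>v n \<longrightarrow> Re ((X *\<^sub>v v) \<bullet>c v) < 0)"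
  unfolding neg_def_def using hermitian_matsD[OF assms] assms hermitian_form_real[OF assms]
  by (auto simp: less_complex_def)

lemma gram_hermitian:
  assumes "Z \<in> carrier_mat k r" shows "Z * mat_adjoint Z \<in> hermitian_mats k"
  unfolding hermitian_mats_def using assms mat_adjoint_mult[of Z k r "mat_adjoint Z" k] by auto

text \<open>The point of least norm in the image works: if \<open>A x\<close> had inner product with
  \<open>A x0\<close> below the squared norm of \<open>A x0\<close>, a short move from
  \<open>A x0\<close> towards \<open>A x\<close> would come closer to the origin. Convexity is asked
  of the image, not of \<open>X\<close>, because \<open>X\<close> will consist of factors
  \<open>Z\<close>.\<close>

lemma strict_separation:
  fixes A :: "'a :: topological_space \<Rightarrow> 'i \<Rightarrow> complex"
  assumes X: "compact X" "X \<noteq> {}" and I: "finite I"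
    and cont: "\<And>i. i \<in> I \<Longrightarrow> continuous_on X (\<lambda>x. A x i)"
    and conv: "\<And>x y t. x \<in> X \<Longrightarrow> y \<in> X \<Longrightarrow> 0 \<le> t \<Longrightarrow> t \<le> 1 \<Longrightarrow>
      \<exists>z \<in> X. \<forall>i \<in> I. A z i = complex_of_real (1 - t) * A x i + complex_of_real t * A y i"
    and nz: "\<And>x. x \<in> X \<Longrightarrow> \<exists>i \<in> I. A x i \<noteq> 0"
  shows "\<exists>x0 \<in> X. \<forall>x \<in> X. 0 < Re (\<Sum>i \<in> I. A x i * cnj (A x0 i))"
proof -
  define J where "J x = (\<Sum>i\<in>I. (cmod (A x i))\<^sup>2)" for x
  have "continuous_on X J" unfolding J_def by (intro continuous_intros cont)
  then obtain x0 where x0: "x0 \<in> X" "\<And>x. x \<in> X \<Longrightarrow> J x0 \<le> J x"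
    using continuous_attains_inf[OF X] by blast
  have J0: "J x0 > 0"
  proof -
    obtain i where "i \<in> I" "A x0 i \<noteq> 0" using nz[OF x0(1)] by blast
    then show ?thesis unfolding J_def using I by (intro sum_pos2[of _ i]) auto
  qed
  have "J x0 \<le> Re (\<Sum>i \<in> I. A x i * cnj (A x0 i))" if x: "x \<in> X" for x
  proof (rule ccontr)
    define p where "p = Re (\<Sum>i \<in> I. A x i * cnj (A x0 i))"
    assume "\<not> ?thesis"
    then have p: "p < J x0" by (simp add: p_def)
    define c where "c = \<bar>J x0 - 2 * p + J x\<bar>"
    \<comment> \<open>Small enough for the gain \<open>2 * (J x0 - p)\<close> to outweigh
      \<open>t * c\<close>, which bounds the quadratic term; \<open>c + 1\<close> avoids a zero
      denominator.\<close>
    define t where "t = min 1 ((J x0 - p) / (c + 1))"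
    have c: "c \<ge> 0" by (simp add: c_def)
    have t: "0 < t" "t \<le> 1" using p c by (auto simp: t_def)
    have tc: "t * c < 2 * (J x0 - p)"
    proof -
      have "t \<le> (J x0 - p) / (c + 1)" by (simp add: t_def)
      then have "t * (c + 1) \<le> J x0 - p" using c by (subst (asm) pos_le_divide_eq) auto
      then show ?thesis using t p by (simp add: algebra_simps)
    qed
    obtain z where z: "z \<in> X" "\<forall>i \<in> I. A z i = complex_of_real (1 - t) * A x0 i + complex_of_real t * A x i"
      using conv[OF x0(1) x, of t] t by auto
    have sq: "(cmod (complex_of_real (1 - t) * a + complex_of_real t * b))\<^sup>2
        = (1 - t)\<^sup>2 * (cmod a)\<^sup>2 + 2 * t * (1 - t) * Re (b * cnj a) + t\<^sup>2 * (cmod b)\<^sup>2" for a b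
      unfolding cmod_power2 by (simp add: power2_eq_square algebra_simps)
    have "J z = (\<Sum>i\<in>I. (1 - t)\<^sup>2 * (cmod (A x0 i))\<^sup>2 + 2 * t * (1 - t) * Re (A x i * cnj (A x0 i))
        + t\<^sup>2 * (cmod (A x i))\<^sup>2)"
      unfolding J_def by (intro sum.cong refl) (simp only: z(2) sq)
    also have "\<dots> = (1 - t)\<^sup>2 * J x0 + 2 * t * (1 - t) * p + t\<^sup>2 * J x"
      unfolding J_def p_def Re_sum by (simp only: sum.distrib sum_distrib_left)
    also have "\<dots> = J x0 + t * (2 * (p - J x0) + t * (J x0 - 2 * p + J x))"
      by (simp add: power2_eq_square algebra_simps)
    also have "\<dots> < J x0"
    proof -
      have "t * (J x0 - 2 * p + J x) \<le> t * c" using t by (intro mult_left_mono) (auto simp: c_def)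
      then have "2 * (p - J x0) + t * (J x0 - 2 * p + J x) < 0" using tc by simp
      then show ?thesis using t by (simp add: mult_pos_neg)
    qed
    finally show False using x0(2)[OF z(1)] by simp
  qed
  then show ?thesis using x0(1) J0 by (meson less_le_trans)
qed

text \<open>Continuity is read entry by entry, so only the topology of the complex numbers is
  involved. The size is fixed outside \<open>X\<close> too, which frees index rewriting from
  membership premises.\<close>

definition entries_continuous :: "'a :: topological_space set \<Rightarrow> nat \<Rightarrow> nat \<Rightarrow> ('a \<Rightarrow> complex mat) \<Rightarrow> bool" where
  "entries_continuous X nr nc M \<longleftrightarrow>
    (\<forall>x. M x \<in> carrier_mat nr nc) \<and> (\<forall>i < nr. \<forall>j < nc. continuous_on X (\<lambda>x. M x $$ (i, j)))"

lemma entries_continuous_const: "A \<in> carrier_mat nr nc \<Longrightarrow> entries_continuous X nr nc (\<lambda>_. A)"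
  by (simp add: entries_continuous_def)

lemma entries_continuous_adjoint:
  "entries_continuous X nr nc M \<Longrightarrow> entries_continuous X nc nr (\<lambda>x. mat_adjoint (M x))"
proof -
  assume M: "entries_continuous X nr nc M"
  have "mat_adjoint (M x) $$ (i, j) = cnj (M x $$ (j, i))" if "i < nc" "j < nr" for x i j
  proof -
    have "M x \<in> carrier_mat nr nc" using M by (auto simp: entries_continuous_def)
    then show ?thesis using that by (intro mat_adjoint_index) auto
  qed
  then show ?thesis
    using M unfolding entries_continuous_def by (auto intro!: continuous_intros)
qed

lemma entries_continuous_mult:
  assumes "entries_continuous X a b M" "entries_continuous X b c N"
  shows "entries_continuous X a c (\<lambda>x. M x * N x)"
proof -
  have "(M x * N x) $$ (i, j) = (\<Sum>l\<in>{0..<b}. M x $$ (i, l) * N x $$ (l, j))" if "i < a" "j < c" for x i j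
  proof -
    have "M x \<in> carrier_mat a b" "N x \<in> carrier_mat b c" using assms by (auto simp: entries_continuous_def)
    then show ?thesis using that by (auto simp: scalar_prod_def)
  qed
  then show ?thesis
    using assms unfolding entries_continuous_def by (auto intro!: continuous_intros mult_carrier_mat)
qed

lemma entries_continuous_add:
  assumes "entries_continuous X a b M" "entries_continuous X a b N"
  shows "entries_continuous X a b (\<lambda>x. M x + N x)"
proof -
  have "(M x + N x) $$ (i, j) = M x $$ (i, j) + N x $$ (i, j)" if "i < a" "j < b" for x i j
  proof -
    have "M x \<in> carrier_mat a b" "N x \<in> carrier_mat a b" using assms by (auto simp: entries_continuous_def)
    then show ?thesis using that by auto
  qed
  then show ?thesis
    using assms unfolding entries_continuous_def by (auto intro!: continuous_intros)
qed

lemma entries_continuous_smult: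
  assumes "entries_continuous X a b M"
  shows "entries_continuous X a b (\<lambda>x. d \<cdot>\<^sub>m M x)"
proof -
  have "(d \<cdot>\<^sub>m M x) $$ (i, j) = d * M x $$ (i, j)" if "i < a" "j < b" for x i j
  proof -
    have "M x \<in> carrier_mat a b" using assms by (auto simp: entries_continuous_def)
    then show ?thesis using that by auto
  qed
  then show ?thesis
    using assms unfolding entries_continuous_def by (auto intro!: continuous_intros)
qed

lemma tr_prod_continuous:
  assumes "P \<in> carrier_mat k k" "entries_continuous X k k M"
  shows "continuous_on X (\<lambda>x. tr_prod P (M x))"
  using assms unfolding tr_prod_def entries_continuous_def by (auto intro!: continuous_intros)

text \<open>\<open>block_form D F G S\<close> is the adjoint of \<open>U \<mapsto> N\<^sup>* (D \<otimes> U) N\<close> at \<open>S\<close>, where \<open>N\<close> has the block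
  rows \<open>F\<close> and \<open>G\<close>.\<close>

definition block_form :: "complex mat \<Rightarrow> complex mat \<Rightarrow> complex mat \<Rightarrow> complex mat \<Rightarrow> complex mat" where
  "block_form D F G S =
    D $$ (0, 0) \<cdot>\<^sub>m (F * S * mat_adjoint F) + D $$ (0, 1) \<cdot>\<^sub>m (G * S * mat_adjoint F) +
    D $$ (1, 0) \<cdot>\<^sub>m (F * S * mat_adjoint G) + D $$ (1, 1) \<cdot>\<^sub>m (G * S * mat_adjoint G)"

lemma sandwich_carrier:
  "F \<in> carrier_mat n k \<Longrightarrow> S \<in> carrier_mat k k \<Longrightarrow> G \<in> carrier_mat n k \<Longrightarrow>
    F * S * mat_adjoint (G :: complex mat) \<in> carrier_mat n n"
  by (auto intro!: mult_carrier_mat)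

lemma block_form_carrier:
  "F \<in> carrier_mat n k \<Longrightarrow> G \<in> carrier_mat n k \<Longrightarrow> S \<in> carrier_mat k k \<Longrightarrow>
    block_form D F G S \<in> carrier_mat n n"
  unfolding block_form_def by (intro add_carrier_mat smult_carrier_mat sandwich_carrier)

lemma block_form_index:
  assumes "F \<in> carrier_mat n k" "G \<in> carrier_mat n k" "S \<in> carrier_mat k k" "i < n" "j < n"
  shows "block_form D F G S $$ (i, j) =
    D $$ (0, 0) * (F * S * mat_adjoint F) $$ (i, j) + D $$ (0, 1) * (G * S * mat_adjoint F) $$ (i, j) +
    D $$ (1, 0) * (F * S * mat_adjoint G) $$ (i, j) + D $$ (1, 1) * (G * S * mat_adjoint G) $$ (i, j)"
  using assms sandwich_carrier[OF assms(1,3,1)] sandwich_carrier[OF assms(1,3,2)]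
    sandwich_carrier[OF assms(2,3,1)] sandwich_carrier[OF assms(2,3,2)]
  unfolding block_form_def by (simp del: index_mult_mat add: carrier_matD)

lemma sandwich_linear:
  assumes F: "F \<in> carrier_mat n k" and G: "G \<in> carrier_mat n k" and S: "S \<in> carrier_mat k k" "T \<in> carrier_mat k k"
  shows "F * (a \<cdot>\<^sub>m S + b \<cdot>\<^sub>m T) * mat_adjoint (G :: complex mat) = a \<cdot>\<^sub>m (F * S * mat_adjoint G) + b \<cdot>\<^sub>m (F * T * mat_adjoint G)"
proof -
  have aG: "mat_adjoint G \<in> carrier_mat k n" using G by simp
  have FS: "F * S \<in> carrier_mat n k" and FT: "F * T \<in> carrier_mat n k" using F S by auto
  have "F * (a \<cdot>\<^sub>m S + b \<cdot>\<^sub>m T) = a \<cdot>\<^sub>m (F * S) + b \<cdot>\<^sub>m (F * T)"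
    using F S by (simp add: mult_add_distrib_mat[of _ n k _ k] mult_smult_distrib[of _ n k _ k])
  then show ?thesis
    using FS FT aG by (simp add: add_mult_distrib_mat[of _ n k _ _ n] mult_smult_assoc_mat[of _ n k _ n])
qed

lemma block_form_linear:
  assumes F: "F \<in> carrier_mat n k" and G: "G \<in> carrier_mat n k" and S: "S \<in> carrier_mat k k" "T \<in> carrier_mat k k"
  shows "block_form D F G (a \<cdot>\<^sub>m S + b \<cdot>\<^sub>m T) = a \<cdot>\<^sub>m block_form D F G S + b \<cdot>\<^sub>m block_form D F G T"
proof (rule eq_matI)
  have ST: "a \<cdot>\<^sub>m S + b \<cdot>\<^sub>m T \<in> carrier_mat k k" using S by simp
  note c = block_form_carrier[OF F G ST, of D] block_form_carrier[OF F G S(1), of D] block_form_carrier[OF F G S(2), of D]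
  show "dim_row (block_form D F G (a \<cdot>\<^sub>m S + b \<cdot>\<^sub>m T)) = dim_row (a \<cdot>\<^sub>m block_form D F G S + b \<cdot>\<^sub>m block_form D F G T)"
    "dim_col (block_form D F G (a \<cdot>\<^sub>m S + b \<cdot>\<^sub>m T)) = dim_col (a \<cdot>\<^sub>m block_form D F G S + b \<cdot>\<^sub>m block_form D F G T)"
    using c by (simp_all add: carrier_matD)
  fix i j assume "i < dim_row (a \<cdot>\<^sub>m block_form D F G S + b \<cdot>\<^sub>m block_form D F G T)"
    "j < dim_col (a \<cdot>\<^sub>m block_form D F G S + b \<cdot>\<^sub>m block_form D F G T)"
  then have ij: "i < n" "j < n" using c by auto
  have e: "(F1 * (a \<cdot>\<^sub>m S + b \<cdot>\<^sub>m T) * mat_adjoint F2) $$ (i, j)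
      = a * (F1 * S * mat_adjoint F2) $$ (i, j) + b * (F1 * T * mat_adjoint F2) $$ (i, j)"
    if F12: "F1 \<in> carrier_mat n k" "F2 \<in> carrier_mat n k" for F1 F2
    using sandwich_carrier[OF F12(1) S(1) F12(2)] sandwich_carrier[OF F12(1) S(2) F12(2)] ij
    unfolding sandwich_linear[OF F12 S] by (simp del: index_mult_mat add: carrier_matD)
  show "block_form D F G (a \<cdot>\<^sub>m S + b \<cdot>\<^sub>m T) $$ (i, j) =
      (a \<cdot>\<^sub>m block_form D F G S + b \<cdot>\<^sub>m block_form D F G T) $$ (i, j)"
    using ij c by (simp add: block_form_index[OF F G ST] block_form_index[OF F G S(1)]
        block_form_index[OF F G S(2)] e F G algebra_simps del: index_mult_mat)
qed

lemma sandwich_adjoint: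
  assumes F: "F \<in> carrier_mat n k" and G: "G \<in> carrier_mat n k" and S: "S \<in> hermitian_mats k"
  shows "mat_adjoint (F * S * mat_adjoint G) = G * S * mat_adjoint F"
proof -
  note S' = hermitian_matsD[OF S]
  have "mat_adjoint (F * S * mat_adjoint G) = G * (S * mat_adjoint F)"
    using mat_adjoint_mult[of "F * S" n k "mat_adjoint G" n] mat_adjoint_mult[OF F S'(1)] F G S' by simp
  also have "\<dots> = G * S * mat_adjoint F"
    using F G S'(1) by (intro assoc_mult_mat[symmetric]) auto
  finally show ?thesis .
qed

text \<open>Taking adjoints swaps the two mixed terms together with their conjugate coefficients.
  Multipliers will be built from values of \<open>block_form\<close>, and this makes them
  Hermitian.\<close>

lemma block_form_hermitian:
  assumes F: "F \<in> carrier_mat n k" and G: "G \<in> carrier_mat n k" and S: "S \<in> hermitian_mats k"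
    and D: "D \<in> hermitian_mats 2"
  shows "block_form D F G S \<in> hermitian_mats n"
proof (rule hermitian_matsI)
  note S' = hermitian_matsD[OF S]
  show "block_form D F G S \<in> carrier_mat n n" using block_form_carrier[OF F G S'(1)] .
  fix i j assume ij: "i < n" "j < n"
  have e: "cnj ((F1 * S * mat_adjoint F2) $$ (j, i)) = (F2 * S * mat_adjoint F1) $$ (i, j)"
    if F12: "F1 \<in> carrier_mat n k" "F2 \<in> carrier_mat n k" for F1 F2
  proof -
    have "(F2 * S * mat_adjoint F1) $$ (i, j) = mat_adjoint (F1 * S * mat_adjoint F2) $$ (i, j)"
      using sandwich_adjoint[OF F12 S] by simp
    also have "\<dots> = cnj ((F1 * S * mat_adjoint F2) $$ (j, i))"
      using sandwich_carrier[OF F12(1) S'(1) F12(2)] ij by (intro mat_adjoint_index) auto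
    finally show ?thesis by simp
  qed
  have d: "cnj (D $$ (0, 0)) = D $$ (0, 0)" "cnj (D $$ (0, 1)) = D $$ (1, 0)"
    "cnj (D $$ (1, 0)) = D $$ (0, 1)" "cnj (D $$ (1, 1)) = D $$ (1, 1)"
    using hermitian_mats_cnj[OF D] by auto
  show "cnj (block_form D F G S $$ (j, i)) = block_form D F G S $$ (i, j)"
    unfolding block_form_index[OF F G S'(1) ij] block_form_index[OF F G S'(1) ij(2,1)]
    by (simp only: complex_cnj_add complex_cnj_mult e[OF F F] e[OF F G] e[OF G F] e[OF G G] d) simp
qed

lemma entries_continuous_block_form:
  assumes "F \<in> carrier_mat n k" "G \<in> carrier_mat n k" "entries_continuous X k k M"
  shows "entries_continuous X n n (\<lambda>x. block_form D F G (M x))"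
  unfolding block_form_def using assms
  by (intro entries_continuous_add entries_continuous_smult entries_continuous_mult[of _ n k]
      entries_continuous_const entries_continuous_adjoint) auto

text \<open>Turns the entrywise inner product of \<open>strict_separation\<close> into a
  trace.\<close>

lemma tr_prod_hermitian:
  assumes "U \<in> hermitian_mats n" "X \<in> carrier_mat n n"
  shows "(\<Sum>i<n. \<Sum>j<n. X $$ (i, j) * cnj (U $$ (i, j))) = tr_prod U X"
proof -
  have "(\<Sum>i<n. \<Sum>j<n. X $$ (i, j) * cnj (U $$ (i, j))) = (\<Sum>i<n. \<Sum>j<n. U $$ (j, i) * X $$ (i, j))"
    using hermitian_mats_cnj[OF assms(1)] by (intro sum.cong) auto
  also have "\<dots> = (\<Sum>j<n. \<Sum>i<n. U $$ (j, i) * X $$ (i, j))" by (rule sum.swap)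
  finally show ?thesis using hermitian_matsD[OF assms(1)] by (simp add: tr_prod_def)
qed

lemma tr_prod_smult_right:
  assumes "X \<in> carrier_mat n m" "Y \<in> carrier_mat m n"
  shows "tr_prod X (a \<cdot>\<^sub>m Y) = a * tr_prod X Y"
  using assms by (simp add: tr_prod_def sum_distrib_left mult_ac)

lemma tr_prod_smult_left: "tr_prod (a \<cdot>\<^sub>m X) Y = a * tr_prod X Y"
  by (simp add: tr_prod_def sum_distrib_left mult_ac)

text \<open>The squared Frobenius norm, expressed through the Gram matrix so that the normalisation
  is compatible with \<open>gram_convex\<close>. The sum of squares in \<open>frob_eq\<close> bounds
  each entry.\<close>

definition frob :: "complex mat \<Rightarrow> real" where
  "frob Z = (\<Sum>i<dim_row Z. Re ((Z * mat_adjoint Z) $$ (i, i)))"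

lemma frob_eq:
  assumes "Z \<in> carrier_mat k r"
  shows "frob Z = (\<Sum>i<k. \<Sum>j<r. (cmod (Z $$ (i, j)))\<^sup>2)"
proof -
  have sq: "Re (z * cnj z) = (cmod z)\<^sup>2" for z
    unfolding cmod_power2 by (simp add: power2_eq_square)
  show ?thesis unfolding frob_def using carrier_matD[OF assms]
    by (auto simp: scalar_prod_def lessThan_atLeast0 sq simp del: times_complex.sel intro!: sum.cong)
qed

lemma frob_nonneg: "0 \<le> frob Z"
  using frob_eq[of Z "dim_row Z" "dim_col Z"] by (simp add: sum_nonneg)

lemma entry_le_frob:
  assumes Z: "Z \<in> carrier_mat k r" and ij: "i < k" "j < r"
  shows "(cmod (Z $$ (i, j)))\<^sup>2 \<le> frob Z"
proof -
  have "(cmod (Z $$ (i, j)))\<^sup>2 \<le> (\<Sum>j<r. (cmod (Z $$ (i, j)))\<^sup>2)"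
    using ij by (intro member_le_sum) auto
  also have "\<dots> \<le> (\<Sum>i<k. \<Sum>j<r. (cmod (Z $$ (i, j)))\<^sup>2)"
    using ij by (intro member_le_sum[where f = "\<lambda>i. \<Sum>j<r. (cmod (Z $$ (i, j)))\<^sup>2"]) (auto intro: sum_nonneg)
  finally show ?thesis unfolding frob_eq[OF Z] .
qed

lemma outer_as_gram:
  assumes "u \<in> carrier_vec k"
  shows "\<exists>Z \<in> carrier_mat k k. Z * mat_adjoint Z = outer u u"
proof -
  define C where "C = mat k 1 (\<lambda>(i, j). u $ i)"
  have "C * mat_adjoint C = outer u u"
    using assms by (intro eq_matI) (auto simp: C_def scalar_prod_def)
  then show ?thesis using gram_square_factor[of C k 1] by (auto simp: C_def)
qed

text \<open>A theorem of alternatives: \<open>no\<close> keeps the values of normalised triples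
  \<open>(Z, Y, t)\<close> away from the origin, and the functional from
  \<open>strict_separation\<close> is then evaluated at triples with one nonzero component.\<close>

lemma lmi_alternative:
  assumes P: "P \<in> hermitian_mats k" and F: "F \<in> carrier_mat n k" and G: "G \<in> carrier_mat n k"
    and D: "D \<in> hermitian_mats 2" and Sg: "Sg \<in> hermitian_mats 2"
    and no: "\<And>Z Y. Z \<in> carrier_mat k k \<Longrightarrow> Y \<in> carrier_mat n n \<Longrightarrow>
      block_form D F G (Z * mat_adjoint Z) = 0\<^sub>m n n \<Longrightarrow>
      block_form Sg F G (Z * mat_adjoint Z) = Y * mat_adjoint Y \<Longrightarrow>
      Z = 0\<^sub>m k k \<or> Re (tr_prod P (Z * mat_adjoint Z)) < 0"
  shows "\<exists>U \<in> hermitian_mats n. \<exists>V \<in> hermitian_mats n. pos_def V \<and>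
    (\<forall>w \<in> carrier_vec k. w \<noteq> 0\<^sub>v k \<longrightarrow>
      Re (tr_prod U (block_form D F G (outer w w)) + tr_prod V (block_form Sg F G (outer w w)) +
        (P *\<^sub>v w) \<bullet>c w) < 0)"
proof -
  \<comment> \<open>Triples are coded by functions on index pairs, to have the product topology at
    hand; \<open>mat\<close> reads off the entries inside the block.\<close>
  define Zm where "Zm x = mat k k (fst x)" for x :: "(nat \<times> nat \<Rightarrow> complex) \<times> (nat \<times> nat \<Rightarrow> complex) \<times> real"
  define Ym where "Ym x = mat n n (fst (snd x))" for x :: "(nat \<times> nat \<Rightarrow> complex) \<times> (nat \<times> nat \<Rightarrow> complex) \<times> real"
  define gz where "gz x = Zm x * mat_adjoint (Zm x)" for x
  define gy where "gy x = Ym x * mat_adjoint (Ym x)" for x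
  \<comment> \<open>A product of compact sets. Radius one suffices: the squared modulus of an entry
    is at most \<open>frob\<close>, which is at most one under the normalisation.\<close>
  define Box where "Box l = PiE UNIV (\<lambda>p. if p \<in> {..<l} \<times> {..<l} then cball (0 :: complex) 1 else {0})" for l :: nat
  define X where "X = (Box k \<times> Box n \<times> {0..1 :: real}) \<inter> {x. frob (Zm x) + frob (Ym x) + snd (snd x) = 1}"
  define \<Phi> where "\<Phi> x = block_form D F G (gz x)" for x
  \<comment> \<open>The slacks turn semidefiniteness of the \<open>Sg\<close> form, and below it
    nonnegativity of the trace with \<open>P\<close>, into equations, so that the excluded
    alternative is the origin.\<close>
  define \<Psi> where "\<Psi> x = block_form Sg F G (gz x) - gy x" for x
  define \<pi> where "\<pi> x = Re (tr_prod P (gz x)) - snd (snd x)" for x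
  define A where "A x = (\<lambda>(c, i, j). if c = (0 :: nat) then \<Phi> x $$ (i, j) else if c = 1 then \<Psi> x $$ (i, j)
    else complex_of_real (\<pi> x))" for x
  define I where "I = {0 :: nat} \<times> {..<n} \<times> {..<n} \<union> {1} \<times> {..<n} \<times> {..<n} \<union> {(2, 0, 0)}"
  note P' = hermitian_matsD[OF P]
  have Zc: "Zm x \<in> carrier_mat k k" and Yc: "Ym x \<in> carrier_mat n n" for x by (auto simp: Zm_def Ym_def)
  have gzc: "gz x \<in> carrier_mat k k" and gyc: "gy x \<in> carrier_mat n n" for x
    unfolding gz_def gy_def by (rule gram_carrier[OF Zc], rule gram_carrier[OF Yc])
  have gzh: "gz x \<in> hermitian_mats k" and gyh: "gy x \<in> hermitian_mats n" for x
    unfolding gz_def gy_def by (rule gram_hermitian[OF Zc], rule gram_hermitian[OF Yc])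
  have Bc: "block_form E F G (gz x) \<in> carrier_mat n n" for E x
    by (rule block_form_carrier[OF F G gzc])
  have \<Phi>c: "\<Phi> x \<in> carrier_mat n n" and \<Psi>c: "\<Psi> x \<in> carrier_mat n n" for x
    unfolding \<Phi>_def \<Psi>_def by (rule Bc, rule minus_carrier_mat, rule gyc)
  have \<Psi>ij: "\<Psi> x $$ (i, j) = block_form Sg F G (gz x) $$ (i, j) - gy x $$ (i, j)" if "i < n" "j < n" for x i j
    unfolding \<Psi>_def using Bc[of Sg x] gyc[of x] that by simp
  have Zcont: "entries_continuous T k k Zm" and Ycont: "entries_continuous T n n Ym" for T
  proof -
    have "continuous_on T (\<lambda>x :: (nat \<times> nat \<Rightarrow> complex) \<times> (nat \<times> nat \<Rightarrow> complex) \<times> real. fst x p)"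
      "continuous_on T (\<lambda>x :: (nat \<times> nat \<Rightarrow> complex) \<times> (nat \<times> nat \<Rightarrow> complex) \<times> real. fst (snd x) p)" for p T
      by (rule continuous_on_product_then_coordinatewise[of T fst], rule continuous_on_fst, rule continuous_on_id,
          rule continuous_on_product_then_coordinatewise[of T "\<lambda>x. fst (snd x)"], rule continuous_on_fst,
          rule continuous_on_snd, rule continuous_on_id)
    then show "entries_continuous T k k Zm" "entries_continuous T n n Ym" for T
      unfolding entries_continuous_def Zm_def Ym_def by simp_all
  qed
  have gzcont: "entries_continuous T k k gz" and gycont: "entries_continuous T n n gy" for T
    unfolding gz_def gy_def
    by (rule entries_continuous_mult[OF Zcont entries_continuous_adjoint[OF Zcont]],
        rule entries_continuous_mult[OF Ycont entries_continuous_adjoint[OF Ycont]])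
  have Bcont: "entries_continuous T n n (\<lambda>x. block_form E F G (gz x))" for E T
    by (rule entries_continuous_block_form[OF F G gzcont])
  have frobZ: "frob (Zm x) = (\<Sum>i<k. Re (gz x $$ (i, i)))" and frobY: "frob (Ym x) = (\<Sum>i<n. Re (gy x $$ (i, i)))" for x
    unfolding frob_def gz_def gy_def using Zc[of x] Yc[of x] by auto
  have boxed: "(\<lambda>p. if p \<in> {..<l} \<times> {..<l} then Z $$ p else 0) \<in> Box l"
    if "Z \<in> carrier_mat l l" "frob Z \<le> 1" for Z l
  proof -
    have "cmod (Z $$ (i, j)) \<le> 1" if ij: "i < l" "j < l" for i j
    proof -
      have "(cmod (Z $$ (i, j)))\<^sup>2 \<le> 1\<^sup>2" using entry_le_frob[OF \<open>Z \<in> _\<close> ij] \<open>frob Z \<le> 1\<close> by simp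
      then show ?thesis using abs_le_square_iff[of "cmod (Z $$ (i, j))" 1] by simp
    qed
    then show ?thesis unfolding Box_def by (auto simp: PiE_iff)
  qed
  have point: "\<exists>x \<in> X. Zm x = Z \<and> Ym x = Y \<and> snd (snd x) = t"
    if "Z \<in> carrier_mat k k" "Y \<in> carrier_mat n n" "0 \<le> t" "frob Z + frob Y + t = 1" for Z Y t
  proof -
    define x where "x = (\<lambda>p. if p \<in> {..<k} \<times> {..<k} then Z $$ p else 0,
      \<lambda>p. if p \<in> {..<n} \<times> {..<n} then Y $$ p else 0, t)"
    have "Zm x = Z" unfolding Zm_def x_def using that(1) by (intro eq_matI) auto
    moreover have "Ym x = Y" unfolding Ym_def x_def using that(2) by (intro eq_matI) auto
    moreover have "snd (snd x) = t" by (simp add: x_def)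
    moreover have "x \<in> Box k \<times> Box n \<times> {0..1}"
      unfolding x_def using that frob_nonneg[of Z] frob_nonneg[of Y] by (auto intro!: boxed)
    ultimately show ?thesis using that(4) unfolding X_def by (intro bexI[of _ x]) auto
  qed
  have "\<exists>x0 \<in> X. \<forall>x \<in> X. 0 < Re (\<Sum>i \<in> I. A x i * cnj (A x0 i))"
  proof (rule strict_separation)
    have "compact (Box l)" for l
    proof -
      have "compactin (product_topology (\<lambda>p. euclidean) UNIV)
          (PiE UNIV (\<lambda>p. if p \<in> {..<l} \<times> {..<l} then cball (0 :: complex) 1 else {0}))"
        unfolding compactin_PiE by auto
      then show ?thesis
        unfolding Box_def euclidean_product_topology compactin_euclidean_iff .
    qed
    then have "compact (Box k \<times> Box n \<times> {0..1 :: real})"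
      by (intro compact_Times) auto
    moreover have "closed {x. frob (Zm x) + frob (Ym x) + snd (snd x) = 1}"
      unfolding frobZ frobY using gzcont[of UNIV] gycont[of UNIV] unfolding entries_continuous_def
      by (intro closed_Collect_eq continuous_intros) auto
    ultimately show "compact X" unfolding X_def by (rule compact_Int_closed)
    show "X \<noteq> {}"
      using point[of "0\<^sub>m k k" "0\<^sub>m n n" 1] by (auto simp: frob_def scalar_prod_def)
    show "finite I" by (simp add: I_def)
    show "continuous_on X (\<lambda>x. A x i)" if "i \<in> I" for i
    proof -
      have "continuous_on X (\<lambda>x. \<Phi> x $$ (i, j))" if "i < n" "j < n" for i j
        using Bcont[of X D] that unfolding \<Phi>_def entries_continuous_def by auto
      moreover have "continuous_on X (\<lambda>x. \<Psi> x $$ (i, j))" if "i < n" "j < n" for i j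
        unfolding \<Psi>ij[OF that] using Bcont[of X Sg] gycont[of X] that unfolding entries_continuous_def
        by (auto intro!: continuous_intros)
      moreover have "continuous_on X (\<lambda>x. complex_of_real (\<pi> x))"
        unfolding \<pi>_def by (intro continuous_intros tr_prod_continuous[OF P'(1) gzcont])
      ultimately show ?thesis using that unfolding I_def A_def by auto
    qed
    \<comment> \<open>At the origin \<open>Re (tr_prod P (gz x)) = t\<close> is nonnegative, so
      \<open>no\<close> leaves \<open>Z = 0\<close>; then \<open>t\<close> and the Gram matrix of
      \<open>Y\<close> vanish as well, against total trace one.\<close>
    show "\<exists>i\<in>I. A x i \<noteq> 0" if x: "x \<in> X" for x
    proof (rule ccontr)
      assume "\<not> ?thesis"
      then have z: "A x i = 0" if "i \<in> I" for i using that by blast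
      have \<Phi>0: "\<Phi> x $$ (i, j) = 0" if "i < n" "j < n" for i j
        using z[of "(0, i, j)"] that by (simp add: A_def I_def)
      have \<Psi>0: "\<Psi> x $$ (i, j) = 0" if "i < n" "j < n" for i j
        using z[of "(1, i, j)"] that by (simp add: A_def I_def)
      have \<pi>0: "\<pi> x = 0" using z[of "(2, 0, 0)"] by (simp add: A_def I_def)
      have t: "0 \<le> snd (snd x)" using x by (auto simp: X_def)
      have "\<Phi> x = 0\<^sub>m n n" using \<Phi>0 \<Phi>c[of x] by (intro eq_matI) auto
      moreover have "block_form Sg F G (gz x) = gy x"
        using \<Psi>0 \<Psi>ij Bc[of Sg x] gyc[of x] by (intro eq_matI) auto
      ultimately have "Zm x = 0\<^sub>m k k \<or> Re (tr_prod P (gz x)) < 0"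
        using no[OF Zc Yc] unfolding \<Phi>_def gz_def gy_def by blast
      then have Z0: "Zm x = 0\<^sub>m k k" using \<pi>0 t by (auto simp: \<pi>_def)
      have gz0: "gz x = 0\<^sub>m k k" unfolding gz_def Z0 by (intro eq_matI) (auto simp: scalar_prod_def)
      have t0: "snd (snd x) = 0" using \<pi>0 P' by (simp add: \<pi>_def gz0 tr_prod_def)
      have sw: "F1 * 0\<^sub>m k k * mat_adjoint F2 = 0\<^sub>m n n" if "F1 \<in> carrier_mat n k" "F2 \<in> carrier_mat n k" for F1 F2 :: "complex mat"
        using that mat_adjoint_carrier[OF that(2)] by simp
      have "gy x = block_form Sg F G (0\<^sub>m k k)" using \<open>block_form Sg F G (gz x) = gy x\<close> gz0 by simp
      also have "\<dots> = 0\<^sub>m n n"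
        unfolding block_form_def sw[OF F F] sw[OF F G] sw[OF G F] sw[OF G G] by (intro eq_matI) auto
      finally have "frob (Ym x) = 0" unfolding frobY by simp
      moreover have "frob (Zm x) = 0" unfolding frobZ gz0 by simp
      ultimately show False using x t0 by (simp add: X_def)
    qed
    show "\<exists>z\<in>X. \<forall>i\<in>I. A z i = complex_of_real (1 - t) * A x i + complex_of_real t * A y i"
      if x: "x \<in> X" and y: "y \<in> X" and t: "0 \<le> t" "t \<le> 1" for x y t
    proof -
      \<comment> \<open>Gram matrices are combined, not their factors: the values depend linearly on
        \<open>gz\<close>, \<open>gy\<close> and \<open>t\<close>.\<close>
      define a b where "a = complex_of_real (1 - t)" and "b = complex_of_real t"
      obtain Z where Z: "Z \<in> carrier_mat k k" "Z * mat_adjoint Z = a \<cdot>\<^sub>m gz x + b \<cdot>\<^sub>m gz y"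
        using gram_convex[OF Zc Zc, of "1 - t" t x y] t unfolding gz_def a_def b_def by auto
      obtain Y where Y: "Y \<in> carrier_mat n n" "Y * mat_adjoint Y = a \<cdot>\<^sub>m gy x + b \<cdot>\<^sub>m gy y"
        using gram_convex[OF Yc Yc, of "1 - t" t x y] t unfolding gy_def a_def b_def by auto
      define s where "s = (1 - t) * snd (snd x) + t * snd (snd y)"
      have s: "0 \<le> s" using x y t by (auto simp: s_def X_def)
      have "frob Z = (\<Sum>i<k. (1 - t) * Re (gz x $$ (i, i)) + t * Re (gz y $$ (i, i)))"
        unfolding frob_def Z(2) using Z(1) gzc[of x] gzc[of y]
        by (intro sum.cong) (auto simp: a_def b_def)
      then have fZ: "frob Z = (1 - t) * frob (Zm x) + t * frob (Zm y)"
        by (simp add: frobZ sum.distrib sum_distrib_left)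
      have "frob Y = (\<Sum>i<n. (1 - t) * Re (gy x $$ (i, i)) + t * Re (gy y $$ (i, i)))"
        unfolding frob_def Y(2) using Y(1) gyc[of x] gyc[of y]
        by (intro sum.cong) (auto simp: a_def b_def)
      then have fY: "frob Y = (1 - t) * frob (Ym x) + t * frob (Ym y)"
        by (simp add: frobY sum.distrib sum_distrib_left)
      have "frob Z + frob Y + s = (1 - t) * (frob (Zm x) + frob (Ym x) + snd (snd x))
          + t * (frob (Zm y) + frob (Ym y) + snd (snd y))"
        unfolding fZ fY s_def by (simp add: algebra_simps)
      then have "frob Z + frob Y + s = 1" using x y by (simp add: X_def)
      then obtain z where z: "z \<in> X" "Zm z = Z" "Ym z = Y" "snd (snd z) = s"
        using point[OF Z(1) Y(1) s] by blast
      have gz: "gz z = a \<cdot>\<^sub>m gz x + b \<cdot>\<^sub>m gz y" using Z(2) unfolding z(2)[symmetric] gz_def[symmetric] .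
      have gy: "gy z = a \<cdot>\<^sub>m gy x + b \<cdot>\<^sub>m gy y" using Y(2) unfolding z(3)[symmetric] gy_def[symmetric] .
      have B: "block_form E F G (gz z) $$ (i, j) = a * block_form E F G (gz x) $$ (i, j) + b * block_form E F G (gz y) $$ (i, j)"
        if "i < n" "j < n" for E i j
        unfolding gz block_form_linear[OF F G gzc gzc] using that Bc[of E x] Bc[of E y] by simp
      have gyij: "gy z $$ (i, j) = a * gy x $$ (i, j) + b * gy y $$ (i, j)" if "i < n" "j < n" for i j
        unfolding gy using that gyc[of x] gyc[of y] by simp
      have "tr_prod P (gz z) = a * tr_prod P (gz x) + b * tr_prod P (gz y)"
        unfolding gz using P'(1) gzc[of x] gzc[of y]
        by (simp add: tr_prod_add[of _ k k] tr_prod_smult_right[of _ k k])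
      then have "Re (tr_prod P (gz z)) = (1 - t) * Re (tr_prod P (gz x)) + t * Re (tr_prod P (gz y))"
        by (simp add: a_def b_def del: of_real_diff)
      then have "\<pi> z = (1 - t) * \<pi> x + t * \<pi> y"
        unfolding \<pi>_def z(4) s_def by (simp add: algebra_simps)
      then have \<pi>: "complex_of_real (\<pi> z) = a * complex_of_real (\<pi> x) + b * complex_of_real (\<pi> y)"
        by (simp add: a_def b_def)
      have "A z i = a * A x i + b * A y i" if "i \<in> I" for i
        using that unfolding I_def A_def \<Phi>_def
        by (auto simp: \<Psi>ij B gyij \<pi> algebra_simps)
      then show ?thesis using z(1) unfolding a_def b_def by blast
    qed
  qed
  then obtain x0 where x0: "x0 \<in> X" and sep: "\<And>x. x \<in> X \<Longrightarrow> 0 < Re (\<Sum>i \<in> I. A x i * cnj (A x0 i))"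
    by blast
  \<comment> \<open>The coordinates of the nearest point are the multipliers, still unscaled and
    with the opposite sign.\<close>
  define U W p where "U = \<Phi> x0" and "W = \<Psi> x0" and "p = \<pi> x0"
  have Uh: "U \<in> hermitian_mats n"
    unfolding U_def \<Phi>_def by (rule block_form_hermitian[OF F G gzh D])
  have Wh: "W \<in> hermitian_mats n"
  proof (rule hermitian_matsI)
    show "W \<in> carrier_mat n n" unfolding W_def by (rule \<Psi>c)
    show "cnj (W $$ (j, i)) = W $$ (i, j)" if "i < n" "j < n" for i j
      unfolding W_def using that
      by (simp add: \<Psi>ij hermitian_mats_cnj[OF block_form_hermitian[OF F G gzh Sg]] hermitian_mats_cnj[OF gyh])
  qed
  have sum_I: "(\<Sum>i \<in> I. A x i * cnj (A x0 i)) = tr_prod U (\<Phi> x) + tr_prod W (\<Psi> x) + complex_of_real (\<pi> x * p)" for x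
  proof -
    have "(\<Sum>i \<in> I. A x i * cnj (A x0 i))
        = (\<Sum>(c, i, j) \<in> {0 :: nat} \<times> {..<n} \<times> {..<n}. A x (c, i, j) * cnj (A x0 (c, i, j)))
        + (\<Sum>(c, i, j) \<in> {1 :: nat} \<times> {..<n} \<times> {..<n}. A x (c, i, j) * cnj (A x0 (c, i, j)))
        + A x (2, 0, 0) * cnj (A x0 (2, 0, 0))"
      unfolding I_def by (subst sum.union_disjoint; (subst sum.union_disjoint)?) (auto simp: split_def)
    also have "\<dots> = (\<Sum>i<n. \<Sum>j<n. \<Phi> x $$ (i, j) * cnj (U $$ (i, j))) +
        (\<Sum>i<n. \<Sum>j<n. \<Psi> x $$ (i, j) * cnj (W $$ (i, j))) + complex_of_real (\<pi> x * p)"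
      by (simp add: sum.cartesian_product[symmetric] A_def U_def W_def p_def)
        (simp add: sum.cartesian_product split_def)
    finally show ?thesis unfolding tr_prod_hermitian[OF Uh \<Phi>c] tr_prod_hermitian[OF Wh \<Psi>c] .
  qed
  have sep': "0 < Re (tr_prod U (block_form D F G (Z * mat_adjoint Z)) +
      tr_prod W (block_form Sg F G (Z * mat_adjoint Z) - Y * mat_adjoint Y)) +
      (Re (tr_prod P (Z * mat_adjoint Z)) - t) * p"
    if ZYt: "Z \<in> carrier_mat k k" "Y \<in> carrier_mat n n" "0 \<le> t" "frob Z + frob Y + t = 1" for Z Y t
  proof -
    obtain x where "x \<in> X" "Zm x = Z" "Ym x = Y" "snd (snd x) = t" using point[OF ZYt] by blast
    then show ?thesis using sep[of x] unfolding sum_I \<Phi>_def \<Psi>_def \<pi>_def gz_def gy_def by simp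
  qed
  have zz: "0\<^sub>m l l * mat_adjoint (0\<^sub>m l l) = (0\<^sub>m l l :: complex mat)" for l
    by (intro eq_matI) (auto simp: scalar_prod_def)
  have sw: "F1 * 0\<^sub>m k k * mat_adjoint F2 = 0\<^sub>m n n" if "F1 \<in> carrier_mat n k" "F2 \<in> carrier_mat n k" for F1 F2 :: "complex mat"
    using that mat_adjoint_carrier[OF that(2)] by simp
  have b0: "block_form E F G (0\<^sub>m k k) = 0\<^sub>m n n" for E
    unfolding block_form_def sw[OF F F] sw[OF F G] sw[OF G F] sw[OF G G] by (intro eq_matI) auto
  have frob0: "frob (0\<^sub>m l l) = 0" for l by (simp add: frob_def zz)
  have tr0: "tr_prod M (0\<^sub>m l l) = 0" if "M \<in> carrier_mat l l" for M l
    using that by (simp add: tr_prod_def)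
  note Uc = hermitian_matsD(1)[OF Uh] and Wc = hermitian_matsD(1)[OF Wh]
  \<comment> \<open>The triple with \<open>t = 1\<close> alone gives \<open>0 < - p\<close>.\<close>
  have p: "p < 0"
    using sep'[of "0\<^sub>m k k" "0\<^sub>m n n" 1] Uc Wc P'(1) by (simp add: zz b0 frob0 tr0 minus_zero_mat)
  have frob_unit: "frob Z = 1" if "Z \<in> carrier_mat l l" "Z * mat_adjoint Z = outer u u" "u \<in> carrier_vec l" "u \<bullet>c u = 1" for Z u l
  proof -
    have "frob Z = Re (u \<bullet>c u)"
      using that(1,3) unfolding frob_def that(2) by (auto simp: scalar_prod_def lessThan_atLeast0)
    then show ?thesis using that(4) by simp
  qed
  have outer_scale: "outer (complex_of_real a \<cdot>\<^sub>v u) (complex_of_real a \<cdot>\<^sub>v u) = complex_of_real (a\<^sup>2) \<cdot>\<^sub>m outer u u" for a u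
    unfolding outer_smult by (simp add: power2_eq_square)
  have form_scale: "(M *\<^sub>v (complex_of_real a \<cdot>\<^sub>v u)) \<bullet>c (complex_of_real a \<cdot>\<^sub>v u) = complex_of_real (a\<^sup>2) * ((M *\<^sub>v u) \<bullet>c u)"
    if "M \<in> carrier_mat l l" "u \<in> carrier_vec l" for M a u l
    using that by (simp add: mult_mat_vec conjugate_smult_vec power2_eq_square)
  \<comment> \<open>Tested at \<open>Y Y^* = u u^*\<close> alone. The slack enters with a minus
    sign, hence \<open>W\<close> is negative definite; \<open>u\<close> has unit length to meet the
    normalisation.\<close>
  have Wneg: "Re ((W *\<^sub>v v) \<bullet>c v) < 0" if v: "v \<in> carrier_vec n" "v \<noteq> 0\<^sub>v n" for v
  proof -
    obtain a where a: "a > 0" "(complex_of_real a \<cdot>\<^sub>v v) \<bullet>c (complex_of_real a \<cdot>\<^sub>v v) = 1"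
      using unit_vec_of_nonzero[OF v] by blast
    define u where "u = complex_of_real a \<cdot>\<^sub>v v"
    have u: "u \<in> carrier_vec n" using v by (simp add: u_def)
    obtain Y where Y: "Y \<in> carrier_mat n n" "Y * mat_adjoint Y = outer u u" using outer_as_gram[OF u] by blast
    have ou: "outer u u \<in> carrier_mat n n" using u by simp
    have "0\<^sub>m n n - outer u u = (- 1) \<cdot>\<^sub>m outer u u" using ou by (intro eq_matI) auto
    then have "tr_prod W (0\<^sub>m n n - outer u u) = - ((W *\<^sub>v u) \<bullet>c u)"
      using tr_prod_smult_right[OF Wc ou, of "-1"] tr_prod_outer[OF Wc u u] by simp
    then have "Re ((W *\<^sub>v u) \<bullet>c u) < 0"
      using sep'[of "0\<^sub>m k k" Y 0] Y frob_unit[OF Y u] a(2) Uc P'(1)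
      by (simp add: zz b0 frob0 tr0 u_def[symmetric])
    then have "a\<^sup>2 * Re ((W *\<^sub>v v) \<bullet>c v) < 0"
      unfolding u_def form_scale[OF Wc v(1)] by simp
    then show ?thesis using a(1) by (simp add: mult_less_0_iff)
  qed
  \<comment> \<open>Tested at \<open>Z Z^* = u u^*\<close> alone. The inequality is homogeneous of
    degree two, so it passes from the unit vector \<open>u\<close> to \<open>w\<close>.\<close>
  have main: "0 < Re (tr_prod U (block_form D F G (outer w w)) + tr_prod W (block_form Sg F G (outer w w))) +
      Re ((P *\<^sub>v w) \<bullet>c w) * p"
    if w: "w \<in> carrier_vec k" "w \<noteq> 0\<^sub>v k" for w
  proof -
    obtain a where a: "a > 0" "(complex_of_real a \<cdot>\<^sub>v w) \<bullet>c (complex_of_real a \<cdot>\<^sub>v w) = 1"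
      using unit_vec_of_nonzero[OF w] by blast
    define u where "u = complex_of_real a \<cdot>\<^sub>v w"
    have u: "u \<in> carrier_vec k" using w by (simp add: u_def)
    obtain Z where Z: "Z \<in> carrier_mat k k" "Z * mat_adjoint Z = outer u u" using outer_as_gram[OF u] by blast
    have ow: "outer w w \<in> carrier_mat k k" and ou: "outer u u \<in> carrier_mat k k" using w u by auto
    have Bscale: "block_form E F G (outer u u) = complex_of_real (a\<^sup>2) \<cdot>\<^sub>m block_form E F G (outer w w)" for E
    proof -
      have "outer u u = complex_of_real (a\<^sup>2) \<cdot>\<^sub>m outer w w + 0 \<cdot>\<^sub>m outer w w"
        unfolding u_def outer_scale using ow by (intro eq_matI) auto
      then have "block_form E F G (outer u u) = complex_of_real (a\<^sup>2) \<cdot>\<^sub>m block_form E F G (outer w w) + 0 \<cdot>\<^sub>m block_form E F G (outer w w)"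
        using block_form_linear[OF F G ow ow] by simp
      then show ?thesis using block_form_carrier[OF F G ow, of E] by (auto intro!: eq_matI)
    qed
    have Bu: "block_form E F G (outer u u) \<in> carrier_mat n n" and Bw: "block_form E F G (outer w w) \<in> carrier_mat n n" for E
      by (rule block_form_carrier[OF F G ou], rule block_form_carrier[OF F G ow])
    have "0 < Re (tr_prod U (block_form D F G (outer u u)) + tr_prod W (block_form Sg F G (outer u u))) +
        Re ((P *\<^sub>v u) \<bullet>c u) * p"
      using sep'[of Z "0\<^sub>m n n" 0] Z frob_unit[OF Z u] a(2) tr_prod_outer[OF P'(1) u u] Bu[of Sg]
      by (simp add: zz frob0 u_def[symmetric] minus_zero_mat)
    also have "\<dots> = a\<^sup>2 * (Re (tr_prod U (block_form D F G (outer w w)) + tr_prod W (block_form Sg F G (outer w w))) +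
        Re ((P *\<^sub>v w) \<bullet>c w) * p)"
      unfolding Bscale tr_prod_smult_right[OF Uc Bw] tr_prod_smult_right[OF Wc Bw]
      unfolding u_def form_scale[OF P'(1) w(1)] by (simp add: algebra_simps)
    finally show ?thesis using a(1) by (simp add: zero_less_mult_iff)
  qed
  \<comment> \<open>Dividing by the negative \<open>p\<close> makes the coefficient of
    \<open>P\<close> one, turns \<open>W\<close> into a positive definite matrix and reverses the
    inequality.\<close>
  define c where "c = complex_of_real (1 / p)"
  have scaled: "c \<cdot>\<^sub>m M \<in> hermitian_mats n" if "M \<in> hermitian_mats n" for M
    using hermitian_matsD[OF that] hermitian_mats_cnj[OF that] by (intro hermitian_matsI) (auto simp: c_def)
  have "pos_def (c \<cdot>\<^sub>m W)"
    unfolding pos_def_iff[OF scaled[OF Wh]]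
  proof (intro ballI impI)
    fix v :: "complex vec" assume v: "v \<in> carrier_vec n" "v \<noteq> 0\<^sub>v n"
    have "((c \<cdot>\<^sub>m W) *\<^sub>v v) \<bullet>c v = c * ((W *\<^sub>v v) \<bullet>c v)"
      using Wc v(1) tr_prod_outer[OF _ v(1) v(1)] tr_prod_smult_left[of c W "outer v v"] by (metis smult_carrier_mat)
    then show "0 < Re (((c \<cdot>\<^sub>m W) *\<^sub>v v) \<bullet>c v)"
      using Wneg[OF v] p by (simp add: c_def divide_neg_neg)
  qed
  moreover have "Re (tr_prod (c \<cdot>\<^sub>m U) (block_form D F G (outer w w)) + tr_prod (c \<cdot>\<^sub>m W) (block_form Sg F G (outer w w)) +
      (P *\<^sub>v w) \<bullet>c w) < 0" if w: "w \<in> carrier_vec k" "w \<noteq> 0\<^sub>v k" for w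
  proof -
    let ?u = "Re (tr_prod U (block_form D F G (outer w w)) + tr_prod W (block_form Sg F G (outer w w)))"
    have "Re (tr_prod (c \<cdot>\<^sub>m U) (block_form D F G (outer w w)) + tr_prod (c \<cdot>\<^sub>m W) (block_form Sg F G (outer w w)) +
      (P *\<^sub>v w) \<bullet>c w) = (?u + Re ((P *\<^sub>v w) \<bullet>c w) * p) / p"
      using p by (simp add: tr_prod_smult_left c_def field_simps)
    also have "\<dots> < 0" using main[OF w] p by (intro divide_pos_neg)
    finally show ?thesis .
  qed
  ultimately show ?thesis using scaled[OF Uh] scaled[OF Wh] by blast
qed

section \<open>The geometry of \<open>\<Theta>\<close>\<close>

lemma rho_eq:
  assumes "M \<in> carrier_mat 2 2"
  shows "rho \<theta> M = M $$ (0, 0) * (\<theta> * cnj \<theta>) + M $$ (0, 1) * cnj \<theta> + M $$ (1, 0) * \<theta> + M $$ (1, 1)"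
proof -
  have v: "vec_of_list [\<theta>, 1] $ 0 = \<theta>" "vec_of_list [\<theta>, 1] $ Suc 0 = 1" "dim_vec (vec_of_list [\<theta>, 1]) = 2"
    by (simp_all add: vec_of_list_index numeral_2_eq_2)
  show ?thesis
    using assms unfolding rho_def
    by (simp add: scalar_prod_def v algebra_simps numeral_2_eq_2 del: vec_of_list_Cons)
qed

lemma rho_hermitian:
  assumes M: "M \<in> hermitian_mats 2"
  shows "rho \<theta> M = complex_of_real (Re (M $$ (0, 0)) * (cmod \<theta>)\<^sup>2 + 2 * Re (M $$ (1, 0) * \<theta>) + Re (M $$ (1, 1)))"
proof -
  have d: "M $$ (0, 0) = complex_of_real (Re (M $$ (0, 0)))" "M $$ (1, 1) = complex_of_real (Re (M $$ (1, 1)))"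
    using hermitian_mats_cnj[OF M, of 0 0] hermitian_mats_cnj[OF M, of 1 1]
    by (auto simp: complex_eq_iff)
  have o: "M $$ (0, 1) = cnj (M $$ (1, 0))" using hermitian_mats_cnj[OF M, of 1 0] by simp
  have c: "cnj (M $$ (1, 0)) * cnj \<theta> + M $$ (1, 0) * \<theta> = complex_of_real (2 * Re (M $$ (1, 0) * \<theta>))"
    by (simp add: complex_eq_iff)
  have n: "\<theta> * cnj \<theta> = complex_of_real ((cmod \<theta>)\<^sup>2)" by (rule complex_norm_square[symmetric])
  have "rho \<theta> M = complex_of_real (Re (M $$ (0, 0))) * complex_of_real ((cmod \<theta>)\<^sup>2)
      + complex_of_real (2 * Re (M $$ (1, 0) * \<theta>)) + complex_of_real (Re (M $$ (1, 1)))"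
    unfolding rho_eq[OF hermitian_matsD(1)[OF M]] n[symmetric] c[symmetric] d(1)[symmetric] d(2)[symmetric] o
    by simp
  then show ?thesis by simp
qed

definition rhoR :: "complex mat \<Rightarrow> complex \<Rightarrow> real" where
  "rhoR M \<theta> = Re (M $$ (0, 0)) * (cmod \<theta>)\<^sup>2 + 2 * Re (M $$ (1, 0) * \<theta>) + Re (M $$ (1, 1))"

lemma Theta_eq:
  assumes "D \<in> hermitian_mats 2" "Sg \<in> hermitian_mats 2"
  shows "Theta D Sg = {\<theta>. rhoR D \<theta> = 0 \<and> 0 \<le> rhoR Sg \<theta>}"
  unfolding Theta_def rho_hermitian[OF assms(1)] rho_hermitian[OF assms(2)] rhoR_def[symmetric]
  by (simp add: less_eq_complex_def)

text \<open>Outside the unit disc the constant is at most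
  \<open>\<bar>d\<bar> * cmod \<theta>\<close>, so a factor \<open>cmod \<theta>\<close> cancels and
  what remains is a bound on it.\<close>

lemma bounded_negative_quadratic:
  fixes e :: complex
  assumes "a < 0"
  shows "bounded {\<theta>. 0 \<le> a * (cmod \<theta>)\<^sup>2 + 2 * Re (e * \<theta>) + d}"
proof (rule boundedI)
  fix \<theta> assume "\<theta> \<in> {\<theta>. 0 \<le> a * (cmod \<theta>)\<^sup>2 + 2 * Re (e * \<theta>) + d}"
  then have q: "- a * (cmod \<theta>)\<^sup>2 \<le> 2 * Re (e * \<theta>) + d" by simp
  let ?C = "(2 * cmod e + \<bar>d\<bar>) / (- a)"
  have "Re (e * \<theta>) \<le> cmod e * cmod \<theta>" by (metis complex_Re_le_cmod norm_mult)
  show "cmod \<theta> \<le> max 1 ?C"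
  proof (cases "cmod \<theta> \<le> 1")
    case False
    have "\<bar>d\<bar> \<le> \<bar>d\<bar> * cmod \<theta>" using False by (simp add: mult_le_cancel_left1)
    then have "- a * cmod \<theta> * cmod \<theta> \<le> (2 * cmod e + \<bar>d\<bar>) * cmod \<theta>"
      using q \<open>Re (e * \<theta>) \<le> _\<close> by (simp add: power2_eq_square algebra_simps)
    then have "- a * cmod \<theta> \<le> 2 * cmod e + \<bar>d\<bar>"
      by (rule mult_right_le_imp_le) (use False in linarith)
    then have "cmod \<theta> \<le> ?C" using assms by (subst pos_le_divide_eq) (auto simp: mult.commute)
    then show ?thesis by simp
  qed simp
qed

text \<open>Opposite increments cancel the linear part. This turns an upper bound at one of the two
  points into a lower bound at the other.\<close>

lemma rhoR_midpoint:
  "rhoR M (\<theta> + h) + rhoR M (\<theta> - h) = 2 * rhoR M \<theta> + 2 * Re (M $$ (0, 0)) * (cmod h)\<^sup>2"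
  unfolding rhoR_def cmod_power2 by (simp add: power2_eq_square algebra_simps)

lemma continuous_rhoR: "continuous_on UNIV (rhoR M)"
  unfolding rhoR_def by (intro continuous_intros)

text \<open>A bounded \<open>\<Theta>\<close> is excluded by the point at infinity, and a \<open>\<Theta>\<close> with interior points by the
  curve hypothesis; what remains are subsets of a line.\<close>

lemma unbounded_Theta_line:
  assumes D: "D \<in> hermitian_mats 2" and Sg: "Sg \<in> hermitian_mats 2"
    and unb: "\<not> bounded (Theta D Sg)" and int: "interior (Theta D Sg) = {}"
  shows "D $$ (0, 0) = 0" "D $$ (0, 1) \<noteq> 0" "0 \<le> Re (Sg $$ (0, 0))"
proof -
  note T = Theta_eq[OF D Sg]
  have re: "Im (D $$ (0, 0)) = 0" using hermitian_mats_cnj[OF D, of 0 0] by (simp add: complex_eq_iff)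
  show s: "0 \<le> Re (Sg $$ (0, 0))"
  proof (rule ccontr)
    assume "\<not> ?thesis"
    then have "bounded {\<theta>. 0 \<le> rhoR Sg \<theta>}" unfolding rhoR_def by (intro bounded_negative_quadratic) simp
    moreover have "Theta D Sg \<subseteq> {\<theta>. 0 \<le> rhoR Sg \<theta>}" unfolding T by auto
    ultimately show False using unb bounded_subset by blast
  qed
  have "\<not> Re (D $$ (0, 0)) < 0"
  proof
    assume "Re (D $$ (0, 0)) < 0"
    then have "bounded {\<theta>. 0 \<le> rhoR D \<theta>}" unfolding rhoR_def by (intro bounded_negative_quadratic)
    moreover have "Theta D Sg \<subseteq> {\<theta>. 0 \<le> rhoR D \<theta>}" unfolding T by auto
    ultimately show False using unb bounded_subset by blast
  qed
  moreover have "\<not> Re (D $$ (0, 0)) > 0"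
  proof
    assume "Re (D $$ (0, 0)) > 0"
    then have "bounded {\<theta>. 0 \<le> - Re (D $$ (0, 0)) * (cmod \<theta>)\<^sup>2 + 2 * Re (- D $$ (1, 0) * \<theta>) + - Re (D $$ (1, 1))}"
      by (intro bounded_negative_quadratic) simp
    moreover have "Theta D Sg \<subseteq> {\<theta>. 0 \<le> - Re (D $$ (0, 0)) * (cmod \<theta>)\<^sup>2 + 2 * Re (- D $$ (1, 0) * \<theta>) + - Re (D $$ (1, 1))}"
      unfolding T rhoR_def by auto
    ultimately show False using unb bounded_subset by blast
  qed
  ultimately show D0: "D $$ (0, 0) = 0" using re by (simp add: complex_eq_iff)
  show "D $$ (0, 1) \<noteq> 0"
  proof
    \<comment> \<open>The equation becomes constant in \<theta>, so a nonempty \<Theta> is a full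
      superlevel set of \<open>rhoR Sg\<close>, with the points of strict inequality in its
      interior.\<close>
    assume D1: "D $$ (0, 1) = 0"
    then have "D $$ (1, 0) = 0" using hermitian_mats_cnj[OF D, of 0 1] by simp
    then have rD: "rhoR D \<theta> = Re (D $$ (1, 1))" for \<theta> by (simp add: rhoR_def D0)
    obtain \<theta>1 where \<theta>1: "\<theta>1 \<in> Theta D Sg" using unb by fastforce
    then have T': "Theta D Sg = {\<theta>. 0 \<le> rhoR Sg \<theta>}" unfolding T rD by auto
    have op: "open {\<theta>. 0 < rhoR Sg \<theta>}"
      using open_Collect_less[OF continuous_on_const continuous_rhoR] by blast
    have neg: "rhoR Sg \<theta> \<le> 0" for \<theta>
    proof (rule ccontr)
      assume "\<not> ?thesis"
      then have "\<theta> \<in> interior (Theta D Sg)" unfolding T' using op by (intro interiorI[of "{\<theta>. 0 < rhoR Sg \<theta>}"]) auto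
      then show False using int by simp
    qed
    \<comment> \<open>Reflect \<theta> in a point of \<Theta>: the value at the mirror image is at
      most zero while the two values add up to something nonnegative. So \<Theta> would be the whole
      plane.\<close>
    have "0 \<le> rhoR Sg \<theta>" for \<theta>
    proof -
      have "0 \<le> rhoR Sg \<theta>1" using \<theta>1 T' by auto
      moreover have "0 \<le> 2 * Re (Sg $$ (0, 0)) * (cmod (\<theta> - \<theta>1))\<^sup>2" using s by simp
      ultimately show ?thesis
        using rhoR_midpoint[of Sg \<theta>1 "\<theta> - \<theta>1"] neg[of "\<theta>1 - (\<theta> - \<theta>1)"] by simp
    qed
    then have "Theta D Sg = UNIV" unfolding T' by auto
    then show False using int by simp
  qed
qed

text \<open>An indefinite real quadratic is a product of two independent linear factors, so that
  \<open>\<alpha> s\<^sup>2 + \<beta> s + \<gamma> \<ge> 0\<close> becomes nonnegativity of the Moebius transform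
  \<open>(p\<^sub>1 s + r\<^sub>1) / (p\<^sub>2 s + r\<^sub>2)\<close>.\<close>

lemma real_quadratic_factor:
  fixes \<alpha> \<beta> \<gamma> :: real
  assumes "0 \<le> \<alpha>" "\<alpha> * s0\<^sup>2 + \<beta> * s0 + \<gamma> < 0" "0 \<le> \<alpha> * s1\<^sup>2 + \<beta> * s1 + \<gamma>"
  obtains p1 r1 p2 r2 where "p1 * p2 = \<alpha>" "p1 * r2 + r1 * p2 = \<beta>" "r1 * r2 = \<gamma>" "p1 * r2 - r1 * p2 \<noteq> 0"
proof (cases "\<alpha> = 0")
  case True
  then have "\<beta> \<noteq> 0" using assms by auto
  \<comment> \<open>The instantiation order is \<open>p1, p2, r2, r1\<close>. The factors are
    \<open>\<beta> s + \<gamma>\<close> and the constant 1, whose zero lies at infinity.\<close>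
  then show thesis using that[of \<beta> 0 1 \<gamma>] True by simp
next
  case False
  then have a: "\<alpha> > 0" using assms(1) by simp
  define \<delta> where "\<delta> = \<beta>\<^sup>2 - 4 * \<alpha> * \<gamma>"
  have "4 * \<alpha> * (\<alpha> * s0\<^sup>2 + \<beta> * s0 + \<gamma>) = (2 * \<alpha> * s0 + \<beta>)\<^sup>2 - \<delta>"
    by (simp add: \<delta>_def power2_eq_square algebra_simps)
  moreover have "4 * \<alpha> * (\<alpha> * s0\<^sup>2 + \<beta> * s0 + \<gamma>) < 0" using a assms(2) by (simp add: mult_pos_neg)
  moreover have "0 \<le> (2 * \<alpha> * s0 + \<beta>)\<^sup>2" by simp
  ultimately have d: "\<delta> > 0" by linarith
  define w where "w = sqrt \<delta>"
  have w: "w > 0" "w * w = \<beta>\<^sup>2 - 4 * \<alpha> * \<gamma>" using d by (auto simp: w_def \<delta>_def)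
  show thesis
  \<comment> \<open>The factors are \<open>\<alpha> s + (\<beta> + w) / 2\<close> and
    \<open>s + (\<beta> - w) / (2 \<alpha>)\<close>, with \<open>w\<close> the root of the
    discriminant; their determinant is \<open>- w\<close>.\<close>
  proof (rule that[of \<alpha> 1 "(\<beta> - w) / (2 * \<alpha>)" "(\<beta> + w) / 2"])
    show "\<alpha> * 1 = \<alpha>" by simp
    show "\<alpha> * ((\<beta> - w) / (2 * \<alpha>)) + (\<beta> + w) / 2 * 1 = \<beta>" using a by (simp add: field_simps)
    have "(\<beta> + w) / 2 * ((\<beta> - w) / (2 * \<alpha>)) = (\<beta>\<^sup>2 - w * w) / (4 * \<alpha>)"
      by (simp add: power2_eq_square algebra_simps)
    then show "(\<beta> + w) / 2 * ((\<beta> - w) / (2 * \<alpha>)) = \<gamma>" unfolding w(2) using a by simp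
    show "\<alpha> * ((\<beta> - w) / (2 * \<alpha>)) - (\<beta> + w) / 2 * 1 \<noteq> 0" using a w(1) by (simp add: field_simps)
  qed
qed

section \<open>Null spaces and Kronecker products\<close>

lemma mult_mat_zero_vec: "A \<in> carrier_mat n m \<Longrightarrow> A *\<^sub>v 0\<^sub>v m = 0\<^sub>v n"
  by (intro eq_vecI) auto

text \<open>Removes the choice of basis: spanning makes every nonzero kernel vector a value of
  \<open>S\<close>, independence keeps values at nonzero vectors nonzero. If \<open>S\<close> has no
  columns, both sides are false.\<close>

lemma null_basis_image:
  assumes A: "A \<in> carrier_mat nr nc" and b: "is_null_basis A S"
  shows "z \<in> mat_kernel A \<and> z \<noteq> 0\<^sub>v nc \<longleftrightarrow>
    (\<exists>v \<in> carrier_vec (dim_col S). v \<noteq> 0\<^sub>v (dim_col S) \<and> z = S *\<^sub>v v)"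
proof -
  interpret kernel nr nc A using A by unfold_locales
  let ?cs = "cols S"
  have S: "S \<in> carrier_mat nc (dim_col S)" and dist: "distinct ?cs"
    using b A unfolding is_null_basis_def by auto
  have bas: "basis (set ?cs)" using b A unfolding is_null_basis_def by auto
  have ker: "set ?cs \<subseteq> mat_kernel A" and ind: "\<not> NC.lin_dep (set ?cs)"
    and gen: "NC.span (set ?cs) = mat_kernel A"
    using bas span_same lindep_same unfolding Ker.basis_def by auto
  have csc: "set ?cs \<subseteq> carrier_vec nc" using cols_dim[of S] S by auto
  have mult: "S *\<^sub>v vec (dim_col S) c = NC.lincomb_list c ?cs" for c
  proof -
    have "\<forall>w \<in> set ?cs. dim_vec w = nc" using csc by auto
    moreover have "mat_of_cols nc ?cs = S" using mat_of_cols_cols[of S] carrier_matD(1)[OF S] by simp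
    ultimately show ?thesis using NC.lincomb_list_as_mat_mult[of ?cs c] by (simp only: cols_length)
  qed
  have mult': "\<exists>f. S *\<^sub>v v = NC.lincomb f (set ?cs) \<and> (\<forall>i < dim_col S. f (?cs ! i) = v $ i)"
    if v: "v \<in> carrier_vec (dim_col S)" for v
  proof -
    \<comment> \<open>Coefficients of a linear combination are indexed by vectors, those of
      \<open>v\<close> by positions; distinctness of the columns makes the passage well
      defined.\<close>
    define f where "f w = v $ (THE i. i < dim_col S \<and> ?cs ! i = w)" for w
    have f: "f (?cs ! i) = v $ i" if i: "i < dim_col S" for i
    proof -
      have inj: "j = i" if "j < dim_col S \<and> ?cs ! j = ?cs ! i" for j
        by (rule iffD1[OF nth_eq_iff_index_eq[OF dist] conjunct2[OF that]]) (use that i in \<open>simp_all only: cols_length\<close>)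
      have "(THE j. j < dim_col S \<and> ?cs ! j = ?cs ! i) = i"
        by (rule the_equality) (rule conjI[OF i refl], rule inj)
      then show ?thesis by (simp only: f_def)
    qed
    have "vec (dim_col S) (\<lambda>i. f (?cs ! i)) = v" using f v by (intro eq_vecI) auto
    then have "S *\<^sub>v v = NC.lincomb f (set ?cs)"
      using mult[of "\<lambda>i. f (?cs ! i)"] NC.lincomb_as_lincomb_list_distinct[OF csc dist, of f] by simp
    then show ?thesis using f by blast
  qed
  show ?thesis
  proof
    assume z: "z \<in> mat_kernel A \<and> z \<noteq> 0\<^sub>v nc"
    then have "z \<in> NC.span_list ?cs" using gen NC.span_list_as_span[OF csc] by simp
    then obtain c where "z = NC.lincomb_list c ?cs" by (rule NC.in_span_listE)
    then have zS: "z = S *\<^sub>v vec (dim_col S) c" by (simp add: mult)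
    moreover have "vec (dim_col S) c \<noteq> 0\<^sub>v (dim_col S)"
    proof
      assume 0: "vec (dim_col S) c = 0\<^sub>v (dim_col S)"
      have "z = 0\<^sub>v nc" unfolding zS 0 by (rule mult_mat_zero_vec[OF S])
      then show False using z by simp
    qed
    ultimately show "\<exists>v \<in> carrier_vec (dim_col S). v \<noteq> 0\<^sub>v (dim_col S) \<and> z = S *\<^sub>v v"
      by (intro bexI[of _ "vec (dim_col S) c"]) auto
  next
    assume "\<exists>v \<in> carrier_vec (dim_col S). v \<noteq> 0\<^sub>v (dim_col S) \<and> z = S *\<^sub>v v"
    then obtain v where v: "v \<in> carrier_vec (dim_col S)" "v \<noteq> 0\<^sub>v (dim_col S)" "z = S *\<^sub>v v" by blast
    obtain f where f: "S *\<^sub>v v = NC.lincomb f (set ?cs)" "\<forall>i < dim_col S. f (?cs ! i) = v $ i"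
      using mult'[OF v(1)] by blast
    have "z \<in> mat_kernel A"
    proof -
      have "z \<in> NC.span (set ?cs)" unfolding v(3) f(1) NC.span_def by auto
      then show ?thesis using gen by simp
    qed
    moreover have "z \<noteq> 0\<^sub>v nc"
    proof
      assume z: "z = 0\<^sub>v nc"
      obtain i where i: "i < dim_col S" "v $ i \<noteq> 0"
        using v(1,2) by (metis carrier_vecD eq_vecI index_zero_vec(1,2))
      have mem: "col S i \<in> set ?cs" using i(1) by (metis cols_length cols_nth nth_mem)
      have "NC.lin_dep (set ?cs)"
        unfolding NC.lin_dep_def
        by (rule exI[of _ "set ?cs"], rule exI[of _ f], rule exI[of _ "?cs ! i"])
          (use f i z v(3) mem in \<open>auto simp: module_vec_simps class_ring_simps\<close>)
      then show False using ind by simp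
    qed
    ultimately show "z \<in> mat_kernel A \<and> z \<noteq> 0\<^sub>v nc" by blast
  qed
qed

section \<open>Block rows of \<open>N\<close> and the kernels in statement (i)\<close>

lemma smult_mat_mult_vec_assoc:
  "A \<in> carrier_mat n k \<Longrightarrow> w \<in> carrier_vec k \<Longrightarrow> (a \<cdot>\<^sub>m A) *\<^sub>v w = a \<cdot>\<^sub>v (A *\<^sub>v (w :: complex vec))"
  by (intro eq_vecI) (auto simp: scalar_prod_def sum_distrib_left mult.assoc)

definition top_rows :: "nat \<Rightarrow> complex mat \<Rightarrow> complex mat" where
  "top_rows n N = mat n (dim_col N) (\<lambda>(i, j). N $$ (i, j))"

definition bottom_rows :: "nat \<Rightarrow> complex mat \<Rightarrow> complex mat" where
  "bottom_rows n N = mat n (dim_col N) (\<lambda>(i, j). N $$ (n + i, j))"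

lemma rows_carrier:
  "N \<in> carrier_mat (2 * n) k \<Longrightarrow> top_rows n N \<in> carrier_mat n k"
  "N \<in> carrier_mat (2 * n) k \<Longrightarrow> bottom_rows n N \<in> carrier_mat n k"
  by (auto simp: top_rows_def bottom_rows_def)

text \<open>The empty right-hand blocks give \<open>N\<close> the shape needed for block
  multiplication by \<open>Xi\<close>, whose lower blocks have no rows.\<close>

lemma rows_split:
  assumes "N \<in> carrier_mat (2 * n) k"
  shows "N = four_block_mat (top_rows n N) (0\<^sub>m n 0) (bottom_rows n N) (0\<^sub>m n 0)"
  using assms by (intro eq_matI) (auto simp: top_rows_def bottom_rows_def)

lemma four_block_top:
  assumes "A \<in> carrier_mat n k"
  shows "four_block_mat A (0\<^sub>m n 0) (0\<^sub>m 0 k) (0\<^sub>m 0 0) = (A :: complex mat)"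
  using assms by (intro eq_matI) auto

lemma Xi_mult_finite:
  assumes N: "N \<in> carrier_mat (2 * n) k"
  shows "Xi n (Fin \<theta>) * N = top_rows n N - \<theta> \<cdot>\<^sub>m bottom_rows n N"
proof -
  note R = rows_carrier[OF N]
  have "Xi n (Fin \<theta>) * N = four_block_mat (1\<^sub>m n * top_rows n N + - (\<theta> \<cdot>\<^sub>m 1\<^sub>m n) * bottom_rows n N)
      (1\<^sub>m n * 0\<^sub>m n 0 + - (\<theta> \<cdot>\<^sub>m 1\<^sub>m n) * 0\<^sub>m n 0)
      (0\<^sub>m 0 n * top_rows n N + 0\<^sub>m 0 n * bottom_rows n N) (0\<^sub>m 0 n * 0\<^sub>m n 0 + 0\<^sub>m 0 n * 0\<^sub>m n 0)"
    by (subst rows_split[OF N], unfold Xi.simps, rule mult_four_block_mat) (use R in auto)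
  also have "1\<^sub>m n * top_rows n N + - (\<theta> \<cdot>\<^sub>m 1\<^sub>m n) * bottom_rows n N = top_rows n N - \<theta> \<cdot>\<^sub>m bottom_rows n N"
  proof -
    have "- (\<theta> \<cdot>\<^sub>m 1\<^sub>m n) * bottom_rows n N = - (\<theta> \<cdot>\<^sub>m bottom_rows n N)"
      using R by (simp add: mult_smult_assoc_mat[of _ n n _ k])
    then show ?thesis using R by (auto intro!: eq_matI)
  qed
  also have "1\<^sub>m n * 0\<^sub>m n 0 + - (\<theta> \<cdot>\<^sub>m 1\<^sub>m n) * 0\<^sub>m n 0 = (0\<^sub>m n 0 :: complex mat)" by (intro eq_matI) auto
  also have "0\<^sub>m 0 n * top_rows n N + 0\<^sub>m 0 n * bottom_rows n N = 0\<^sub>m 0 k" using R by (intro eq_matI) auto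
  also have "0\<^sub>m 0 n * 0\<^sub>m n 0 + 0\<^sub>m 0 n * 0\<^sub>m n 0 = (0\<^sub>m 0 0 :: complex mat)" by (intro eq_matI) auto
  finally show ?thesis using R by (subst (asm) four_block_top) auto
qed

lemma Xi_mult_infinite:
  assumes N: "N \<in> carrier_mat (2 * n) k"
  shows "Xi n Infty * N = - bottom_rows n N"
proof -
  note R = rows_carrier[OF N]
  have "Xi n Infty * N = four_block_mat (0\<^sub>m n n * top_rows n N + - (1\<^sub>m n) * bottom_rows n N)
      (0\<^sub>m n n * 0\<^sub>m n 0 + - (1\<^sub>m n) * 0\<^sub>m n 0)
      (0\<^sub>m 0 n * top_rows n N + 0\<^sub>m 0 n * bottom_rows n N) (0\<^sub>m 0 n * 0\<^sub>m n 0 + 0\<^sub>m 0 n * 0\<^sub>m n 0)"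
    by (subst rows_split[OF N], unfold Xi.simps, rule mult_four_block_mat) (use R in auto)
  also have "0\<^sub>m n n * top_rows n N + - (1\<^sub>m n) * bottom_rows n N = - bottom_rows n N"
    using R by (auto intro!: eq_matI)
  also have "0\<^sub>m n n * 0\<^sub>m n 0 + - (1\<^sub>m n) * 0\<^sub>m n 0 = (0\<^sub>m n 0 :: complex mat)" by (intro eq_matI) auto
  also have "0\<^sub>m 0 n * top_rows n N + 0\<^sub>m 0 n * bottom_rows n N = 0\<^sub>m 0 k" using R by (intro eq_matI) auto
  also have "0\<^sub>m 0 n * 0\<^sub>m n 0 + 0\<^sub>m 0 n * 0\<^sub>m n 0 = (0\<^sub>m 0 0 :: complex mat)" by (intro eq_matI) auto
  finally show ?thesis using R by (subst (asm) four_block_top) auto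
qed

lemma minus_eq_zero_vec_iff:
  assumes "a \<in> carrier_vec n" "b \<in> carrier_vec n"
  shows "a - b = 0\<^sub>v n \<longleftrightarrow> a = (b :: complex vec)"
proof
  assume 0: "a - b = 0\<^sub>v n"
  show "a = b"
  proof (rule eq_vecI)
    fix i assume "i < dim_vec b"
    then have i: "i < n" using assms by simp
    have "(a - b) $ i = 0" using 0 i by simp
    then show "a $ i = b $ i" using i assms by simp
  qed (use assms in auto)
qed (use assms in auto)

lemma kernel_Xi_finite:
  assumes N: "N \<in> carrier_mat (2 * n) k"
  shows "w \<in> mat_kernel (Xi n (Fin \<theta>) * N) \<longleftrightarrow>
    w \<in> carrier_vec k \<and> top_rows n N *\<^sub>v w = \<theta> \<cdot>\<^sub>v (bottom_rows n N *\<^sub>v w)"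
proof -
  note R = rows_carrier[OF N]
  have c: "top_rows n N - \<theta> \<cdot>\<^sub>m bottom_rows n N \<in> carrier_mat n k" using R by auto
  have "(top_rows n N - \<theta> \<cdot>\<^sub>m bottom_rows n N) *\<^sub>v w = top_rows n N *\<^sub>v w - \<theta> \<cdot>\<^sub>v (bottom_rows n N *\<^sub>v w)"
    if "w \<in> carrier_vec k"
    using R that by (subst minus_mult_distrib_mat_vec[of _ n k]) (auto simp: smult_mat_mult_vec_assoc[of _ n k])
  then show ?thesis
    unfolding Xi_mult_finite[OF N] mat_kernel[OF c]
    using minus_eq_zero_vec_iff[of "top_rows n N *\<^sub>v w" n "\<theta> \<cdot>\<^sub>v (bottom_rows n N *\<^sub>v w)"] R by auto
qed

lemma kernel_Xi_infinite:
  assumes N: "N \<in> carrier_mat (2 * n) k"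
  shows "w \<in> mat_kernel (Xi n Infty * N) \<longleftrightarrow> w \<in> carrier_vec k \<and> bottom_rows n N *\<^sub>v w = 0\<^sub>v n"
proof -
  note R = rows_carrier[OF N]
  have c: "- bottom_rows n N \<in> carrier_mat n k" using R by auto
  have "- bottom_rows n N *\<^sub>v w = - (bottom_rows n N *\<^sub>v w)" if "w \<in> carrier_vec k"
    using R that by auto
  then show ?thesis
    unfolding Xi_mult_infinite[OF N] mat_kernel[OF c] using R
    by (auto simp: uminus_zero_vec_eq)
qed

section \<open>Quadratic forms of Kronecker products\<close>

lemma kronecker_2_blocks:
  assumes D: "D \<in> carrier_mat 2 2" and U: "U \<in> carrier_mat n n"
  shows "D \<otimes>\<^sub>K U = four_block_mat (D $$ (0, 0) \<cdot>\<^sub>m U) (D $$ (0, 1) \<cdot>\<^sub>m U) (D $$ (1, 0) \<cdot>\<^sub>m U) (D $$ (1, 1) \<cdot>\<^sub>m (U :: complex mat))"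
    (is "_ = ?B")
proof (rule eq_matI)
  fix i j assume "i < dim_row ?B" "j < dim_col ?B"
  then have ij: "i < n + n" "j < n + n" using U by auto
  have d: "l div n = (if l < n then 0 else 1)" "l mod n = (if l < n then l else l - n)" if "l < n + n" for l
    using that by (auto simp: div_nat_eqI mod_if[of l n])
  show "(D \<otimes>\<^sub>K U) $$ (i, j) = ?B $$ (i, j)"
    using ij D U by (auto simp: kronecker_def d)
qed (use D U in \<open>auto simp: kronecker_def\<close>)

lemma kronecker_2_carrier:
  assumes "D \<in> carrier_mat 2 2" "U \<in> carrier_mat n n"
  shows "D \<otimes>\<^sub>K U \<in> carrier_mat (2 * n) (2 * (n :: nat))"
  using assms by (auto simp: kronecker_def)

lemma kronecker_hermitian:
  assumes D: "D \<in> hermitian_mats 2" and U: "U \<in> hermitian_mats n"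
  shows "D \<otimes>\<^sub>K U \<in> hermitian_mats (2 * n)"
proof (rule hermitian_matsI)
  note D' = hermitian_matsD[OF D] and U' = hermitian_matsD[OF U]
  show "D \<otimes>\<^sub>K U \<in> carrier_mat (2 * n) (2 * n)" by (rule kronecker_2_carrier[OF D'(1) U'(1)])
  fix i j assume ij: "i < 2 * n" "j < 2 * n"
  then have n: "0 < n" by auto
  have "i div n < 2" "j div n < 2" "i mod n < n" "j mod n < n"
    using ij n by (auto simp: less_mult_imp_div_less)
  then show "cnj ((D \<otimes>\<^sub>K U) $$ (j, i)) = (D \<otimes>\<^sub>K U) $$ (i, j)"
    using ij D' U' by (simp add: kronecker_def hermitian_mats_cnj[OF D] hermitian_mats_cnj[OF U])
qed

lemma rows_split_vec:
  assumes N: "N \<in> carrier_mat (2 * n) k" and w: "w \<in> carrier_vec k"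
  shows "N *\<^sub>v w = (top_rows n N *\<^sub>v w) @\<^sub>v (bottom_rows n N *\<^sub>v w)"
proof (rule eq_vecI)
  fix i assume "i < dim_vec ((top_rows n N *\<^sub>v w) @\<^sub>v (bottom_rows n N *\<^sub>v w))"
  then have i: "i < 2 * n" using rows_carrier[OF N] by auto
  have "row N i = (if i < n then row (top_rows n N) i else row (bottom_rows n N) (i - n))"
    using i N by (auto simp: top_rows_def bottom_rows_def intro!: eq_vecI)
  then show "(N *\<^sub>v w) $ i = ((top_rows n N *\<^sub>v w) @\<^sub>v (bottom_rows n N *\<^sub>v w)) $ i"
    using i N rows_carrier[OF N] by auto
qed (use N rows_carrier[OF N] in auto)

lemma conjugate_append_vec:
  "conjugate (a @\<^sub>v b) = conjugate a @\<^sub>v conjugate (b :: complex vec)"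
  by (intro eq_vecI) (auto simp: append_vec_def Let_def)

lemma kronecker_form:
  assumes D: "D \<in> carrier_mat 2 2" and U: "(U :: complex mat) \<in> carrier_mat n n"
    and f: "f \<in> carrier_vec n" and g: "g \<in> carrier_vec n"
  shows "((D \<otimes>\<^sub>K U) *\<^sub>v (f @\<^sub>v g)) \<bullet>c (f @\<^sub>v g) =
    D $$ (0, 0) * ((U *\<^sub>v f) \<bullet>c f) + D $$ (0, 1) * ((U *\<^sub>v g) \<bullet>c f) +
    D $$ (1, 0) * ((U *\<^sub>v f) \<bullet>c g) + D $$ (1, 1) * ((U *\<^sub>v g) \<bullet>c g)"
proof -
  have "(D \<otimes>\<^sub>K U) *\<^sub>v (f @\<^sub>v g) =
      (D $$ (0, 0) \<cdot>\<^sub>v (U *\<^sub>v f) + D $$ (0, 1) \<cdot>\<^sub>v (U *\<^sub>v g)) @\<^sub>v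
      (D $$ (1, 0) \<cdot>\<^sub>v (U *\<^sub>v f) + D $$ (1, 1) \<cdot>\<^sub>v (U *\<^sub>v g))"
    unfolding kronecker_2_blocks[OF D U]
    using four_block_mat_mult_vec[of "D $$ (0, 0) \<cdot>\<^sub>m U" n n "D $$ (0, 1) \<cdot>\<^sub>m U" n "D $$ (1, 0) \<cdot>\<^sub>m U" n "D $$ (1, 1) \<cdot>\<^sub>m U" f g]
      U f g by (simp add: smult_mat_mult_vec_assoc[of _ n n])
  then show ?thesis
    using U f g
    by (simp add: conjugate_append_vec scalar_prod_append[of _ n _ n] add_scalar_prod_distrib[of _ n])
qed

text \<open>The same expression as in \<open>kronecker_form\<close> at \<open>f = F w\<close>,
  \<open>g = G w\<close>: the duality between \<open>block_form\<close> and the Kronecker product on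
  rank-one matrices. The mixed terms match because the trace of \<open>U g f^*\<close> is
  \<open>f^* U g\<close>.\<close>

lemma tr_prod_block_form_outer:
  assumes F: "F \<in> carrier_mat n k" and G: "G \<in> carrier_mat n k" and U: "U \<in> carrier_mat n n" and w: "w \<in> carrier_vec k"
  shows "tr_prod U (block_form D F G (outer w w)) =
    D $$ (0, 0) * ((U *\<^sub>v (F *\<^sub>v w)) \<bullet>c (F *\<^sub>v w)) + D $$ (0, 1) * ((U *\<^sub>v (G *\<^sub>v w)) \<bullet>c (F *\<^sub>v w)) +
    D $$ (1, 0) * ((U *\<^sub>v (F *\<^sub>v w)) \<bullet>c (G *\<^sub>v w)) + D $$ (1, 1) * ((U *\<^sub>v (G *\<^sub>v w)) \<bullet>c (G *\<^sub>v w))"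
proof -
  have o: "X * outer w w * mat_adjoint Y = outer (X *\<^sub>v w) (Y *\<^sub>v w)"
    if "X \<in> carrier_mat n k" "Y \<in> carrier_mat n k" for X Y
    using that w by (simp add: mult_outer[of _ n k] outer_mult_adjoint[of _ n k])
  have c: "outer (X *\<^sub>v w) (Y *\<^sub>v w) \<in> carrier_mat n n" if "X \<in> carrier_mat n k" "Y \<in> carrier_mat n k" for X Y
    using that w by simp
  have v: "F *\<^sub>v w \<in> carrier_vec n" "G *\<^sub>v w \<in> carrier_vec n" using F G w by auto
  show ?thesis
    unfolding block_form_def o[OF F F] o[OF F G] o[OF G F] o[OF G G]
    using U c[OF F F] c[OF F G] c[OF G F] c[OF G G] v
    by (simp add: tr_prod_add[of _ n n] tr_prod_smult_right[of _ n n] tr_prod_outer[of _ n])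
qed

section \<open>The lossless S-procedure\<close>

lemma eq_matI_carrier:
  assumes "A \<in> carrier_mat n m" "B \<in> carrier_mat n m"
    and "\<And>i j. i < n \<Longrightarrow> j < m \<Longrightarrow> A $$ (i, j) = B $$ (i, j)"
  shows "A = B"
  using assms by (intro eq_matI) auto

lemma sandwich_comb_left:
  assumes F1: "F1 \<in> carrier_mat n k" and F2: "F2 \<in> carrier_mat n k" and Y: "Y \<in> carrier_mat n k"
    and S: "S \<in> carrier_mat k k" and ij: "i < n" "j < n"
  shows "((a \<cdot>\<^sub>m F1 + b \<cdot>\<^sub>m F2) * S * mat_adjoint (Y :: complex mat)) $$ (i, j) =
    a * (F1 * S * mat_adjoint Y) $$ (i, j) + b * (F2 * S * mat_adjoint Y) $$ (i, j)"
proof -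
  have aY: "mat_adjoint Y \<in> carrier_mat k n" using Y by simp
  have FS: "F1 * S \<in> carrier_mat n k" "F2 * S \<in> carrier_mat n k" using F1 F2 S by auto
  have "(a \<cdot>\<^sub>m F1 + b \<cdot>\<^sub>m F2) * S * mat_adjoint Y = a \<cdot>\<^sub>m (F1 * S * mat_adjoint Y) + b \<cdot>\<^sub>m (F2 * S * mat_adjoint Y)"
    using F1 F2 S FS aY
    by (simp add: add_mult_distrib_mat[of _ n k _ _ k] add_mult_distrib_mat[of _ n k _ _ n]
        mult_smult_assoc_mat[of _ n k _ k] mult_smult_assoc_mat[of _ n k _ n])
  then show ?thesis
    using ij sandwich_carrier[OF F1 S Y] sandwich_carrier[OF F2 S Y] by (simp del: index_mult_mat)
qed

text \<open>Obtained from the left version by adjoints, hence the hermiticity of \<open>S\<close>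
  and the conjugated coefficients.\<close>

lemma sandwich_comb_right:
  assumes F1: "F1 \<in> carrier_mat n k" and F2: "F2 \<in> carrier_mat n k" and Y: "Y \<in> carrier_mat n k"
    and S: "S \<in> hermitian_mats k" and ij: "i < n" "j < n"
  shows "(Y * S * mat_adjoint (a \<cdot>\<^sub>m F1 + b \<cdot>\<^sub>m F2)) $$ (i, j) =
    cnj a * (Y * S * mat_adjoint F1) $$ (i, j) + cnj b * (Y * S * mat_adjoint F2) $$ (i, j)"
proof -
  note S' = hermitian_matsD(1)[OF S]
  have F: "a \<cdot>\<^sub>m F1 + b \<cdot>\<^sub>m F2 \<in> carrier_mat n k" using F1 F2 by auto
  have e: "(Y * S * mat_adjoint X) $$ (i, j) = cnj ((X * S * mat_adjoint Y) $$ (j, i))"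
    if X: "X \<in> carrier_mat n k" for X
    unfolding sandwich_adjoint[OF X Y S, symmetric]
    using sandwich_carrier[OF X S' Y] ij by (intro mat_adjoint_index) auto
  show ?thesis
    unfolding e[OF F] e[OF F1] e[OF F2] sandwich_comb_left[OF F1 F2 Y S' ij(2,1)] by simp
qed

text \<open>The inverse Moebius transformation on ratios of vectors, with \<open>g = 0\<close> as
  ratio infinity. Either alternative is a real relation \<open>u f = v g\<close>, nontrivial because
  the determinant is nonzero, and for nonzero \<open>u\<close> the quadratic at \<open>v / u\<close>
  is zero or \<open>s\<close> times a square.\<close>

lemma moebius_ratio:
  fixes f g :: "complex vec"
  assumes f: "f \<in> carrier_vec n" and g: "g \<in> carrier_vec n"
    and pr: "p1 * p2 = \<alpha>" "p1 * r2 + r1 * p2 = \<beta>" "r1 * r2 = \<gamma>" "p1 * r2 - r1 * p2 \<noteq> 0"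
    and fg: "complex_of_real p2 \<cdot>\<^sub>v f + complex_of_real r2 \<cdot>\<^sub>v g = 0\<^sub>v n \<or>
      complex_of_real p1 \<cdot>\<^sub>v f + complex_of_real r1 \<cdot>\<^sub>v g =
        complex_of_real s \<cdot>\<^sub>v (complex_of_real p2 \<cdot>\<^sub>v f + complex_of_real r2 \<cdot>\<^sub>v g) \<and> 0 \<le> s"
  shows "g = 0\<^sub>v n \<or> (\<exists>\<sigma>. 0 \<le> \<alpha> * \<sigma>\<^sup>2 + \<beta> * \<sigma> + \<gamma> \<and> f = complex_of_real \<sigma> \<cdot>\<^sub>v g)"
proof -
  have quad: "\<alpha> * \<sigma>\<^sup>2 + \<beta> * \<sigma> + \<gamma> = (p1 * \<sigma> + r1) * (p2 * \<sigma> + r2)" for \<sigma>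
    unfolding pr(1-3)[symmetric] by (simp add: power2_eq_square algebra_simps)
  have "\<exists>u v. (u \<noteq> 0 \<or> v \<noteq> 0) \<and> (\<forall>i < n. complex_of_real u * f $ i = complex_of_real v * g $ i) \<and>
      (u \<noteq> 0 \<longrightarrow> 0 \<le> (p1 * (v / u) + r1) * (p2 * (v / u) + r2))"
    using fg
  proof (elim disjE conjE)
    assume 0: "complex_of_real p2 \<cdot>\<^sub>v f + complex_of_real r2 \<cdot>\<^sub>v g = 0\<^sub>v n"
    have "complex_of_real p2 * f $ i = complex_of_real (- r2) * g $ i" if "i < n" for i
    proof -
      have "(complex_of_real p2 \<cdot>\<^sub>v f + complex_of_real r2 \<cdot>\<^sub>v g) $ i = 0" using 0 that by simp
      then show ?thesis using that f g by (simp add: eq_neg_iff_add_eq_0)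
    qed
    then show ?thesis using pr(4) by (intro exI[of _ p2] exI[of _ "- r2"]) auto
  next
    assume e: "complex_of_real p1 \<cdot>\<^sub>v f + complex_of_real r1 \<cdot>\<^sub>v g =
        complex_of_real s \<cdot>\<^sub>v (complex_of_real p2 \<cdot>\<^sub>v f + complex_of_real r2 \<cdot>\<^sub>v g)" and s: "0 \<le> s"
    define u v where "u = p1 - s * p2" and "v = s * r2 - r1"
    have "complex_of_real u * f $ i = complex_of_real v * g $ i" if "i < n" for i
    proof -
      have "(complex_of_real p1 \<cdot>\<^sub>v f + complex_of_real r1 \<cdot>\<^sub>v g) $ i =
          (complex_of_real s \<cdot>\<^sub>v (complex_of_real p2 \<cdot>\<^sub>v f + complex_of_real r2 \<cdot>\<^sub>v g)) $ i" using e by simp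
      then show ?thesis using that f g by (simp add: u_def v_def algebra_simps)
    qed
    moreover have "u \<noteq> 0 \<or> v \<noteq> 0"
    proof (rule ccontr)
      assume "\<not> ?thesis"
      then have "p1 = s * p2" "r1 = s * r2" by (auto simp: u_def v_def)
      then show False using pr(4) by simp
    qed
    moreover have "0 \<le> (p1 * (v / u) + r1) * (p2 * (v / u) + r2)" if "u \<noteq> 0"
    proof -
      \<comment> \<open>With \<open>u\<close> and \<open>v\<close> substituted, both numerators are
        multiples of the determinant, the first with the extra factor \<open>s\<close>.\<close>
      have "p1 * (v / u) + r1 = s * (p1 * r2 - r1 * p2) / u" "p2 * (v / u) + r2 = (p1 * r2 - r1 * p2) / u"
        using that by (simp_all add: field_simps) (simp_all add: u_def v_def algebra_simps)
      then have "(p1 * (v / u) + r1) * (p2 * (v / u) + r2) = s * ((p1 * r2 - r1 * p2) / u)\<^sup>2"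
        by (simp add: power2_eq_square)
      then show ?thesis using s by simp
    qed
    ultimately show ?thesis by blast
  qed
  then obtain u v where uv: "u \<noteq> 0 \<or> v \<noteq> 0" "\<forall>i < n. complex_of_real u * f $ i = complex_of_real v * g $ i"
    "u \<noteq> 0 \<longrightarrow> 0 \<le> (p1 * (v / u) + r1) * (p2 * (v / u) + r2)" by blast
  show ?thesis
  proof (cases "u = 0")
    case True
    then have "g = 0\<^sub>v n" using uv(1,2) g by (intro eq_vecI) auto
    then show ?thesis by simp
  next
    case False
    have "f = complex_of_real (v / u) \<cdot>\<^sub>v g"
      using uv(2) False f g by (intro eq_vecI) (auto simp: field_simps)
    then show ?thesis unfolding quad using uv(3) False by blast
  qed
qed

text \<open>Coordinates are adapted to the line \<open>2 * Re (cnj b * \<theta>) + c = 0\<close>,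
  parametrized as \<open>\<theta>0 + e * s\<close> with real \<open>s\<close>. Writing
  \<open>F = e F' + \<theta>0 G\<close> turns \<open>F w = \<theta> G w\<close> into
  \<open>F' w = s G w\<close>, the \<open>D\<close> constraint into hermiticity of
  \<open>F' S G^*\<close>, and the \<open>Sg\<close> constraint into
  \<open>\<alpha> R + \<beta> X + \<gamma> Q = Y Y^*\<close>.\<close>

lemma constrained_gram:
  assumes P: "P \<in> carrier_mat k k" and F: "F \<in> carrier_mat n k" and G: "G \<in> carrier_mat n k"
    and D: "D \<in> hermitian_mats 2" and Sg: "Sg \<in> hermitian_mats 2"
    and D0: "D $$ (0, 0) = 0" and D1: "D $$ (0, 1) \<noteq> 0" and Sg0: "0 \<le> Re (Sg $$ (0, 0))"
    and ne: "Theta D Sg \<noteq> {}"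
    and neg: "\<And>w. w \<in> carrier_vec k \<Longrightarrow> w \<noteq> 0\<^sub>v k \<Longrightarrow>
      G *\<^sub>v w = 0\<^sub>v n \<or> (\<exists>\<theta> \<in> Theta D Sg. F *\<^sub>v w = \<theta> \<cdot>\<^sub>v (G *\<^sub>v w)) \<Longrightarrow> Re ((P *\<^sub>v w) \<bullet>c w) < 0"
    and Z: "Z \<in> carrier_mat k k" and Y: "Y \<in> carrier_mat n n"
    and eqD: "block_form D F G (Z * mat_adjoint Z) = 0\<^sub>m n n"
    and eqS: "block_form Sg F G (Z * mat_adjoint Z) = Y * mat_adjoint Y"
  shows "Z = 0\<^sub>m k k \<or> Re (tr_prod P (Z * mat_adjoint Z)) < 0"
proof -
  define b where "b = D $$ (0, 1)"
  define c where "c = Re (D $$ (1, 1))"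
  \<comment> \<open>The point of the line nearest to the origin; \<open>e\<close> below is
    orthogonal to \<open>b\<close> and hence points along the line.\<close>
  define \<theta>0 where "\<theta>0 = complex_of_real (- c / (2 * (cmod b)\<^sup>2)) * b"
  define e where "e = \<i> * b"
  define F' where "F' = inverse e \<cdot>\<^sub>m F + (- \<theta>0 / e) \<cdot>\<^sub>m G"
  have b: "b \<noteq> 0" and e: "e \<noteq> 0" using D1 by (auto simp: b_def e_def)
  have D10: "D $$ (1, 0) = cnj b" using hermitian_mats_cnj[OF D, of 0 1] by (simp add: b_def)
  have D11: "D $$ (1, 1) = complex_of_real c"
    using hermitian_mats_cnj[OF D, of 1 1] by (simp add: c_def complex_eq_iff)
  have bb: "b * cnj b = complex_of_real ((cmod b)\<^sup>2)" by (rule complex_norm_square[symmetric])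
  have b0: "cnj b * \<theta>0 = complex_of_real (- c / 2)"
  proof -
    have "cnj b * \<theta>0 = complex_of_real (- c / (2 * (cmod b)\<^sup>2)) * (b * cnj b)" by (simp add: \<theta>0_def)
    also have "\<dots> = complex_of_real (- c / (2 * (cmod b)\<^sup>2) * (cmod b)\<^sup>2)" unfolding bb by (simp only: of_real_mult)
    also have "- c / (2 * (cmod b)\<^sup>2) * (cmod b)\<^sup>2 = - c / 2" using b by simp
    finally show ?thesis .
  qed
  have b0': "b * cnj \<theta>0 = complex_of_real (- c / 2)"
    using arg_cong[OF b0, of cnj] by simp
  define \<alpha> where "\<alpha> = Re (Sg $$ (0, 0)) * (cmod e)\<^sup>2"
  define \<beta> where "\<beta> = 2 * Re (Sg $$ (0, 0)) * Re (cnj \<theta>0 * e) + 2 * Re (Sg $$ (1, 0) * e)"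
  define \<gamma> where "\<gamma> = rhoR Sg \<theta>0"
  have quad: "rhoR Sg (\<theta>0 + e * complex_of_real s) = \<alpha> * s\<^sup>2 + \<beta> * s + \<gamma>" for s
    unfolding rhoR_def \<alpha>_def \<beta>_def \<gamma>_def cmod_power2 by (simp add: power2_eq_square algebra_simps)
  have onD: "rhoR D (\<theta>0 + e * complex_of_real s) = 0" for s
  proof -
    have "D $$ (1, 0) * (\<theta>0 + e * complex_of_real s) = complex_of_real (- c / 2) + \<i> * complex_of_real ((cmod b)\<^sup>2 * s)"
      unfolding D10 ring_distribs b0 e_def using bb by (simp add: mult_ac)
    then show ?thesis unfolding rhoR_def D0 c_def[symmetric] by simp
  qed
  have inTheta: "\<theta>0 + e * complex_of_real s \<in> Theta D Sg" if "0 \<le> \<alpha> * s\<^sup>2 + \<beta> * s + \<gamma>" for s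
    unfolding Theta_eq[OF D Sg] using onD quad that by simp
  have ex: "\<exists>s. 0 \<le> \<alpha> * s\<^sup>2 + \<beta> * s + \<gamma>"
  proof -
    obtain \<theta> where \<theta>: "rhoR D \<theta> = 0" "0 \<le> rhoR Sg \<theta>" using ne unfolding Theta_eq[OF D Sg] by blast
    \<comment> \<open>For a point of the line this number is purely imaginary, which makes the
      parameter \<open>s\<close> real.\<close>
    define z where "z = cnj b * (\<theta> - \<theta>0)"
    have "Re (cnj b * \<theta>) = - c / 2" using \<theta>(1) unfolding rhoR_def D0 D10 c_def[symmetric] by simp
    then have "Re z = 0" unfolding z_def right_diff_distrib b0 by simp
    then have z: "z = \<i> * complex_of_real (Im z)" by (simp add: complex_eq_iff)
    define s where "s = Im z / (cmod b)\<^sup>2"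
    have "e * complex_of_real s * cnj b = \<i> * complex_of_real ((cmod b)\<^sup>2 * s)"
      unfolding e_def using bb by (simp add: mult_ac)
    also have "(cmod b)\<^sup>2 * s = Im z" using b by (simp add: s_def)
    finally have "e * complex_of_real s * cnj b = (\<theta> - \<theta>0) * cnj b" using z by (simp add: z_def mult.commute)
    then have "e * complex_of_real s = \<theta> - \<theta>0" using b by simp
    then have "\<theta> = \<theta>0 + e * complex_of_real s" by simp
    then show ?thesis using \<theta>(2) quad[of s] by auto
  qed
  have \<alpha>: "0 \<le> \<alpha>" using Sg0 by (simp add: \<alpha>_def)
  have F': "F' \<in> carrier_mat n k" using F G by (simp add: F'_def)
  have FF': "F = e \<cdot>\<^sub>m F' + \<theta>0 \<cdot>\<^sub>m G"
    unfolding F'_def using F G e by (intro eq_matI) (auto simp: field_simps)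
  have Fw: "F *\<^sub>v w = e \<cdot>\<^sub>v (F' *\<^sub>v w) + \<theta>0 \<cdot>\<^sub>v (G *\<^sub>v w)" if "w \<in> carrier_vec k" for w
    using that F' G by (subst FF') (simp add: add_mult_distrib_mat_vec[of _ n k] smult_mat_mult_vec_assoc[of _ n k])
  have Fgood: "F *\<^sub>v w = (\<theta>0 + e * complex_of_real s) \<cdot>\<^sub>v (G *\<^sub>v w)"
    if "w \<in> carrier_vec k" "F' *\<^sub>v w = complex_of_real s \<cdot>\<^sub>v (G *\<^sub>v w)" for w s
    unfolding Fw[OF that(1)] that(2) using G that(1) by (intro eq_vecI) (auto simp: algebra_simps)
  have neg': "Re ((P *\<^sub>v w) \<bullet>c w) < 0"
    if w: "w \<in> carrier_vec k" "w \<noteq> 0\<^sub>v k"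
      and "G *\<^sub>v w = 0\<^sub>v n \<or> (\<exists>s. 0 \<le> \<alpha> * s\<^sup>2 + \<beta> * s + \<gamma> \<and> F' *\<^sub>v w = complex_of_real s \<cdot>\<^sub>v (G *\<^sub>v w))" for w
    using neg[OF w] that(3) Fgood[OF w(1)] inTheta by blast
  let ?S = "Z * mat_adjoint Z"
  have Sh: "?S \<in> hermitian_mats k" by (rule gram_hermitian[OF Z])
  note Sc = hermitian_matsD(1)[OF Sh]
  define X where "X i j = (F' * ?S * mat_adjoint G) $$ (i, j)" for i j
  define Xt where "Xt i j = (G * ?S * mat_adjoint F') $$ (i, j)" for i j
  define Q where "Q i j = (G * ?S * mat_adjoint G) $$ (i, j)" for i j
  define R where "R i j = (F' * ?S * mat_adjoint F') $$ (i, j)" for i j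
  have left: "(F * ?S * mat_adjoint W) $$ (i, j) = e * (F' * ?S * mat_adjoint W) $$ (i, j) + \<theta>0 * (G * ?S * mat_adjoint W) $$ (i, j)"
    if "i < n" "j < n" "W \<in> carrier_mat n k" for i j W
    using sandwich_comb_left[OF F' G that(3) Sc that(1,2), of e \<theta>0] unfolding FF'[symmetric] .
  have right: "(W * ?S * mat_adjoint F) $$ (i, j) = cnj e * (W * ?S * mat_adjoint F') $$ (i, j) + cnj \<theta>0 * (W * ?S * mat_adjoint G) $$ (i, j)"
    if "i < n" "j < n" "W \<in> carrier_mat n k" for i j W
    using sandwich_comb_right[OF F' G that(3) Sh that(1,2), of e \<theta>0] unfolding FF'[symmetric] .
  have FG: "(F * ?S * mat_adjoint G) $$ (i, j) = e * X i j + \<theta>0 * Q i j"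
    and GF: "(G * ?S * mat_adjoint F) $$ (i, j) = cnj e * Xt i j + cnj \<theta>0 * Q i j"
    and FF: "(F * ?S * mat_adjoint F) $$ (i, j) = e * cnj e * R i j + e * cnj \<theta>0 * X i j + \<theta>0 * cnj e * Xt i j + \<theta>0 * cnj \<theta>0 * Q i j"
    if "i < n" "j < n" for i j
    using left[OF that G] right[OF that G] left[OF that F] right[OF that F'] right[OF that G]
    by (simp_all add: X_def Xt_def Q_def R_def algebra_simps)
  \<comment> \<open>The choice of \<open>\<theta>0\<close> cancels all terms in \<open>Q\<close>,
    and \<open>e = \<i> * b\<close> leaves
    \<open>\<i> * (cmod b)\<^sup>2 * (X - Xt)\<close>.\<close>
  have XX: "Xt i j = X i j" if ij: "i < n" "j < n" for i j
  proof -
    have "block_form D F G ?S $$ (i, j) = 0" using eqD ij by simp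
    then have "b * (cnj e * Xt i j + cnj \<theta>0 * Q i j) + cnj b * (e * X i j + \<theta>0 * Q i j) + complex_of_real c * Q i j = 0"
      unfolding block_form_index[OF F G Sc ij] FG[OF ij] GF[OF ij] D0 D10 D11 b_def[symmetric] Q_def[symmetric] by simp
    moreover have "b * (cnj e * Xt i j + cnj \<theta>0 * Q i j) + cnj b * (e * X i j + \<theta>0 * Q i j) + complex_of_real c * Q i j
        = \<i> * (b * cnj b) * (X i j - Xt i j) + (b * cnj \<theta>0 + cnj b * \<theta>0 + complex_of_real c) * Q i j"
      by (simp add: e_def algebra_simps)
    moreover have "b * cnj \<theta>0 + cnj b * \<theta>0 + complex_of_real c = 0" unfolding b0 b0' by simp
    ultimately show ?thesis using b by simp
  qed
  have YY: "(Y * mat_adjoint Y) $$ (i, j) = complex_of_real \<alpha> * R i j + complex_of_real \<beta> * X i j + complex_of_real \<gamma> * Q i j"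
    if ij: "i < n" "j < n" for i j
  proof -
    define a0 where "a0 = Re (Sg $$ (0, 0))"
    define a2 where "a2 = Re (Sg $$ (1, 1))"
    define a1 where "a1 = Sg $$ (1, 0)"
    have S0: "Sg $$ (0, 0) = complex_of_real a0" and S3: "Sg $$ (1, 1) = complex_of_real a2"
      using hermitian_mats_cnj[OF Sg, of 0 0] hermitian_mats_cnj[OF Sg, of 1 1]
      by (auto simp: a0_def a2_def complex_eq_iff)
    have S1: "Sg $$ (0, 1) = cnj a1" using hermitian_mats_cnj[OF Sg, of 1 0] by (simp add: a1_def)
    have re2: "complex_of_real (2 * Re u) = u + cnj u" for u by (simp add: complex_eq_iff)
    have \<alpha>': "complex_of_real \<alpha> = complex_of_real a0 * (e * cnj e)"
      unfolding \<alpha>_def a0_def[symmetric] by (simp only: of_real_mult complex_norm_square)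
    have \<beta>': "complex_of_real \<beta> = complex_of_real a0 * (cnj \<theta>0 * e + \<theta>0 * cnj e) + (a1 * e + cnj a1 * cnj e)"
    proof -
      have "complex_of_real \<beta> = complex_of_real a0 * complex_of_real (2 * Re (cnj \<theta>0 * e)) + complex_of_real (2 * Re (a1 * e))"
        unfolding \<beta>_def a0_def a1_def by simp
      then show ?thesis unfolding re2 by simp
    qed
    have \<gamma>': "complex_of_real \<gamma> = complex_of_real a0 * (\<theta>0 * cnj \<theta>0) + (a1 * \<theta>0 + cnj a1 * cnj \<theta>0) + complex_of_real a2"
    proof -
      have "complex_of_real \<gamma> = complex_of_real a0 * complex_of_real ((cmod \<theta>0)\<^sup>2) + complex_of_real (2 * Re (a1 * \<theta>0)) + complex_of_real a2"
        unfolding \<gamma>_def rhoR_def a0_def a1_def a2_def by simp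
      then show ?thesis unfolding re2 complex_norm_square by simp
    qed
    have "(Y * mat_adjoint Y) $$ (i, j) = block_form Sg F G ?S $$ (i, j)" unfolding eqS ..
    also have "\<dots> = complex_of_real \<alpha> * R i j + complex_of_real \<beta> * X i j + complex_of_real \<gamma> * Q i j"
      unfolding block_form_index[OF F G Sc ij] FG[OF ij] GF[OF ij] FF[OF ij] XX[OF ij] S0 S1 S3 a1_def[symmetric]
        Q_def[symmetric] \<alpha>' \<beta>' \<gamma>' by (simp add: algebra_simps)
    finally show ?thesis .
  qed
  show ?thesis
  \<comment> \<open>Either the whole line lies in \<Theta> and every real ratio is admissible, or
    the quadratic also takes a negative value, factors, and admissibility becomes nonnegativity of a
    new ratio.\<close>
  proof (cases "\<forall>s. 0 \<le> \<alpha> * s\<^sup>2 + \<beta> * s + \<gamma>")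
    case True
    show ?thesis
    proof (rule gram_decomposition[OF P F' G _ Z, where nonneg = False])
      show "Re ((P *\<^sub>v w) \<bullet>c w) < 0"
        if "w \<in> carrier_vec k" "w \<noteq> 0\<^sub>v k"
          "G *\<^sub>v w = 0\<^sub>v n \<or> F' *\<^sub>v w = complex_of_real s \<cdot>\<^sub>v (G *\<^sub>v w) \<and> (False \<longrightarrow> 0 \<le> s)" for w s
        using neg'[OF that(1,2)] that(3) True by blast
      show "F' * ?S * mat_adjoint G = G * ?S * mat_adjoint F'"
        by (rule eq_matI_carrier[OF sandwich_carrier[OF F' Sc G] sandwich_carrier[OF G Sc F']])
          (use XX in \<open>simp only: X_def Xt_def\<close>)
    qed simp
  next
    case False
    then obtain s0 where s0: "\<alpha> * s0\<^sup>2 + \<beta> * s0 + \<gamma> < 0" by (auto simp: not_le)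
    obtain s1 where s1: "0 \<le> \<alpha> * s1\<^sup>2 + \<beta> * s1 + \<gamma>" using ex by blast
    obtain p1 r1 p2 r2 where pr: "p1 * p2 = \<alpha>" "p1 * r2 + r1 * p2 = \<beta>" "r1 * r2 = \<gamma>" "p1 * r2 - r1 * p2 \<noteq> 0"
      by (rule real_quadratic_factor[OF \<alpha> s0 s1])
    \<comment> \<open>The linear factors of the quadratic with \<open>F'\<close> for
      \<open>s\<close> and \<open>G\<close> for 1. As \<open>Xt = X\<close>, the product
      \<open>A S B^*\<close> collects to the \<open>Sg\<close> constraint and inherits positivity
      from \<open>Y\<close>.\<close>
    define A where "A = complex_of_real p1 \<cdot>\<^sub>m F' + complex_of_real r1 \<cdot>\<^sub>m G"
    define B where "B = complex_of_real p2 \<cdot>\<^sub>m F' + complex_of_real r2 \<cdot>\<^sub>m G"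
    have A: "A \<in> carrier_mat n k" and B: "B \<in> carrier_mat n k" using F' G by (auto simp: A_def B_def)
    have Yg: "Y * mat_adjoint Y \<in> hermitian_mats n" by (rule gram_hermitian[OF Y])
    have AB: "A * ?S * mat_adjoint B = Y * mat_adjoint Y"
    proof (rule eq_matI)
      fix i j assume "i < dim_row (Y * mat_adjoint Y)" "j < dim_col (Y * mat_adjoint Y)"
      then have ij: "i < n" "j < n" using Y by auto
      have "(A * ?S * mat_adjoint B) $$ (i, j) =
          complex_of_real p1 * (complex_of_real p2 * R i j + complex_of_real r2 * X i j) +
          complex_of_real r1 * (complex_of_real p2 * Xt i j + complex_of_real r2 * Q i j)"
        unfolding A_def sandwich_comb_left[OF F' G B Sc ij] unfolding B_def
          sandwich_comb_right[OF F' G F' Sh ij] sandwich_comb_right[OF F' G G Sh ij]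
        by (simp add: X_def Xt_def Q_def R_def)
      also have "\<dots> = complex_of_real (p1 * p2) * R i j + complex_of_real (p1 * r2 + r1 * p2) * X i j + complex_of_real (r1 * r2) * Q i j"
        by (simp add: XX[OF ij] algebra_simps)
      finally show "(A * ?S * mat_adjoint B) $$ (i, j) = (Y * mat_adjoint Y) $$ (i, j)"
        unfolding YY[OF ij] pr(1-3) .
    qed (use A B Y in auto)
    have Aw: "A *\<^sub>v w = complex_of_real p1 \<cdot>\<^sub>v (F' *\<^sub>v w) + complex_of_real r1 \<cdot>\<^sub>v (G *\<^sub>v w)"
      and Bw: "B *\<^sub>v w = complex_of_real p2 \<cdot>\<^sub>v (F' *\<^sub>v w) + complex_of_real r2 \<cdot>\<^sub>v (G *\<^sub>v w)"
      if "w \<in> carrier_vec k" for w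
      using that F' G unfolding A_def B_def
      by (simp_all add: add_mult_distrib_mat_vec[of _ n k] smult_mat_mult_vec_assoc[of _ n k])
    show ?thesis
    proof (rule gram_decomposition[OF P A B _ Z, where nonneg = True])
      show "Re ((P *\<^sub>v w) \<bullet>c w) < 0"
        if w: "w \<in> carrier_vec k" "w \<noteq> 0\<^sub>v k"
          and g: "B *\<^sub>v w = 0\<^sub>v n \<or> A *\<^sub>v w = complex_of_real s \<cdot>\<^sub>v (B *\<^sub>v w) \<and> (True \<longrightarrow> 0 \<le> s)" for w s
      proof -
        have c: "F' *\<^sub>v w \<in> carrier_vec n" "G *\<^sub>v w \<in> carrier_vec n" using F' G w(1) by auto
        show ?thesis
          using neg'[OF w moebius_ratio[OF c pr, of s]] g unfolding Aw[OF w(1)] Bw[OF w(1)] by blast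
      qed
      show "A * ?S * mat_adjoint B = B * ?S * mat_adjoint A"
        using sandwich_adjoint[OF A B Sh] AB hermitian_matsD(2)[OF Yg] by simp
      show "0 \<le> Re ((A * ?S * mat_adjoint B *\<^sub>v y) \<bullet>c y)" if y: "y \<in> carrier_vec n" for y
      proof -
        have aY: "mat_adjoint Y \<in> carrier_mat n n" using Y by simp
        have "(Y * mat_adjoint Y *\<^sub>v y) \<bullet>c y = (mat_adjoint Y *\<^sub>v y) \<bullet>c (mat_adjoint Y *\<^sub>v y)"
          using assoc_mult_mat_vec[OF Y aY y] scalar_prod_adjoint[OF Y _ y, of "mat_adjoint Y *\<^sub>v y"] aY y by simp
        then show ?thesis unfolding AB by (simp add: cscalar_prod_self sum_nonneg)
      qed
    qed
  qed
qed

section \<open>The equivalence\<close>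

lemma congruence_hermitian:
  assumes S: "S \<in> carrier_mat k r" and P: "P \<in> hermitian_mats k"
  shows "mat_adjoint S * P * S \<in> hermitian_mats r"
proof -
  note P' = hermitian_matsD(1)[OF P]
  have aS: "mat_adjoint S \<in> carrier_mat r k" using S by simp
  show ?thesis
    using sandwich_adjoint[OF aS aS P] sandwich_carrier[OF aS P' aS] by (simp add: hermitian_mats_def)
qed

lemma congruence_form:
  assumes S: "(S :: complex mat) \<in> carrier_mat k r" and P: "P \<in> carrier_mat k k" and v: "v \<in> carrier_vec r"
  shows "((mat_adjoint S * P * S) *\<^sub>v v) \<bullet>c v = (P *\<^sub>v (S *\<^sub>v v)) \<bullet>c (S *\<^sub>v v)"
proof -
  have aS: "mat_adjoint S \<in> carrier_mat r k" using S by simp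
  have Sv: "S *\<^sub>v v \<in> carrier_vec k" using S v by simp
  have PSv: "P *\<^sub>v (S *\<^sub>v v) \<in> carrier_vec k" using P Sv by simp
  have "(mat_adjoint S * P * S) *\<^sub>v v = mat_adjoint S *\<^sub>v (P *\<^sub>v (S *\<^sub>v v))"
    using assoc_mult_mat_vec[OF mult_carrier_mat[OF aS P] S v] assoc_mult_mat_vec[OF aS P Sv] by simp
  then show ?thesis using scalar_prod_adjoint[OF aS PSv v] by simp
qed

lemma neg_def_on_kernel:
  assumes A: "A \<in> carrier_mat nr k" and S: "is_null_basis A S" and P: "P \<in> hermitian_mats k"
  shows "neg_def (mat_adjoint S * P * S) \<longleftrightarrow>
    (\<forall>z \<in> mat_kernel A. z \<noteq> 0\<^sub>v k \<longrightarrow> Re ((P *\<^sub>v z) \<bullet>c z) < 0)"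
proof -
  have Sc: "S \<in> carrier_mat k (dim_col S)" using S A by (auto simp: is_null_basis_def)
  show ?thesis
    unfolding neg_def_iff[OF congruence_hermitian[OF Sc P]]
    using congruence_form[OF Sc hermitian_matsD(1)[OF P]] null_basis_image[OF A S] by metis
qed

lemma cscalar_prod_smult:
  assumes "u \<in> carrier_vec n" "v \<in> carrier_vec n"
  shows "(a \<cdot>\<^sub>v u) \<bullet>c v = a * (u \<bullet>c (v :: complex vec))" "u \<bullet>c (a \<cdot>\<^sub>v v) = cnj a * (u \<bullet>c v)"
    "(a \<cdot>\<^sub>v u) \<bullet>c (b \<cdot>\<^sub>v v) = a * cnj b * (u \<bullet>c v)"
  using assms by (auto simp: scalar_prod_def sum_distrib_left mult_ac intro!: sum.cong)

lemma lmi_iff: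
  assumes P: "P \<in> hermitian_mats k" and N: "N \<in> carrier_mat (2 * n) k"
    and D: "D \<in> hermitian_mats 2" and Sg: "Sg \<in> hermitian_mats 2"
    and U: "U \<in> hermitian_mats n" and V: "V \<in> hermitian_mats n"
  shows "neg_def (mat_adjoint N * (D \<otimes>\<^sub>K U + Sg \<otimes>\<^sub>K V) * N + P) \<longleftrightarrow>
    (\<forall>w \<in> carrier_vec k. w \<noteq> 0\<^sub>v k \<longrightarrow>
      Re (tr_prod U (block_form D (top_rows n N) (bottom_rows n N) (outer w w)) +
        tr_prod V (block_form Sg (top_rows n N) (bottom_rows n N) (outer w w)) + (P *\<^sub>v w) \<bullet>c w) < 0)"
proof -
  note R = rows_carrier[OF N]
  note D' = hermitian_matsD(1)[OF D] and Sg' = hermitian_matsD(1)[OF Sg]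
    and U' = hermitian_matsD(1)[OF U] and V' = hermitian_matsD(1)[OF V] and P' = hermitian_matsD(1)[OF P]
  let ?K = "D \<otimes>\<^sub>K U + Sg \<otimes>\<^sub>K V"
  have DU: "D \<otimes>\<^sub>K U \<in> carrier_mat (2 * n) (2 * n)" and SV: "Sg \<otimes>\<^sub>K V \<in> carrier_mat (2 * n) (2 * n)"
    by (rule kronecker_2_carrier[OF D' U'], rule kronecker_2_carrier[OF Sg' V'])
  have add: "A + B \<in> hermitian_mats l" if "A \<in> hermitian_mats l" "B \<in> hermitian_mats l" for A B l
    using hermitian_matsD(1)[OF that(1)] hermitian_matsD(1)[OF that(2)] hermitian_mats_cnj[OF that(1)] hermitian_mats_cnj[OF that(2)]
    by (intro hermitian_matsI) auto
  have K: "?K \<in> hermitian_mats (2 * n)"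
    by (rule add[OF kronecker_hermitian[OF D U] kronecker_hermitian[OF Sg V]])
  note K' = hermitian_matsD(1)[OF K]
  have NK: "mat_adjoint N * ?K * N \<in> hermitian_mats k" by (rule congruence_hermitian[OF N K])
  note NK' = hermitian_matsD(1)[OF NK]
  have form: "((mat_adjoint N * ?K * N + P) *\<^sub>v w) \<bullet>c w =
      tr_prod U (block_form D (top_rows n N) (bottom_rows n N) (outer w w)) +
        tr_prod V (block_form Sg (top_rows n N) (bottom_rows n N) (outer w w)) + (P *\<^sub>v w) \<bullet>c w"
    if w: "w \<in> carrier_vec k" for w
  proof -
    let ?f = "top_rows n N *\<^sub>v w" and ?g = "bottom_rows n N *\<^sub>v w"
    have fg: "?f \<in> carrier_vec n" "?g \<in> carrier_vec n" using R w by auto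
    have Nw: "N *\<^sub>v w = ?f @\<^sub>v ?g" by (rule rows_split_vec[OF N w])
    have Nwc: "N *\<^sub>v w \<in> carrier_vec (2 * n)" using N w by simp
    have kron: "((E \<otimes>\<^sub>K X) *\<^sub>v (N *\<^sub>v w)) \<bullet>c (N *\<^sub>v w) =
        tr_prod X (block_form E (top_rows n N) (bottom_rows n N) (outer w w))"
      if "E \<in> carrier_mat 2 2" "X \<in> carrier_mat n n" for E X
      unfolding Nw kronecker_form[OF that fg] tr_prod_block_form_outer[OF R that(2) w] ..
    have "((mat_adjoint N * ?K * N + P) *\<^sub>v w) \<bullet>c w = ((mat_adjoint N * ?K * N) *\<^sub>v w) \<bullet>c w + (P *\<^sub>v w) \<bullet>c w"
      unfolding add_mult_distrib_mat_vec[OF NK' P' w]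
      using NK' P' w by (intro add_scalar_prod_distrib[of _ k]) (auto intro: mult_mat_vec_carrier)
    also have "((mat_adjoint N * ?K * N) *\<^sub>v w) \<bullet>c w = (?K *\<^sub>v (N *\<^sub>v w)) \<bullet>c (N *\<^sub>v w)"
      by (rule congruence_form[OF N K' w])
    also have "\<dots> = ((D \<otimes>\<^sub>K U) *\<^sub>v (N *\<^sub>v w)) \<bullet>c (N *\<^sub>v w) + ((Sg \<otimes>\<^sub>K V) *\<^sub>v (N *\<^sub>v w)) \<bullet>c (N *\<^sub>v w)"
      unfolding add_mult_distrib_mat_vec[OF DU SV Nwc]
      using mult_mat_vec_carrier[OF DU Nwc] mult_mat_vec_carrier[OF SV Nwc] Nwc
      by (intro add_scalar_prod_distrib[of _ "2 * n"]) auto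
    finally show ?thesis unfolding kron[OF D' U'] kron[OF Sg' V'] .
  qed
  show ?thesis
    unfolding neg_def_iff[OF add[OF NK P]] by (intro ball_cong refl) (simp only: form)
qed

theorem theorem20:
  fixes n m :: nat
    and P N D Sg :: "complex mat"
    and S :: "ext_complex \<Rightarrow> complex mat"
  assumes "P \<in> hermitian_mats (n + m)"
    and "N \<in> carrier_mat (2 * n) (n + m)"
    and "D \<in> hermitian_mats 2"
    and "Sg \<in> hermitian_mats 2"
    and "represents_curves (Theta D Sg)"
    and "Theta D Sg \<subseteq> {z. Re z \<ge> 0}"
    and "Theta_bar D Sg = Fin ` Theta D Sg \<union> {Infty}"
    and "\<And>\<theta>. is_null_basis (Xi n \<theta> * N) (S \<theta>)"
  shows "(\<forall>\<theta> \<in> Theta_bar D Sg. neg_def (mat_adjoint (S \<theta>) * P * S \<theta>)) \<longleftrightarrow>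
         (\<exists>U \<in> hermitian_mats n. \<exists>V \<in> hermitian_mats n. pos_def V \<and>
            neg_def (mat_adjoint N * (D \<otimes>\<^sub>K U + Sg \<otimes>\<^sub>K V) * N + P))"
proof -
  note P = assms(1) and N = assms(2) and D = assms(3) and Sg = assms(4)
  let ?k = "n + m" and ?F = "top_rows n N" and ?G = "bottom_rows n N" and ?T = "Theta D Sg"
  note R = rows_carrier[OF N]
  \<comment> \<open>Infinity belongs to \<open>Theta_bar\<close> only in the unbounded case.\<close>
  have unb: "\<not> bounded ?T"
  proof
    assume b: "bounded ?T"
    have "Infty \<in> Theta_bar D Sg" unfolding assms(7) by simp
    then show False using b by (auto simp: Theta_bar_def)
  qed
  note line = unbounded_Theta_line[OF D Sg unb represents_curves_interior_empty[OF assms(5)]]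
  define good where "good w \<longleftrightarrow> ?G *\<^sub>v w = 0\<^sub>v n \<or> (\<exists>\<theta> \<in> ?T. ?F *\<^sub>v w = \<theta> \<cdot>\<^sub>v (?G *\<^sub>v w))" for w
  have Xi_carrier: "Xi n \<theta> * N \<in> carrier_mat n ?k" for \<theta>
    using R by (cases \<theta>) (simp_all only: Xi_mult_finite[OF N] Xi_mult_infinite[OF N], auto)
  have lhs: "(\<forall>\<theta> \<in> Theta_bar D Sg. neg_def (mat_adjoint (S \<theta>) * P * S \<theta>)) \<longleftrightarrow>
      (\<forall>w \<in> carrier_vec ?k. w \<noteq> 0\<^sub>v ?k \<longrightarrow> good w \<longrightarrow> Re ((P *\<^sub>v w) \<bullet>c w) < 0)"
  proof -
    define Q where "Q \<theta> \<longleftrightarrow> neg_def (mat_adjoint (S \<theta>) * P * S \<theta>)" for \<theta>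
    have Qf: "Q (Fin \<theta>) \<longleftrightarrow> (\<forall>w \<in> carrier_vec ?k. w \<noteq> 0\<^sub>v ?k \<longrightarrow>
        ?F *\<^sub>v w = \<theta> \<cdot>\<^sub>v (?G *\<^sub>v w) \<longrightarrow> Re ((P *\<^sub>v w) \<bullet>c w) < 0)" for \<theta>
      unfolding Q_def neg_def_on_kernel[OF Xi_carrier assms(8) P] Ball_def kernel_Xi_finite[OF N] by blast
    have Qi: "Q Infty \<longleftrightarrow> (\<forall>w \<in> carrier_vec ?k. w \<noteq> 0\<^sub>v ?k \<longrightarrow>
        ?G *\<^sub>v w = 0\<^sub>v n \<longrightarrow> Re ((P *\<^sub>v w) \<bullet>c w) < 0)"
      unfolding Q_def neg_def_on_kernel[OF Xi_carrier assms(8) P] Ball_def kernel_Xi_infinite[OF N] by blast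
    have "(\<forall>\<theta> \<in> Theta_bar D Sg. Q \<theta>) \<longleftrightarrow> (\<forall>\<theta> \<in> ?T. Q (Fin \<theta>)) \<and> Q Infty"
      unfolding assms(7) by blast
    then show ?thesis unfolding Qf Qi good_def Q_def[symmetric] by blast
  qed
  show ?thesis
    unfolding lhs
  proof
    assume neg: "\<forall>w \<in> carrier_vec ?k. w \<noteq> 0\<^sub>v ?k \<longrightarrow> good w \<longrightarrow> Re ((P *\<^sub>v w) \<bullet>c w) < 0"
    have ne: "?T \<noteq> {}" using unb by auto
    have neg': "Re ((P *\<^sub>v w) \<bullet>c w) < 0"
      if "w \<in> carrier_vec ?k" "w \<noteq> 0\<^sub>v ?k"
        "?G *\<^sub>v w = 0\<^sub>v n \<or> (\<exists>\<theta> \<in> ?T. ?F *\<^sub>v w = \<theta> \<cdot>\<^sub>v (?G *\<^sub>v w))" for w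
      using neg that unfolding good_def by blast
    have "\<exists>U \<in> hermitian_mats n. \<exists>V \<in> hermitian_mats n. pos_def V \<and>
      (\<forall>w \<in> carrier_vec ?k. w \<noteq> 0\<^sub>v ?k \<longrightarrow>
        Re (tr_prod U (block_form D ?F ?G (outer w w)) + tr_prod V (block_form Sg ?F ?G (outer w w)) +
          (P *\<^sub>v w) \<bullet>c w) < 0)"
    proof (rule lmi_alternative[OF P R D Sg])
      fix Z Y
      assume ZY: "Z \<in> carrier_mat ?k ?k" "Y \<in> carrier_mat n n"
        "block_form D ?F ?G (Z * mat_adjoint Z) = 0\<^sub>m n n"
        "block_form Sg ?F ?G (Z * mat_adjoint Z) = Y * mat_adjoint Y"
      show "Z = 0\<^sub>m ?k ?k \<or> Re (tr_prod P (Z * mat_adjoint Z)) < 0"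
        by (rule constrained_gram[OF hermitian_matsD(1)[OF P] R D Sg line ne _ ZY]) (rule neg')
    qed
    then obtain U V where UV: "U \<in> hermitian_mats n" "V \<in> hermitian_mats n" "pos_def V"
      "\<forall>w \<in> carrier_vec ?k. w \<noteq> 0\<^sub>v ?k \<longrightarrow>
        Re (tr_prod U (block_form D ?F ?G (outer w w)) + tr_prod V (block_form Sg ?F ?G (outer w w)) +
          (P *\<^sub>v w) \<bullet>c w) < 0"
      by (elim bexE conjE)
    then show "\<exists>U \<in> hermitian_mats n. \<exists>V \<in> hermitian_mats n. pos_def V \<and>
        neg_def (mat_adjoint N * (D \<otimes>\<^sub>K U + Sg \<otimes>\<^sub>K V) * N + P)"
      unfolding lmi_iff[OF P N D Sg UV(1,2), symmetric] by (intro bexI conjI)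
  next
    assume "\<exists>U \<in> hermitian_mats n. \<exists>V \<in> hermitian_mats n. pos_def V \<and>
        neg_def (mat_adjoint N * (D \<otimes>\<^sub>K U + Sg \<otimes>\<^sub>K V) * N + P)"
    then obtain U V where U: "U \<in> hermitian_mats n" and V: "V \<in> hermitian_mats n" and pos: "pos_def V"
      and neg: "neg_def (mat_adjoint N * (D \<otimes>\<^sub>K U + Sg \<otimes>\<^sub>K V) * N + P)" by blast
    note U' = hermitian_matsD(1)[OF U] and V' = hermitian_matsD(1)[OF V]
    have Vnn: "0 \<le> Re ((V *\<^sub>v x) \<bullet>c x)" if "x \<in> carrier_vec n" for x
      using pos that V' unfolding pos_def_iff[OF V] by (cases "x = 0\<^sub>v n") (auto intro: less_imp_le)
    show "\<forall>w \<in> carrier_vec ?k. w \<noteq> 0\<^sub>v ?k \<longrightarrow> good w \<longrightarrow> Re ((P *\<^sub>v w) \<bullet>c w) < 0"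
    proof (intro ballI impI)
      fix w :: "complex vec"
      assume w: "w \<in> carrier_vec ?k" "w \<noteq> 0\<^sub>v ?k" and good: "good w"
      let ?f = "?F *\<^sub>v w" and ?g = "?G *\<^sub>v w"
      have fg: "?f \<in> carrier_vec n" "?g \<in> carrier_vec n" using R w by auto
      let ?q = "\<lambda>E X. tr_prod X (block_form E ?F ?G (outer w w))"
      \<comment> \<open>Both forms factor at \<open>w\<close>. With \<open>g = 0\<close> only the
        coefficient at \<open>(0, 0)\<close> remains; with \<open>f = \<theta> g\<close> the
        coefficients assemble to \<open>rho \<theta>\<close>. In either case the factor is zero for
        \<open>D\<close> and nonnegative for \<open>Sg\<close>.\<close>
      have "0 \<le> Re (?q D U) \<and> 0 \<le> Re (?q Sg V)"
        using good unfolding good_def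
      proof
        assume g: "?g = 0\<^sub>v n"
        have q: "?q E X = E $$ (0, 0) * ((X *\<^sub>v ?f) \<bullet>c ?f)" if X: "X \<in> carrier_mat n n" for E X
        proof -
          have "X *\<^sub>v 0\<^sub>v n = 0\<^sub>v n" using X by (intro eq_vecI) auto
          then show ?thesis unfolding tr_prod_block_form_outer[OF R X w(1)] g using X fg by simp
        qed
        have "Im (Sg $$ (0, 0)) = 0" using hermitian_mats_cnj[OF Sg, of 0 0] by (simp add: complex_eq_iff)
        then show ?thesis unfolding q[OF U'] q[OF V'] using line(1,3) Vnn[OF fg(1)] by simp
      next
        assume "\<exists>\<theta> \<in> ?T. ?f = \<theta> \<cdot>\<^sub>v ?g"
        then obtain \<theta> where \<theta>: "\<theta> \<in> ?T" "?f = \<theta> \<cdot>\<^sub>v ?g" by blast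
        have q: "?q E X = rho \<theta> E * ((X *\<^sub>v ?g) \<bullet>c ?g)" if E: "E \<in> carrier_mat 2 2" and X: "X \<in> carrier_mat n n" for E X
          unfolding tr_prod_block_form_outer[OF R X w(1)] \<theta>(2) rho_eq[OF E]
          using cscalar_prod_smult[OF mult_mat_vec_carrier[OF X fg(2)] fg(2)]
          by (simp add: mult_mat_vec[OF X fg(2)] algebra_simps)
        have "rho \<theta> D = 0" "0 \<le> Re (rho \<theta> Sg)" "Im (rho \<theta> Sg) = 0"
          using \<theta>(1) by (auto simp: Theta_def less_eq_complex_def)
        then show ?thesis
          unfolding q[OF hermitian_matsD(1)[OF D] U'] q[OF hermitian_matsD(1)[OF Sg] V'] using Vnn[OF fg(2)] by simp
      qed
      moreover have "Re (?q D U + ?q Sg V + (P *\<^sub>v w) \<bullet>c w) < 0"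
        using neg w unfolding lmi_iff[OF P N D Sg U V] by blast
      ultimately show "Re ((P *\<^sub>v w) \<bullet>c w) < 0" by simp
    qed
  qed
qed

end
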